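(* Let $n\geq7$, let $\mathcal{B}^n_f$ be a unit geodesic ball with warping function $f$, let $0<a<\pi/2$, and let $\varphi_a:\mathcal{B}^n_f\to\mathbb{S}^n$ be the map $(w,\rho)\mapsto(w,a)$. (i) If $\varphi_a$ is weakly triharmonic, then $n=7$. (ii) If $n=7$, $f(\rho)$ is a real analytic function in a neighbourhood of $\rho=0$ and $\varphi_a$ is weakly triharmonic, then $\mathcal{B}^n_f$ is the Euclidean unit ball $B^n$ (i.e. $f(\rho)=\rho$) and $a=\frac12\arccos\left(\frac19\left(2\sqrt{10}-11\right)\right)$.
   Context: Let $g_{\mathbb{S}}$ be the standard metric on $\mathbb{S}^{n-1}$. $\mathcal{B}^n_f$ denotes the unit geodesic ball, centred at the pole, given by the warped product $\left(\mathbb{S}^{n-1}\times I,\ f^2(\rho)g_{\mathbb{S}}+d\rho^2\right)$ with $\overline{I}=[0,1]$, where $f$ is smooth, positive on $I$, and satisfies the smoothness conditions at the pole $f(0)=0$, $f'(0)=1$, $f^{(2k)}(0)=0$ for all $k\ge1$ (the locus $\rho=0$ is collapsed to the pole). The case $f(\rho)=\rho$ is the Euclidean unit ball. The target sphere is written as $\mathbb{S}^n=\left(\mathbb{S}^{n-1}\times[0,\pi],\ \sin^2\!\alpha\,g_{\mathbb{S}}+d\alpha^2\right)$, so that $\varphi_a$ sends $(w,\rho)$ to $(w,a)$; it is smooth away from the pole. For a smooth map $\varphi:(M,g_M)\to(N,g_N)$, $m=\dim M$, the tension field is $\tau(\varphi)=\mathrm{trace}_{g_M}\nabla d\varphi$,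 and $\varphi$ is triharmonic ($3$-harmonic) if it is a critical point of $E_3(\varphi)=\frac12\int_M\sum_{j=1}^m|\nabla^\varphi_{e_j}\tau(\varphi)|^2\,dV$, $\{e_j\}$ a local orthonormal frame. With $\mathbb{S}^n\subset\mathbb{R}^{n+1}$, $W^{3,2}(M,\mathbb{S}^n)$ is the set of $\varphi\in W^{3,2}(M,\mathbb{R}^{n+1})$ with values in $\mathbb{S}^n$ a.e.; a map in $W^{3,2}(M,\mathbb{S}^n)$ is weakly triharmonic if it solves the Euler-Lagrange equation of $E_3$ in the sense of distributions. For the maps $\varphi_a$ this is used in the equivalent form: $\varphi_a\in W^{3,2}(\mathcal{B}^n_f,\mathbb{S}^n)$ and $\varphi_a$ is triharmonic away from the pole. *)

theory Defs
  imports "HOL-Analysis.Analysis"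
begin

section \<open>Smooth functions\<close>

text \<open>Smoothness on an open set \<open>U\<close>.\<close>

primrec Ck_on ::
  "nat \<Rightarrow> 'a::real_normed_vector set \<Rightarrow> ('a \<Rightarrow> 'b::real_normed_vector) \<Rightarrow> bool" where
  "Ck_on 0 U F \<longleftrightarrow> continuous_on U F"
| "Ck_on (Suc k) U F \<longleftrightarrow>
     (\<forall>x\<in>U. F differentiable (at x)) \<and> (\<forall>v. Ck_on k U (\<lambda>x. frechet_derivative F (at x) v))"

definition smooth_on ::
  "'a::real_normed_vector set \<Rightarrow> ('a \<Rightarrow> 'b::real_normed_vector) \<Rightarrow> bool" where
  "smooth_on U F \<longleftrightarrow> (\<forall>k. Ck_on k U F)"

definition pd :: "'n \<Rightarrow> (real^'n::finite \<Rightarrow> 'b::real_normed_vector) \<Rightarrow> real^'n \<Rightarrow> 'b" where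
  "pd i F x = frechet_derivative F (at x) (axis i 1)"


section \<open>Riemannian geometry in one chart\<close>

text \<open>A Riemannian metric on an open subset of \<open>\<real>\<^sup>n\<close> is given by its Gram matrix \<open>g x\<close> in the
  coordinate frame.  Maps take values in the unit sphere of a Euclidean space \<open>'b\<close>.\<close>

definition christoffel ::
  "(real^'n::finite \<Rightarrow> real^'n^'n) \<Rightarrow> 'n \<Rightarrow> 'n \<Rightarrow> 'n \<Rightarrow> real^'n \<Rightarrow> real" where
  "christoffel g k i j x =
     (\<Sum>l\<in>UNIV. matrix_inv (g x) $ k $ l *
        (pd i (\<lambda>y. g y $ j $ l) x + pd j (\<lambda>y. g y $ i $ l) x - pd l (\<lambda>y. g y $ i $ j) x)) / 2"

text \<open>Trace of a bilinear form with coefficients \<open>B i j\<close>; it equals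
  \<open>\<Sum>\<^sub>j B(e\<^sub>j, e\<^sub>j)\<close> for any \<open>g\<close>-orthonormal frame \<open>e\<^sub>j\<close>.\<close>

definition trace_g :: "real^'n^'n \<Rightarrow> ('n::finite \<Rightarrow> 'n \<Rightarrow> 'b::real_vector) \<Rightarrow> 'b" where
  "trace_g G B = (\<Sum>i\<in>UNIV. \<Sum>j\<in>UNIV. (matrix_inv G $ i $ j) *\<^sub>R B i j)"

definition vol_density :: "(real^'n::finite \<Rightarrow> real^'n^'n) \<Rightarrow> real^'n \<Rightarrow> real" where
  "vol_density g x = sqrt (det (g x))"

text \<open>Pull-back by \<open>\<phi>\<close> of the Levi-Civita connection of the unit sphere: the derivative in the
  ambient space followed by the orthogonal projection to the tangent space at \<open>\<phi> x\<close>.\<close>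

definition pullback_conn ::
  "(real^'n::finite \<Rightarrow> 'b::euclidean_space) \<Rightarrow> 'n \<Rightarrow> (real^'n \<Rightarrow> 'b) \<Rightarrow> real^'n \<Rightarrow> 'b" where
  "pullback_conn \<phi> i V x = pd i V x - (pd i V x \<bullet> \<phi> x) *\<^sub>R \<phi> x"

definition second_fundamental_form ::
  "(real^'n::finite \<Rightarrow> real^'n^'n) \<Rightarrow> (real^'n \<Rightarrow> 'b::euclidean_space) \<Rightarrow>
     'n \<Rightarrow> 'n \<Rightarrow> real^'n \<Rightarrow> 'b" where
  "second_fundamental_form g \<phi> i j x =
     pullback_conn \<phi> i (pd j \<phi>) x - (\<Sum>k\<in>UNIV. christoffel g k i j x *\<^sub>R pd k \<phi> x)"

definition tension ::
  "(real^'n::finite \<Rightarrow> real^'n^'n) \<Rightarrow> (real^'n \<Rightarrow> 'b::euclidean_space) \<Rightarrow> real^'n \<Rightarrow> 'b" where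
  "tension g \<phi> x = trace_g (g x) (\<lambda>i j. second_fundamental_form g \<phi> i j x)"

definition E3 ::
  "(real^'n::finite \<Rightarrow> real^'n^'n) \<Rightarrow> (real^'n \<Rightarrow> 'b::euclidean_space) \<Rightarrow> (real^'n) set \<Rightarrow> real" where
  "E3 g \<phi> K =
     (LINT x:K|lborel.
        trace_g (g x) (\<lambda>i j. pullback_conn \<phi> i (tension g \<phi>) x \<bullet> pullback_conn \<phi> j (tension g \<phi>) x)
        * vol_density g x) / 2"

text \<open>Variations are compactly supported: they are constant in time off a compact \<open>K\<close>, and the
  energy is compared on \<open>K\<close>, where it is finite.\<close>

definition triharmonic_on ::
  "(real^'n::finite) set \<Rightarrow> (real^'n \<Rightarrow> real^'n^'n) \<Rightarrow> (real^'n \<Rightarrow> 'b::euclidean_space) \<Rightarrow> bool" where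
  "triharmonic_on U g \<phi> \<longleftrightarrow>
     smooth_on U \<phi> \<and> \<phi> ` U \<subseteq> sphere 0 1 \<and>
     (\<forall>\<epsilon> K (\<Phi> :: real \<times> (real^'n) \<Rightarrow> 'b).
        0 < \<epsilon> \<longrightarrow> compact K \<longrightarrow> K \<subseteq> U \<longrightarrow>
        smooth_on ({-\<epsilon><..<\<epsilon>} \<times> U) \<Phi> \<longrightarrow>
        (\<forall>t\<in>{-\<epsilon><..<\<epsilon>}. \<forall>x\<in>U. \<Phi> (t, x) \<in> sphere 0 1) \<longrightarrow>
        (\<forall>x\<in>U. \<Phi> (0, x) = \<phi> x) \<longrightarrow>
        (\<forall>t\<in>{-\<epsilon><..<\<epsilon>}. \<forall>x\<in>U - K. \<Phi> (t, x) = \<phi> x) \<longrightarrow>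
        ((\<lambda>t. E3 g (\<lambda>x. \<Phi> (t, x)) K) has_real_derivative 0) (at 0))"


section \<open>Sobolev maps\<close>

definition locally_integrable_on ::
  "(real^'n::finite) set \<Rightarrow> (real^'n \<Rightarrow> 'b::euclidean_space) \<Rightarrow> bool" where
  "locally_integrable_on U u \<longleftrightarrow> (\<forall>K. compact K \<longrightarrow> K \<subseteq> U \<longrightarrow> set_integrable lborel K u)"

text \<open>\<open>v\<close> is the \<open>i\<close>-th partial derivative of \<open>u\<close> on \<open>U\<close> in the sense of distributions.\<close>

definition weak_pd ::
  "(real^'n::finite) set \<Rightarrow> 'n \<Rightarrow> (real^'n \<Rightarrow> 'b::euclidean_space) \<Rightarrow> (real^'n \<Rightarrow> 'b) \<Rightarrow> bool" where
  "weak_pd U i u v \<longleftrightarrow>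
     locally_integrable_on U u \<and> locally_integrable_on U v \<and>
     (\<forall>(\<psi> :: real^'n \<Rightarrow> real) K.
        smooth_on UNIV \<psi> \<longrightarrow> compact K \<longrightarrow> K \<subseteq> U \<longrightarrow> (\<forall>x. x \<notin> K \<longrightarrow> \<psi> x = 0) \<longrightarrow>
        (LINT x:K|lborel. pd i \<psi> x *\<^sub>R u x) = - (LINT x:K|lborel. \<psi> x *\<^sub>R v x))"

text \<open>\<open>u1\<close>, \<open>u2\<close>, \<open>u3\<close> are the components of the weak covariant derivatives \<open>\<nabla>u\<close>, \<open>\<nabla>\<^sup>2u\<close>, \<open>\<nabla>\<^sup>3u\<close>;
  the Christoffel terms come from \<open>\<nabla>\<^sub>i u\<^sub>j = \<partial>\<^sub>i u\<^sub>j - \<Gamma>\<^sup>k\<^sub>i\<^sub>j u\<^sub>k\<close> and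
  \<open>\<nabla>\<^sub>i u\<^sub>j\<^sub>k = \<partial>\<^sub>i u\<^sub>j\<^sub>k - \<Gamma>\<^sup>l\<^sub>i\<^sub>j u\<^sub>l\<^sub>k - \<Gamma>\<^sup>l\<^sub>i\<^sub>k u\<^sub>j\<^sub>l\<close>.\<close>

definition W32 ::
  "(real^'n::finite) set \<Rightarrow> (real^'n \<Rightarrow> real^'n^'n) \<Rightarrow> (real^'n \<Rightarrow> 'b::euclidean_space) \<Rightarrow> bool" where
  "W32 U g u \<longleftrightarrow>
     (\<exists>u1 u2 u3.
        (\<forall>i. weak_pd U i u (u1 i)) \<and>
        (\<forall>i j. weak_pd U i (u1 j)
           (\<lambda>x. u2 i j x + (\<Sum>k\<in>UNIV. christoffel g k i j x *\<^sub>R u1 k x))) \<and>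
        (\<forall>i j k. weak_pd U i (u2 j k)
           (\<lambda>x. u3 i j k x + (\<Sum>l\<in>UNIV. christoffel g l i j x *\<^sub>R u2 l k x)
                           + (\<Sum>l\<in>UNIV. christoffel g l i k x *\<^sub>R u2 j l x))) \<and>
        set_integrable lborel U (\<lambda>x. (u x \<bullet> u x) * vol_density g x) \<and>
        set_integrable lborel U (\<lambda>x.
          trace_g (g x) (\<lambda>i i'. u1 i x \<bullet> u1 i' x) * vol_density g x) \<and>
        set_integrable lborel U (\<lambda>x.
          trace_g (g x) (\<lambda>i i'. trace_g (g x) (\<lambda>j j'. u2 i j x \<bullet> u2 i' j' x)) * vol_density g x) \<and>
        set_integrable lborel U (\<lambda>x.
          trace_g (g x) (\<lambda>i i'. trace_g (g x) (\<lambda>j j'. trace_g (g x) (\<lambda>k k'.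
            u3 i j k x \<bullet> u3 i' j' k' x))) * vol_density g x))"

definition W32_sphere ::
  "(real^'n::finite) set \<Rightarrow> (real^'n \<Rightarrow> real^'n^'n) \<Rightarrow> (real^'n \<Rightarrow> 'b::euclidean_space) \<Rightarrow> bool" where
  "W32_sphere U g \<phi> \<longleftrightarrow> W32 U g \<phi> \<and> (AE x in lborel. x \<in> U \<longrightarrow> \<phi> x \<in> sphere 0 1)"


section \<open>The geodesic ball and the map \<open>\<phi>\<^sub>a\<close>\<close>

text \<open>Iterated derivatives within \<open>S\<close>, one-sided at the end points of an interval \<open>S\<close>.\<close>

definition nderiv_within :: "real set \<Rightarrow> nat \<Rightarrow> (real \<Rightarrow> real) \<Rightarrow> real \<Rightarrow> real" where
  "nderiv_within S k f = ((\<lambda>h t. vector_derivative h (at t within S)) ^^ k) f"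

text \<open>The interval \<open>I\<close> is \<open>(0,1)\<close> or \<open>(0,1]\<close>: it cannot contain \<open>0\<close>, where \<open>f\<close> vanishes.
  Adding \<open>0\<close> to it accounts for the pole.\<close>

definition warping_function :: "real set \<Rightarrow> (real \<Rightarrow> real) \<Rightarrow> bool" where
  "warping_function I f \<longleftrightarrow>
     is_interval I \<and> closure I = {0..1} \<and>
     (\<forall>k. \<forall>t\<in>insert 0 I. nderiv_within (insert 0 I) k f differentiable (at t within insert 0 I)) \<and>
     (\<forall>t\<in>I. 0 < f t) \<and>
     f 0 = 0 \<and>
     nderiv_within (insert 0 I) 1 f 0 = 1 \<and>
     (\<forall>k\<ge>1. nderiv_within (insert 0 I) (2 * k) f 0 = 0)"

definition analytic_near_0 :: "(real \<Rightarrow> real) \<Rightarrow> bool" where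
  "analytic_near_0 f \<longleftrightarrow> (\<exists>r>0. \<exists>c. \<forall>t\<in>{0..<r}. (\<lambda>k. c k * t ^ k) sums f t)"

text \<open>The metric \<open>f\<^sup>2(\<rho>) g\<^sub>S + d\<rho>\<^sup>2\<close> in the geodesic normal chart \<open>(w, \<rho>) \<mapsto> \<rho> w\<close>, which
  identifies the (open) geodesic ball with the unit ball of \<open>\<real>\<^sup>n\<close> and the pole with the origin;
  the lemma below checks the formula in polar coordinates.  By the conditions on \<open>f\<close> at \<open>0\<close> the
  smooth extension of the metric to the pole is Euclidean there.\<close>

definition warped_metric :: "(real \<Rightarrow> real) \<Rightarrow> real^'n::finite \<Rightarrow> real^'n^'n" where
  "warped_metric f x =
     (if x = 0 then mat 1
      else (\<chi> i j. sgn x $ i * sgn x $ j +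
              (f (norm x) / norm x)\<^sup>2 * ((if i = j then 1 else 0) - sgn x $ i * sgn x $ j)))"

lemma warped_metric_polar:
  fixes w u u' :: "real^'n::finite" and s s' \<rho> :: real
  assumes "norm w = 1" "0 < \<rho>" "u \<bullet> w = 0" "u' \<bullet> w = 0"
  shows "((\<lambda>t. (\<rho> + t * s) *\<^sub>R (w + t *\<^sub>R u)) has_vector_derivative (\<rho> *\<^sub>R u + s *\<^sub>R w)) (at 0)"
    and "(\<rho> *\<^sub>R u + s *\<^sub>R w) \<bullet> (warped_metric f (\<rho> *\<^sub>R w) *v (\<rho> *\<^sub>R u' + s' *\<^sub>R w))
           = (f \<rho>)\<^sup>2 * (u \<bullet> u') + s * s'"
proof -
  show "((\<lambda>t. (\<rho> + t * s) *\<^sub>R (w + t *\<^sub>R u)) has_vector_derivative (\<rho> *\<^sub>R u + s *\<^sub>R w)) (at 0)"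
    by (auto intro!: derivative_eq_intros simp: has_vector_derivative_def algebra_simps)
  have ww: "w \<bullet> w = 1" using assms(1) by (simp add: dot_square_norm)
  have nz: "\<rho> *\<^sub>R w \<noteq> 0" using assms by auto
  have sg: "sgn (\<rho> *\<^sub>R w) = w" using assms by (simp add: sgn_div_norm)
  define q where "q = (f \<rho> / \<rho>)\<^sup>2"
  have M: "warped_metric f (\<rho> *\<^sub>R w) *v y = (w \<bullet> y) *\<^sub>R w + q *\<^sub>R (y - (w \<bullet> y) *\<^sub>R w)" for y
  proof -
    have "(warped_metric f (\<rho> *\<^sub>R w) *v y) $ i = ((w \<bullet> y) *\<^sub>R w + q *\<^sub>R (y - (w \<bullet> y) *\<^sub>R w)) $ i" for i
    proof -
      have "(warped_metric f (\<rho> *\<^sub>R w) *v y) $ i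
          = (\<Sum>j\<in>UNIV. (w $ i * w $ j + q * ((if i = j then 1 else 0) - w $ i * w $ j)) * y $ j)"
        using nz sg assms(1,2) by (simp add: warped_metric_def matrix_vector_mult_def q_def)
      also have "\<dots> = (\<Sum>j\<in>UNIV. (1 - q) * w $ i * (w $ j * y $ j) + (if i = j then q * y $ j else 0))"
        by (rule sum.cong) (auto simp: algebra_simps)
      also have "\<dots> = (1 - q) * w $ i * (w \<bullet> y) + q * y $ i"
        by (simp add: sum.distrib sum_distrib_left inner_vec_def)
      finally show ?thesis by (simp add: algebra_simps)
    qed
    then show ?thesis by (simp add: vec_eq_iff)
  qed
  have "q * \<rho>\<^sup>2 = (f \<rho>)\<^sup>2" using assms(2) by (simp add: q_def power_divide)
  then show "(\<rho> *\<^sub>R u + s *\<^sub>R w) \<bullet> (warped_metric f (\<rho> *\<^sub>R w) *v (\<rho> *\<^sub>R u' + s' *\<^sub>R w))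
           = (f \<rho>)\<^sup>2 * (u \<bullet> u') + s * s'"
    using assms(3,4) ww
    by (simp add: M inner_simps inner_commute power2_eq_square flip: \<open>q * \<rho>\<^sup>2 = (f \<rho>)\<^sup>2\<close>)
qed

text \<open>\<open>\<real>\<^sup>n\<^sup>+\<^sup>1\<close> is \<open>\<real>\<^sup>n \<times> \<real>\<close>, and \<open>(w, \<alpha>)\<close> is the point \<open>(sin \<alpha> w, cos \<alpha>)\<close> of the sphere, so
  that the induced metric is \<open>sin\<^sup>2\<alpha> g\<^sub>S + d\<alpha>\<^sup>2\<close>.\<close>

definition phi :: "real \<Rightarrow> real^'n::finite \<Rightarrow> (real^'n) \<times> real" where
  "phi a x = (sin a *\<^sub>R sgn x, cos a)"

text \<open>The Euler-Lagrange equation in the sense of distributions, in the form it takes for the maps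
  \<open>phi a\<close>: membership in \<open>W\<^sup>3\<^sup>,\<^sup>2\<close> over the whole ball, and criticality of the energy away from the
  pole.  It is meant only for these maps, not for maps with other singularities.\<close>

definition weakly_triharmonic_ball ::
  "(real \<Rightarrow> real) \<Rightarrow> (real^'n::finite \<Rightarrow> 'b::euclidean_space) \<Rightarrow> bool" where
  "weakly_triharmonic_ball f \<phi> \<longleftrightarrow>
     W32_sphere (ball 0 1) (warped_metric f) \<phi> \<and>
     triharmonic_on (ball 0 1 - {0}) (warped_metric f) \<phi>"

end

theory Submission
  imports Defs
begin

text \<open>
  Everything takes place among rotationally symmetric maps \<open>(w, \<rho>) \<mapsto> (w, \<alpha> \<rho>)\<close>.  Write
  \<open>m = n - 1\<close>.  The tension field of such a map is \<open>T \<eta>\<close>, where \<open>\<eta>\<close> is the unit field orthogonal to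
  the latitudes and
  \<open>T = \<alpha>'' + m (f'/f) \<alpha>' - m sin \<alpha> cos \<alpha> / f\<^sup>2\<close>, and its energy density is
  \<open>(T')\<^sup>2 + m cos\<^sup>2 \<alpha> T\<^sup>2 / f\<^sup>2\<close> (\<open>tension_equivariant\<close>, \<open>triharmonic_density_equivariant\<close>).  In
  polar coordinates \<open>E\<^sub>3\<close> becomes a one-dimensional integral with weight \<open>f\<^sup>m\<close>
  (\<open>E3_equivariant\<close>).  Criticality of \<open>\<phi>\<^sub>a\<close> under the variations \<open>a + t \<beta> \<rho>\<close> with \<open>\<beta>\<close> a bump function
  is an ordinary differential equation of fourth order for the warping function \<open>f\<close> on
  \<open>(0, 1)\<close>, polynomial in \<open>f, f', \<dots>, f\<^sup>(\<^sup>4\<^sup>)\<close> (\<open>first_variation\<close>, \<open>triharmonic_ode\<close>).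

  This equation is homogeneous under dilations, and at the pole \<open>f\<close> is asymptotic to \<open>\<rho>\<close>.
  Letting \<open>\<rho> \<rightarrow> 0\<close> therefore shows that the Euclidean warping function solves the equation too
  (\<open>triharmonic_pole_condition\<close>), which is a quadratic condition on \<open>cos (2 a)\<close>.  For \<open>m \<ge> 7\<close> it
  has no solution in \<open>(- 1, 1)\<close>; for \<open>m = 6\<close> it reads
  \<open>9 cos\<^sup>2 (2 a) + 22 cos (2 a) + 9 = 0\<close> and determines \<open>a\<close>.

  For \<open>m = 6\<close> and this \<open>a\<close> it remains to show that \<open>f \<rho> = \<rho>\<close>.  The equation is then linear and
  homogeneous in \<open>f' - 1, f'', f''', f\<^sup>(\<^sup>4\<^sup>)\<close>, with coefficients that depend on \<open>f\<close>
  (\<open>triharmonic_poly_6_linear_form\<close>).  If \<open>f\<close> is analytic at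
  the pole and \<open>f \<rho> - \<rho>\<close> starts with \<open>b \<rho>\<^sup>K\<close>, then the lowest order term of the equation is \<open>b\<close> times
  a cubic polynomial in \<open>K\<close> without integer roots \<open>K \<ge> 2\<close>, up to a non-zero factor; so \<open>f \<rho> = \<rho>\<close>
  near the pole.  From there a Gronwall estimate for the deviation propagates the identity over the
  interval (\<open>linear_ode_unique_continuation\<close>), and continuity adds its end point.
\<close>

section \<open>Radial and tangential parts of the warped metric\<close>

lemma inner_sgn_self: "x \<noteq> 0 \<Longrightarrow> sgn x \<bullet> sgn x = (1::real)" for x :: "real^'n::finite"
  by (simp add: dot_square_norm norm_sgn)

lemma sum_sgn_sq: "x \<noteq> 0 \<Longrightarrow> (\<Sum>i\<in>UNIV. sgn x $ i * sgn x $ i) = 1" for x :: "real^'n::finite"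
  using inner_sgn_self[of x] by (simp add: inner_vec_def)

lemma vec_eq_sum_axis: "(\<Sum>i\<in>UNIV. (v $ i) *\<^sub>R axis i 1) = v" for v :: "real^'n::finite"
  using basis_expansion[of v] by (simp add: scalar_mult_eq_scaleR)

text \<open>The component of the coordinate vector \<open>e\<^sub>i\<close> tangent to the sphere through \<open>x\<close>.  Since
  \<open>tang i x $ j = \<delta>\<^sub>i\<^sub>j - w\<^sub>i w\<^sub>j\<close> with \<open>w = sgn x\<close>, these vectors are also the rows of the orthogonal
  projection to the tangent space; the metric and its inverse are combinations of this
  projection and of \<open>w\<^sub>i w\<^sub>j\<close>.\<close>

definition tang :: "'n \<Rightarrow> real^'n::finite \<Rightarrow> real^'n" where
  "tang i x = axis i 1 - (sgn x $ i) *\<^sub>R sgn x"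

lemma tang_nth: "tang i x $ j = (if i = j then 1 else 0) - sgn x $ i * sgn x $ j"
  by (auto simp: tang_def axis_def)

lemma tang_commute: "tang i x $ j = tang j x $ i"
  by (simp add: tang_nth mult.commute)

lemma tang_inner_sgn: "x \<noteq> 0 \<Longrightarrow> tang i x \<bullet> sgn x = 0"
  by (simp add: tang_def inner_diff_left inner_sgn_self inner_axis')

lemma tang_inner_tang: "x \<noteq> 0 \<Longrightarrow> tang i x \<bullet> tang j x = tang i x $ j"
  by (subst (2) tang_def) (simp add: inner_diff_right tang_inner_sgn inner_axis)

lemma sum_sgn_tang: "x \<noteq> 0 \<Longrightarrow> (\<Sum>i\<in>UNIV. (sgn x $ i) *\<^sub>R tang i x) = 0"
  by (simp add: tang_def scaleR_diff_right sum_subtractf vec_eq_sum_axis sum_sgn_sq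
      flip: scaleR_sum_left)

lemma sum_sgn_tang_nth: "x \<noteq> 0 \<Longrightarrow> (\<Sum>i\<in>UNIV. sgn x $ i * tang i x $ j) = 0"
  using arg_cong[OF sum_sgn_tang, of x "\<lambda>v. v $ j"] by simp

lemma sum_tang_sgn_nth: "x \<noteq> 0 \<Longrightarrow> (\<Sum>i\<in>UNIV. tang j x $ i * sgn x $ i) = 0"
  using tang_inner_sgn[of x j] by (simp add: inner_vec_def)

lemma sum_tang_tang:
  "x \<noteq> 0 \<Longrightarrow> (\<Sum>l\<in>UNIV. tang i x $ l * tang l x $ j) = tang i x $ j"
  using tang_inner_tang[of x i j] by (simp add: inner_vec_def tang_commute[of _ x j])

lemma sum_tang_diag:
  fixes x :: "real^'n::finite"
  shows "x \<noteq> 0 \<Longrightarrow> (\<Sum>i\<in>UNIV. tang i x $ i) = real CARD('n) - 1"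
  by (simp add: tang_nth sum_subtractf sum_sgn_sq)

lemma warped_metric_nth:
  "x \<noteq> 0 \<Longrightarrow> warped_metric f x $ i $ j
     = sgn x $ i * sgn x $ j + (f (norm x) / norm x)\<^sup>2 * tang i x $ j"
  by (simp add: warped_metric_def tang_nth)

text \<open>The two summands are complementary projections, so that such matrices multiply
  coefficient by coefficient; this yields the inverse of the metric.\<close>

lemma sgn_tang_matrix_mult:
  fixes x :: "real^'n::finite"
  assumes "x \<noteq> 0"
  shows "(\<Sum>k\<in>UNIV. (sgn x $ i * sgn x $ k + p * tang i x $ k)
                     * (sgn x $ k * sgn x $ j + q * tang k x $ j))
           = sgn x $ i * sgn x $ j + p * q * tang i x $ j"
proof -
  have "(\<Sum>k\<in>UNIV. (sgn x $ i * sgn x $ k + p * tang i x $ k)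
                     * (sgn x $ k * sgn x $ j + q * tang k x $ j))
      = sgn x $ i * sgn x $ j * (\<Sum>k\<in>UNIV. sgn x $ k * sgn x $ k)
        + q * sgn x $ i * (\<Sum>k\<in>UNIV. sgn x $ k * tang k x $ j)
        + p * sgn x $ j * (\<Sum>k\<in>UNIV. tang i x $ k * sgn x $ k)
        + p * q * (\<Sum>k\<in>UNIV. tang i x $ k * tang k x $ j)"
    unfolding sum_distrib_left sum.distrib[symmetric]
    by (rule sum.cong) (auto simp: algebra_simps)
  then show ?thesis
    using assms by (simp add: sum_sgn_sq sum_sgn_tang_nth sum_tang_sgn_nth sum_tang_tang)
qed

lemma matrix_inv_eqI:
  fixes A :: "real^'n::finite^'n"
  assumes "A ** B = mat 1" "B ** A = mat 1"
  shows "matrix_inv A = B"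
proof -
  have "A ** matrix_inv A = mat 1 \<and> matrix_inv A ** A = mat 1"
    unfolding matrix_inv_def by (rule someI) (use assms in blast)
  then show ?thesis
    using assms by (metis matrix_mul_assoc matrix_mul_lid matrix_mul_rid)
qed

lemma matrix_inv_warped_metric:
  fixes x :: "real^'n::finite"
  assumes "x \<noteq> 0" "f (norm x) \<noteq> 0"
  shows "matrix_inv (warped_metric f x) $ i $ j
           = sgn x $ i * sgn x $ j + tang i x $ j / (f (norm x) / norm x)\<^sup>2"
proof -
  define q where "q = (f (norm x) / norm x)\<^sup>2"
  define p where "p = inverse q"
  have pq: "p * q = 1" "q * p = 1" using assms by (simp_all add: p_def q_def)
  define H :: "real^'n^'n" where
    "H = (\<chi> i j. sgn x $ i * sgn x $ j + p * tang i x $ j)"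
  have id: "sgn x $ i * sgn x $ j + tang i x $ j = (if i = j then 1 else 0)" for i j
    by (simp add: tang_nth)
  have 1: "warped_metric f x ** H = mat 1" "H ** warped_metric f x = mat 1"
    using assms(1)
    by (simp_all add: vec_eq_iff[of "_ ** _"] vec_eq_iff[of "_ $ _"] matrix_matrix_mult_def
        warped_metric_nth H_def mat_def id sgn_tang_matrix_mult pq flip: q_def)
  have "matrix_inv (warped_metric f x) = H"
    using 1 by (rule matrix_inv_eqI)
  then show ?thesis by (simp add: H_def p_def q_def divide_inverse_commute)
qed

lemma trace_g_add: "trace_g G (\<lambda>i j. B i j + B' i j) = trace_g G B + trace_g G B'"
  by (simp add: trace_g_def scaleR_add_right sum.distrib)

lemma trace_g_diff: "trace_g G (\<lambda>i j. B i j - B' i j) = trace_g G B - trace_g G B'"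
  by (simp add: trace_g_def scaleR_diff_right sum_subtractf)

lemma trace_g_linear: "linear h \<Longrightarrow> trace_g G (\<lambda>i j. h (B i j)) = h (trace_g G B)"
  by (simp add: trace_g_def linear_sum linear_scale)

text \<open>The radial direction has unit length in the warped metric, hence is fixed by the inverse.\<close>

lemma sum_matrix_inv_sgn:
  fixes x :: "real^'n::finite"
  assumes "x \<noteq> 0" "f (norm x) \<noteq> 0"
  shows "(\<Sum>i\<in>UNIV. matrix_inv (warped_metric f x) $ i $ j * sgn x $ i) = sgn x $ j"
    and "(\<Sum>j\<in>UNIV. matrix_inv (warped_metric f x) $ i $ j * sgn x $ j) = sgn x $ i"
proof -
  define p where "p = inverse ((f (norm x) / norm x)\<^sup>2)"
  have inv: "matrix_inv (warped_metric f x) $ i $ j = sgn x $ i * sgn x $ j + p * tang i x $ j" for i j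
    using matrix_inv_warped_metric[where f = f and x = x, OF assms]
    by (simp add: p_def divide_inverse_commute)
  have "(\<Sum>i\<in>UNIV. matrix_inv (warped_metric f x) $ i $ j * sgn x $ i)
      = sgn x $ j * (\<Sum>i\<in>UNIV. sgn x $ i * sgn x $ i) + p * (\<Sum>i\<in>UNIV. sgn x $ i * tang i x $ j)"
    unfolding inv sum_distrib_left sum.distrib[symmetric]
    by (intro sum.cong refl) (simp add: algebra_simps)
  then show "(\<Sum>i\<in>UNIV. matrix_inv (warped_metric f x) $ i $ j * sgn x $ i) = sgn x $ j"
    using assms by (simp add: sum_sgn_sq sum_sgn_tang_nth)
  have "(\<Sum>j\<in>UNIV. matrix_inv (warped_metric f x) $ i $ j * sgn x $ j)
      = sgn x $ i * (\<Sum>j\<in>UNIV. sgn x $ j * sgn x $ j) + p * (\<Sum>j\<in>UNIV. tang i x $ j * sgn x $ j)"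
    unfolding inv sum_distrib_left sum.distrib[symmetric]
    by (intro sum.cong refl) (simp add: algebra_simps)
  then show "(\<Sum>j\<in>UNIV. matrix_inv (warped_metric f x) $ i $ j * sgn x $ j) = sgn x $ i"
    using assms by (simp add: sum_sgn_sq sum_tang_sgn_nth)
qed

text \<open>Together with the next two lemmas this computes the trace of every bilinear form met below: all
  of them are sums of terms with a factor \<open>w\<^sub>i\<close>, \<open>w\<^sub>j\<close> or \<open>tang i x $ j\<close>.\<close>

lemma trace_g_sgn:
  fixes x :: "real^'n::finite"
  assumes "x \<noteq> 0" "f (norm x) \<noteq> 0"
  shows "trace_g (warped_metric f x) (\<lambda>i j. (sgn x $ i) *\<^sub>R V j) = (\<Sum>j\<in>UNIV. (sgn x $ j) *\<^sub>R V j)"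
    and "trace_g (warped_metric f x) (\<lambda>i j. (sgn x $ j) *\<^sub>R V i) = (\<Sum>i\<in>UNIV. (sgn x $ i) *\<^sub>R V i)"
proof -
  show "trace_g (warped_metric f x) (\<lambda>i j. (sgn x $ i) *\<^sub>R V j) = (\<Sum>j\<in>UNIV. (sgn x $ j) *\<^sub>R V j)"
    unfolding trace_g_def scaleR_scaleR by (subst sum.swap)
      (simp add: sum_matrix_inv_sgn[where f = f and x = x, OF assms] flip: scaleR_sum_left)
  show "trace_g (warped_metric f x) (\<lambda>i j. (sgn x $ j) *\<^sub>R V i) = (\<Sum>i\<in>UNIV. (sgn x $ i) *\<^sub>R V i)"
    unfolding trace_g_def scaleR_scaleR
    by (simp add: sum_matrix_inv_sgn[where f = f and x = x, OF assms] flip: scaleR_sum_left)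
qed

lemma trace_g_sgn_sgn:
  fixes x :: "real^'n::finite"
  assumes "x \<noteq> 0" "f (norm x) \<noteq> 0"
  shows "trace_g (warped_metric f x) (\<lambda>i j. (sgn x $ i * sgn x $ j) *\<^sub>R v) = v"
  using trace_g_sgn(1)[where f = f and x = x, OF assms, of "\<lambda>j. (sgn x $ j) *\<^sub>R v"] assms
  by (simp add: sum_sgn_sq flip: scaleR_sum_left)

text \<open>The inverse metric acts on the sphere directions as multiplication by \<open>(\<rho> / f \<rho>)\<^sup>2\<close>, and there
  are \<open>n - 1\<close> of them.\<close>

lemma trace_g_tang:
  fixes x :: "real^'n::finite"
  assumes "x \<noteq> 0" "f (norm x) \<noteq> 0"
  shows "trace_g (warped_metric f x) (\<lambda>i j. (tang i x $ j) *\<^sub>R v)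
           = ((real CARD('n) - 1) * (norm x / f (norm x))\<^sup>2) *\<^sub>R v"
proof -
  define p where "p = inverse ((f (norm x) / norm x)\<^sup>2)"
  have inv: "matrix_inv (warped_metric f x) $ i $ j = sgn x $ i * sgn x $ j + p * tang i x $ j" for i j
    using matrix_inv_warped_metric[where f = f and x = x, OF assms]
    by (simp add: p_def divide_inverse_commute)
  have "(\<Sum>j\<in>UNIV. matrix_inv (warped_metric f x) $ i $ j * tang i x $ j) = p * tang i x $ i" for i
  proof -
    have "(\<Sum>j\<in>UNIV. matrix_inv (warped_metric f x) $ i $ j * tang i x $ j)
      = sgn x $ i * (\<Sum>j\<in>UNIV. tang i x $ j * sgn x $ j) + p * (tang i x \<bullet> tang i x)"
      unfolding inv sum_distrib_left sum.distrib[symmetric] inner_vec_def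
      by (intro sum.cong refl) (simp add: algebra_simps)
    then show ?thesis
      using assms by (simp add: sum_tang_sgn_nth tang_inner_tang)
  qed
  then have "trace_g (warped_metric f x) (\<lambda>i j. (tang i x $ j) *\<^sub>R v)
      = (p * (\<Sum>i\<in>UNIV. tang i x $ i)) *\<^sub>R v"
    by (simp add: trace_g_def sum_distrib_left flip: scaleR_sum_left)
  then show ?thesis
    using assms by (simp add: sum_tang_diag p_def power_divide mult.commute)
qed

text \<open>An orthogonal matrix that sends a coordinate vector to \<open>sgn x\<close> diagonalises the metric, with
  eigenvalue \<open>1\<close> once and \<open>(f \<rho> / \<rho>)\<^sup>2\<close> in the remaining directions.\<close>

lemma vol_density_warped_metric:
  fixes x :: "real^'n::finite"
  assumes "x \<noteq> 0" "0 \<le> f (norm x)"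
  shows "vol_density (warped_metric f) x = (f (norm x) / norm x) ^ (CARD('n) - 1)"
proof -
  define q where "q = (f (norm x) / norm x)\<^sup>2"
  \<comment> \<open>any index will do\<close>
  define k :: 'n where "k = undefined"
  obtain R where R: "orthogonal_matrix R" "R *v axis k 1 = sgn x"
    using orthogonal_matrix_exists_basis[of "sgn x" k] assms by (auto simp: norm_sgn)
  have Rk: "R $ i $ k = sgn x $ i" for i
    using arg_cong[OF R(2), of "\<lambda>v. v $ i"] by (simp add: matrix_vector_mul_component inner_axis)
  define D :: "real^'n^'n" where "D = (\<chi> i j. if i = j then (if i = k then 1 else q) else 0)"
  have RT: "R ** transpose R = mat 1" "transpose R ** R = mat 1"
    using R(1) by (auto simp: orthogonal_matrix_def)
  have RTn: "(\<Sum>l\<in>UNIV. R $ i $ l * R $ j $ l) = (if i = j then 1 else 0)" for i j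
    using arg_cong[OF RT(1), of "\<lambda>M. M $ i $ j"]
    by (simp add: matrix_matrix_mult_def transpose_def mat_def)
  have "warped_metric f x = R ** D ** transpose R"
  proof -
    have "(R ** D ** transpose R) $ i $ j = warped_metric f x $ i $ j" for i j
    proof -
      have "(R ** D) $ i $ l = R $ i $ l * (if l = k then 1 else q)" for l
        by (simp add: matrix_matrix_mult_def D_def mult_delta_right)
      then have "(R ** D ** transpose R) $ i $ j
          = (\<Sum>l\<in>UNIV. R $ i $ l * (if l = k then 1 else q) * R $ j $ l)"
        by (subst matrix_matrix_mult_def) (simp add: transpose_def)
      also have "\<dots> = (\<Sum>l\<in>UNIV. q * (R $ i $ l * R $ j $ l)
                        + (if l = k then (1 - q) * (R $ i $ k * R $ j $ k) else 0))"
        by (intro sum.cong refl) (auto simp: algebra_simps)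
      also have "\<dots> = warped_metric f x $ i $ j"
        using assms
        by (simp add: sum.distrib RTn Rk warped_metric_nth tang_nth algebra_simps
            flip: sum_distrib_left q_def)
      finally show ?thesis .
    qed
    then show ?thesis by (simp add: vec_eq_iff)
  qed
  then have "det (warped_metric f x) = det (R ** transpose R) * det D"
    by (simp add: det_mul)
  also have "\<dots> = det D" by (simp add: RT)
  also have "\<dots> = (\<Prod>i\<in>UNIV. if i = k then 1 else q)"
    by (subst det_diagonal) (auto simp: D_def)
  also have "\<dots> = q ^ (CARD('n) - 1)"
    by (subst prod.remove[of _ k]) (auto simp: prod.remove)
  finally show ?thesis
    using assms by (simp add: vol_density_def q_def real_sqrt_power power_mult)
qed

section \<open>Radial calculus and Christoffel symbols\<close>

lemma has_derivative_radial:
  fixes x :: "'a::real_inner"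
  assumes "(h has_real_derivative d) (at (norm x))" "x \<noteq> 0"
  shows "((\<lambda>y. h (norm y)) has_derivative (\<lambda>v. d * (sgn x \<bullet> v))) (at x)"
proof -
  have "((\<lambda>y. h (norm y)) has_derivative (\<lambda>v. d * (v \<bullet> sgn x))) (at x)"
    using has_derivative_compose[OF has_derivative_norm[OF assms(2)], of h "(*) d"] assms(1)
    by (simp add: has_field_derivative_def)
  then show ?thesis by (simp add: inner_commute)
qed

lemma has_derivative_sgn:
  fixes x :: "'a::real_inner"
  assumes "x \<noteq> 0"
  shows "(sgn has_derivative (\<lambda>v. (v - (sgn x \<bullet> v) *\<^sub>R sgn x) /\<^sub>R norm x)) (at x)"
proof -
  have 1: "((\<lambda>r. inverse r) has_real_derivative - (inverse (norm x))\<^sup>2) (at (norm x))"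
    using assms by (auto intro!: derivative_eq_intros simp: power2_eq_square)
  have "((\<lambda>y. inverse (norm y) *\<^sub>R y) has_derivative
          (\<lambda>v. inverse (norm x) *\<^sub>R v + (- (inverse (norm x))\<^sup>2 * (sgn x \<bullet> v)) *\<^sub>R x)) (at x)"
    by (rule has_derivative_scaleR[OF has_derivative_radial[OF 1 assms] has_derivative_ident])
  then have "(sgn has_derivative
          (\<lambda>v. inverse (norm x) *\<^sub>R v + (- (inverse (norm x))\<^sup>2 * (sgn x \<bullet> v)) *\<^sub>R x)) (at x)"
    by (simp add: sgn_div_norm[abs_def])
  then show ?thesis
    by (rule has_derivative_eq_rhs)
      (simp add: fun_eq_iff sgn_div_norm[of x] scaleR_diff_right power2_eq_square)
qed

lemma pd_eqI: "(F has_derivative F') (at x) \<Longrightarrow> pd i F x = F' (axis i 1)"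
  by (simp add: pd_def frechet_derivative_at[symmetric])

text \<open>The tension field is differentiated again, so a formula for it must be transported into a
  partial derivative; agreement on a neighbourhood suffices, also where the derivative does not
  exist.\<close>

lemma pd_cong_open:
  assumes "open U" "x \<in> U" "\<And>y. y \<in> U \<Longrightarrow> F y = G y"
  shows "pd i F x = pd i G x"
proof -
  have "(F has_derivative D) (at x) \<longleftrightarrow> (G has_derivative D) (at x)" for D
    using has_derivative_transform_within_open[of F D x UNIV U G]
      has_derivative_transform_within_open[of G D x UNIV U F] assms by auto
  then show ?thesis by (simp add: pd_def frechet_derivative_def)
qed

text \<open>The maps \<open>phi a\<close>, their rotationally symmetric variations and all the vector fields along them
  that occur have this form.\<close>

definition equivariant ::
  "(real \<Rightarrow> real) \<Rightarrow> (real \<Rightarrow> real) \<Rightarrow> real^'n::finite \<Rightarrow> (real^'n) \<times> real" where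
  "equivariant A B y = (A (norm y) *\<^sub>R sgn y, B (norm y))"

lemma equivariant_inner:
  "x \<noteq> 0 \<Longrightarrow> equivariant A B x \<bullet> equivariant A' B' x
     = A (norm x) * A' (norm x) + B (norm x) * B' (norm x)"
  by (simp add: equivariant_def inner_sgn_self)

lemma tang_inner_axis: "tang i x = axis i 1 - (sgn x \<bullet> axis i 1) *\<^sub>R sgn x"
  by (simp add: tang_def inner_axis)

lemma pd_equivariant:
  fixes x :: "real^'n::finite"
  assumes "x \<noteq> 0" "(A has_real_derivative A1) (at (norm x))" "(B has_real_derivative B1) (at (norm x))"
  shows "pd i (equivariant A B) x
    = ((A1 * sgn x $ i) *\<^sub>R sgn x + (A (norm x) / norm x) *\<^sub>R tang i x, B1 * sgn x $ i)"
proof -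
  have "(equivariant A B has_derivative
     (\<lambda>v. (A (norm x) *\<^sub>R ((v - (sgn x \<bullet> v) *\<^sub>R sgn x) /\<^sub>R norm x) + (A1 * (sgn x \<bullet> v)) *\<^sub>R sgn x,
           B1 * (sgn x \<bullet> v)))) (at x)"
    unfolding equivariant_def[abs_def]
    by (intro has_derivative_Pair has_derivative_scaleR has_derivative_radial has_derivative_sgn assms)
  from pd_eqI[OF this, of i] show ?thesis
    by (simp add: inner_axis tang_inner_axis divide_inverse add.commute)
qed

lemma has_derivative_sgn_nth:
  fixes x :: "real^'n::finite"
  assumes "x \<noteq> 0"
  shows "((\<lambda>y. sgn y $ j) has_derivative (\<lambda>v. (v - (sgn x \<bullet> v) *\<^sub>R sgn x) $ j / norm x)) (at x)"
  using bounded_linear.has_derivative[OF bounded_linear_vec_nth has_derivative_sgn[OF assms], of j]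
  by (simp add: divide_inverse_commute)

text \<open>The radial term \<open>D' w\<^sub>i e\<^sub>j\<close> is left in the coordinate basis instead of being split into its
  parts along \<open>sgn x\<close> and \<open>tang j x\<close>, because the trace formula for a factor \<open>w\<^sub>i\<close> applies to it
  directly.\<close>

lemma pd_pd_equivariant:
  fixes x :: "real^'n::finite"
  assumes S: "open S" "norm x \<in> S" "x \<noteq> 0"
    and A: "\<And>r. r \<in> S \<Longrightarrow> (A has_real_derivative A1 r) (at r)"
      "(A1 has_real_derivative A2) (at (norm x))"
    and B: "\<And>r. r \<in> S \<Longrightarrow> (B has_real_derivative B1 r) (at r)"
      "(B1 has_real_derivative B2) (at (norm x))"
  defines "r \<equiv> norm x"
  defines "D \<equiv> A1 r - A r / r" and "D' \<equiv> A1 r / r - A r / r\<^sup>2"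
  shows "pd i (pd j (equivariant A B)) x
    = (((A2 - D') * sgn x $ i * sgn x $ j + D * tang i x $ j / r) *\<^sub>R sgn x
         + (D * sgn x $ j / r) *\<^sub>R tang i x + (D' * sgn x $ i) *\<^sub>R axis j 1,
       B2 * sgn x $ i * sgn x $ j + B1 r * tang i x $ j / r)"
proof -
  have r: "r \<noteq> 0" using S by (simp add: r_def)
  define U :: "(real^'n) set" where "U = norm -` S \<inter> - {0}"
  have U: "open U" "x \<in> U"
    unfolding U_def using S by (auto intro!: open_Int open_vimage continuous_intros)
  define E where "E y = (((A1 (norm y) - A (norm y) / norm y) * sgn y $ j) *\<^sub>R sgn y
      + (A (norm y) / norm y) *\<^sub>R axis j 1, B1 (norm y) * sgn y $ j)" for y :: "real^'n"
  have "pd j (equivariant A B) y = E y" if "y \<in> U" for y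
    using that A(1) B(1)
    by (subst pd_equivariant[where ?A1.0 = "A1 (norm y)" and ?B1.0 = "B1 (norm y)"])
      (auto simp: U_def E_def tang_def algebra_simps)
  then have eq: "pd i (pd j (equivariant A B)) x = pd i E x"
    by (rule pd_cong_open[OF U])
  have Ar: "((\<lambda>r. A r / r) has_real_derivative D') (at (norm x))"
    using A(1)[OF S(2)] r unfolding D'_def
    by (auto intro!: derivative_eq_intros simp: field_simps power2_eq_square r_def)
  have Dr: "((\<lambda>r. A1 r - A r / r) has_real_derivative A2 - D') (at (norm x))"
    by (intro DERIV_diff A Ar)
  have "(E has_derivative (\<lambda>v. (
      (D * sgn x $ j) *\<^sub>R ((v - (sgn x \<bullet> v) *\<^sub>R sgn x) /\<^sub>R r)
      + (D * ((v - (sgn x \<bullet> v) *\<^sub>R sgn x) $ j / r)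
          + ((A2 - D') * (sgn x \<bullet> v)) * sgn x $ j) *\<^sub>R sgn x
      + ((A r / r) *\<^sub>R 0 + (D' * (sgn x \<bullet> v)) *\<^sub>R axis j 1),
      B1 r * ((v - (sgn x \<bullet> v) *\<^sub>R sgn x) $ j / r) + (B2 * (sgn x \<bullet> v)) * sgn x $ j))) (at x)"
    unfolding E_def[abs_def] r_def D_def
    by (intro has_derivative_Pair has_derivative_add has_derivative_scaleR has_derivative_mult
        has_derivative_radial[OF Dr] has_derivative_radial[OF Ar] has_derivative_radial[OF B(2)]
        has_derivative_sgn has_derivative_sgn_nth has_derivative_const S)
  from pd_eqI[OF this, of i] show ?thesis
    unfolding eq tang_inner_axis[symmetric]
    by (simp add: inner_axis D_def[symmetric] divide_inverse mult_ac add_ac)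
qed

lemma pd_warped_metric:
  fixes x :: "real^'n::finite"
  assumes "x \<noteq> 0" "((\<lambda>r. (f r / r)\<^sup>2) has_real_derivative q') (at (norm x))"
  defines "q \<equiv> (f (norm x) / norm x)\<^sup>2"
  shows "pd l (\<lambda>y. warped_metric f y $ i $ j) x
    = q' * sgn x $ l * tang i x $ j
      + (1 - q) / norm x * (tang l x $ i * sgn x $ j + tang l x $ j * sgn x $ i)"
proof -
  define E where "E y = sgn y $ i * sgn y $ j
      + (f (norm y) / norm y)\<^sup>2 * ((if i = j then 1 else 0) - sgn y $ i * sgn y $ j)" for y :: "real^'n"
  have eq: "pd l (\<lambda>y. warped_metric f y $ i $ j) x = pd l E x"
    by (rule pd_cong_open[of "- {0}"]) (use assms in \<open>auto simp: warped_metric_nth E_def tang_nth\<close>)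
  have "(E has_derivative (\<lambda>v. (sgn x $ i * ((v - (sgn x \<bullet> v) *\<^sub>R sgn x) $ j / norm x)
        + ((v - (sgn x \<bullet> v) *\<^sub>R sgn x) $ i / norm x) * sgn x $ j)
      + (q * (0 - (sgn x $ i * ((v - (sgn x \<bullet> v) *\<^sub>R sgn x) $ j / norm x)
        + ((v - (sgn x \<bullet> v) *\<^sub>R sgn x) $ i / norm x) * sgn x $ j))
        + (q' * (sgn x \<bullet> v)) * ((if i = j then 1 else 0) - sgn x $ i * sgn x $ j)))) (at x)"
    unfolding E_def[abs_def] q_def
    by (intro has_derivative_diff has_derivative_add has_derivative_mult
        has_derivative_radial[OF assms(2)] has_derivative_sgn_nth has_derivative_const assms(1))
  note E' = this
  show ?thesis
    unfolding eq pd_eqI[OF E'] tang_inner_axis[symmetric]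
    by (simp add: inner_axis tang_nth[of i] divide_inverse algebra_simps)
qed

text \<open>The symbols with a lower last index follow by adding three derivatives of the metric, where the
  terms in \<open>(1 - q) / \<rho>\<close> cancel except for those in the direction of \<open>sgn x\<close>; raising the index divides the tangential part
  by \<open>q\<close>.\<close>

lemma christoffel_warped_metric:
  fixes x :: "real^'n::finite"
  assumes x: "x \<noteq> 0" "f (norm x) \<noteq> 0"
    and q': "((\<lambda>r. (f r / r)\<^sup>2) has_real_derivative q') (at (norm x))"
  defines "q \<equiv> (f (norm x) / norm x)\<^sup>2"
  shows "christoffel (warped_metric f) k i j x
    = q' / (2 * q) * (sgn x $ i * tang j x $ k + sgn x $ j * tang i x $ k)
      + ((1 - q) / norm x - q' / 2) * tang i x $ j * sgn x $ k"
proof -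
  have q: "q \<noteq> 0" using x by (simp add: q_def)
  let ?p = "(1 - q) / norm x"
  have "pd i (\<lambda>y. warped_metric f y $ j $ l) x + pd j (\<lambda>y. warped_metric f y $ i $ l) x
        - pd l (\<lambda>y. warped_metric f y $ i $ j) x
      = q' * (sgn x $ i * tang j x $ l + sgn x $ j * tang i x $ l)
        + (2 * ?p - q') * tang i x $ j * sgn x $ l" for l
    unfolding pd_warped_metric[OF x(1) q', folded q_def]
    by (simp add: tang_commute[of l x i] tang_commute[of l x j] tang_commute[of j x i] algebra_simps)
  then have 1: "christoffel (warped_metric f) k i j x
    = (\<Sum>l\<in>UNIV. (sgn x $ k * sgn x $ l + tang k x $ l / q)
        * (q' * (sgn x $ i * tang j x $ l + sgn x $ j * tang i x $ l)
           + (2 * ?p - q') * tang i x $ j * sgn x $ l)) / 2"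
    by (simp add: christoffel_def matrix_inv_warped_metric[where f = f and x = x, OF x] q_def)
  have tt: "(\<Sum>l\<in>UNIV. tang k x $ l * tang j x $ l) = tang j x $ k" for j
    using tang_inner_tang[OF x(1), of k j] by (simp add: inner_vec_def tang_commute[of k x j])
  have "(\<Sum>l\<in>UNIV. (sgn x $ k * sgn x $ l + tang k x $ l / q)
        * (q' * (sgn x $ i * tang j x $ l + sgn x $ j * tang i x $ l)
           + (2 * ?p - q') * tang i x $ j * sgn x $ l))
    = sgn x $ k * q' * sgn x $ i * (\<Sum>l\<in>UNIV. tang j x $ l * sgn x $ l)
      + sgn x $ k * q' * sgn x $ j * (\<Sum>l\<in>UNIV. tang i x $ l * sgn x $ l)
      + sgn x $ k * (2 * ?p - q') * tang i x $ j * (\<Sum>l\<in>UNIV. sgn x $ l * sgn x $ l)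
      + q' / q * sgn x $ i * (\<Sum>l\<in>UNIV. tang k x $ l * tang j x $ l)
      + q' / q * sgn x $ j * (\<Sum>l\<in>UNIV. tang k x $ l * tang i x $ l)
      + (2 * ?p - q') / q * tang i x $ j * (\<Sum>l\<in>UNIV. tang k x $ l * sgn x $ l)"
    unfolding sum_distrib_left sum.distrib[symmetric]
    by (intro sum.cong refl) (simp add: divide_inverse algebra_simps)
  also have "\<dots> = sgn x $ k * (2 * ?p - q') * tang i x $ j
      + q' / q * sgn x $ i * tang j x $ k + q' / q * sgn x $ j * tang i x $ k"
    by (simp add: tt sum_tang_sgn_nth[OF x(1)] sum_sgn_sq[OF x(1)])
  also note 2 = calculation
  show ?thesis
    unfolding 1 2 using q x(1) by (simp add: field_simps)
qed

section \<open>Tension and energy density of equivariant maps\<close>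

lemma has_derivative_warp_quotient:
  fixes f :: "real \<Rightarrow> real"
  assumes "(f has_real_derivative f1) (at r)" "r \<noteq> 0"
  shows "((\<lambda>r. (f r / r)\<^sup>2) has_real_derivative 2 * (f r / r) * (f1 / r - f r / r\<^sup>2)) (at r)"
  using assms by (auto intro!: derivative_eq_intros simp: field_simps power2_eq_square)

text \<open>The traced Christoffel symbols are purely radial, because the mixed terms contract \<open>w\<close> with the
  tangential projection.  This is where the factor \<open>(n - 1) f' / f\<close> of the Laplacian of a radial
  function comes from.\<close>

lemma trace_christoffel_warped_metric:
  fixes x :: "real^'n::finite" and V :: "'n \<Rightarrow> 'b::real_vector"
  assumes x: "x \<noteq> 0" "f (norm x) \<noteq> 0"
    and f1: "(f has_real_derivative f1) (at (norm x))"
  defines "r \<equiv> norm x"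
  shows "trace_g (warped_metric f x) (\<lambda>i j. \<Sum>k\<in>UNIV. christoffel (warped_metric f) k i j x *\<^sub>R V k)
    = ((real CARD('n) - 1) * (r / (f r)\<^sup>2 - f1 / f r)) *\<^sub>R (\<Sum>k\<in>UNIV. (sgn x $ k) *\<^sub>R V k)"
proof -
  have r: "r \<noteq> 0" "f r \<noteq> 0" using x by (simp_all add: r_def)
  define q where "q = (f r / r)\<^sup>2"
  define q' where "q' = 2 * (f r / r) * (f1 / r - f r / r\<^sup>2)"
  define s where "s = q' / (2 * q)"
  define t where "t = (1 - q) / r - q' / 2"
  define W where "W j = (\<Sum>k\<in>UNIV. (tang j x $ k) *\<^sub>R V k)" for j
  define R where "R = (\<Sum>k\<in>UNIV. (sgn x $ k) *\<^sub>R V k)"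
  have "(\<Sum>k\<in>UNIV. christoffel (warped_metric f) k i j x *\<^sub>R V k)
      = (s * sgn x $ i) *\<^sub>R W j + (s * sgn x $ j) *\<^sub>R W i + (t * tang i x $ j) *\<^sub>R R" for i j
    unfolding W_def R_def scaleR_sum_right sum.distrib[symmetric]
      christoffel_warped_metric[where f = f and x = x, OF x
        has_derivative_warp_quotient[OF f1], folded r_def, OF r(1), folded q_def q'_def]
      s_def[symmetric] t_def[symmetric]
    by (intro sum.cong refl) (simp add: algebra_simps)
  then have eq: "trace_g (warped_metric f x) (\<lambda>i j. \<Sum>k\<in>UNIV. christoffel (warped_metric f) k i j x *\<^sub>R V k)
      = trace_g (warped_metric f x) (\<lambda>i j. (sgn x $ i) *\<^sub>R s *\<^sub>R W j + (sgn x $ j) *\<^sub>R s *\<^sub>R W i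
          + (tang i x $ j) *\<^sub>R t *\<^sub>R R)"
    by (simp add: mult.commute)
  have W0: "(\<Sum>j\<in>UNIV. (sgn x $ j) *\<^sub>R s *\<^sub>R W j) = 0"
  proof -
    have "(\<Sum>j\<in>UNIV. (sgn x $ j) *\<^sub>R s *\<^sub>R W j)
        = s *\<^sub>R (\<Sum>k\<in>UNIV. \<Sum>j\<in>UNIV. (sgn x $ j * tang j x $ k) *\<^sub>R V k)"
      unfolding W_def scaleR_sum_right by (subst sum.swap) (simp add: mult_ac)
    then show ?thesis
      using x by (simp add: sum_sgn_tang_nth flip: scaleR_sum_left)
  qed
  have "trace_g (warped_metric f x) (\<lambda>i j. \<Sum>k\<in>UNIV. christoffel (warped_metric f) k i j x *\<^sub>R V k)
     = ((real CARD('n) - 1) * ((r / f r)\<^sup>2 * t)) *\<^sub>R R"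
    unfolding eq trace_g_add trace_g_sgn[where f = f and x = x, OF x]
      trace_g_tang[where f = f and x = x, OF x] W0
    by (simp add: r_def mult_ac)
  also have "(r / f r)\<^sup>2 * t = r / (f r)\<^sup>2 - f1 / f r"
    using r by (simp add: q_def t_def q'_def field_simps power2_eq_square)
  finally show ?thesis by (simp add: R_def)
qed

text \<open>The trace of the flat Hessian with the warped inverse metric; the excess over the Laplacian of
  the warped metric is removed by the traced Christoffel symbols.\<close>

lemma trace_pd_pd_equivariant:
  fixes x :: "real^'n::finite"
  assumes S: "open S" "norm x \<in> S" "x \<noteq> 0"
    and A: "\<And>r. r \<in> S \<Longrightarrow> (A has_real_derivative A1 r) (at r)"
      "(A1 has_real_derivative A2) (at (norm x))"
    and B: "\<And>r. r \<in> S \<Longrightarrow> (B has_real_derivative B1 r) (at r)"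
      "(B1 has_real_derivative B2) (at (norm x))"
    and f: "f (norm x) \<noteq> 0"
  defines "r \<equiv> norm x" and "m \<equiv> real CARD('n) - 1"
  shows "trace_g (warped_metric f x) (\<lambda>i j. pd i (pd j (equivariant A B)) x)
    = ((A2 + m * r / (f r)\<^sup>2 * A1 r - m / (f r)\<^sup>2 * A r) *\<^sub>R sgn x, B2 + m * r / (f r)\<^sup>2 * B1 r)"
proof -
  have r: "r \<noteq> 0" "f r \<noteq> 0" using S f by (simp_all add: r_def)
  define D where "D = A1 r - A r / r"
  define D' where "D' = A1 r / r - A r / r\<^sup>2"
  define V where "V v = (v, 0::real)" for v :: "real^'n"
  have V: "linear V" by (auto intro!: linearI simp: V_def)
  have eq: "pd i (pd j (equivariant A B)) x
      = (sgn x $ i * sgn x $ j) *\<^sub>R ((A2 - D') *\<^sub>R sgn x, B2)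
        + (tang i x $ j) *\<^sub>R ((D / r) *\<^sub>R sgn x, B1 r / r)
        + (sgn x $ j) *\<^sub>R (D / r) *\<^sub>R V (tang i x)
        + (sgn x $ i) *\<^sub>R D' *\<^sub>R V (axis j 1)" for i j
    using pd_pd_equivariant[OF S A B, of i j]
    by (simp add: prod_eq_iff D_def D'_def r_def V_def scaleR_add_left mult_ac)
  have V1: "(\<Sum>i\<in>UNIV. (sgn x $ i) *\<^sub>R (D / r) *\<^sub>R V (tang i x)) = 0"
    using arg_cong[OF sum_sgn_tang[OF S(3)], of "\<lambda>v. (D / r) *\<^sub>R V v"] linear_0[OF V]
    by (simp add: linear_sum[OF V] linear_scale[OF V] scaleR_sum_right mult_ac)
  have V2: "(\<Sum>i\<in>UNIV. (sgn x $ i) *\<^sub>R D' *\<^sub>R V (axis i 1)) = D' *\<^sub>R V (sgn x)"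
    using arg_cong[OF vec_eq_sum_axis[of "sgn x"], of "\<lambda>v. D' *\<^sub>R V v"]
    by (simp add: linear_sum[OF V] linear_scale[OF V] scaleR_sum_right mult_ac)
  have "trace_g (warped_metric f x) (\<lambda>i j. pd i (pd j (equivariant A B)) x)
     = ((A2 - D') *\<^sub>R sgn x, B2) + (m * (r / f r)\<^sup>2) *\<^sub>R ((D / r) *\<^sub>R sgn x, B1 r / r)
       + D' *\<^sub>R V (sgn x)"
    unfolding eq trace_g_add trace_g_sgn_sgn[where f = f and x = x, OF S(3) f]
      trace_g_sgn[where f = f and x = x, OF S(3) f]
      trace_g_tang[where f = f and x = x, OF S(3) f] V1 V2
    by (simp add: m_def r_def)
  also have "\<dots> = ((A2 - D' + m * (r / f r)\<^sup>2 * (D / r) + D') *\<^sub>R sgn x, B2 + m * (r / f r)\<^sup>2 * (B1 r / r))"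
    by (simp add: V_def flip: scaleR_add_left)
  also have "A2 - D' + m * (r / f r)\<^sup>2 * (D / r) + D'
      = A2 + m * r / (f r)\<^sup>2 * A1 r - m / (f r)\<^sup>2 * A r"
    using r by (simp add: D_def field_simps power2_eq_square)
  also have "m * (r / f r)\<^sup>2 * (B1 r / r) = m * r / (f r)\<^sup>2 * B1 r"
    using r by (simp add: field_simps power2_eq_square)
  finally show ?thesis .
qed


text \<open>The unit field \<open>\<eta> = (cos \<alpha> w, - sin \<alpha>)\<close> spans the tangent directions that are orthogonal to
  the latitude.  By symmetry the tension field is a multiple \<open>T \<eta>\<close>; the coefficient \<open>T\<close> is the
  usual second order expression for the rotationally symmetric map with profile \<open>\<alpha>\<close>.\<close>

lemma tension_equivariant:
  fixes x :: "real^'n::finite"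
  assumes S: "open S" "norm x \<in> S" "x \<noteq> 0"
    and al: "\<And>r. r \<in> S \<Longrightarrow> (\<alpha> has_real_derivative \<alpha>1 r) (at r)"
      "(\<alpha>1 has_real_derivative \<alpha>2) (at (norm x))"
    and f: "f (norm x) \<noteq> 0" "(f has_real_derivative f1) (at (norm x))"
  defines "r \<equiv> norm x" and "m \<equiv> real CARD('n) - 1"
  defines "T \<equiv> \<alpha>2 + m * f1 / f r * \<alpha>1 r - m * sin (\<alpha> r) * cos (\<alpha> r) / (f r)\<^sup>2"
  shows "tension (warped_metric f) (equivariant (\<lambda>r. sin (\<alpha> r)) (\<lambda>r. cos (\<alpha> r))) x
    = ((T * cos (\<alpha> r)) *\<^sub>R sgn x, - T * sin (\<alpha> r))"
proof -
  have r: "r \<noteq> 0" "f r \<noteq> 0" using S f by (simp_all add: r_def)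
  define A where "A r = sin (\<alpha> r)" for r
  define B where "B r = cos (\<alpha> r)" for r
  define A1 where "A1 r = cos (\<alpha> r) * \<alpha>1 r" for r
  define B1 where "B1 r = - sin (\<alpha> r) * \<alpha>1 r" for r
  define A2 where "A2 = cos (\<alpha> r) * \<alpha>2 - sin (\<alpha> r) * (\<alpha>1 r)\<^sup>2"
  define B2 where "B2 = - sin (\<alpha> r) * \<alpha>2 - cos (\<alpha> r) * (\<alpha>1 r)\<^sup>2"
  have dA: "(A has_real_derivative A1 r) (at r)" if "r \<in> S" for r
    unfolding A_def[abs_def] A1_def using al(1)[OF that] by (auto intro!: derivative_eq_intros)
  have dB: "(B has_real_derivative B1 r) (at r)" if "r \<in> S" for r
    unfolding B_def[abs_def] B1_def using al(1)[OF that] by (auto intro!: derivative_eq_intros)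
  have dA1: "(A1 has_real_derivative A2) (at (norm x))"
    unfolding A1_def[abs_def] A2_def r_def using al(1)[OF S(2)] al(2)
    by (auto intro!: derivative_eq_intros simp: power2_eq_square)
  have dB1: "(B1 has_real_derivative B2) (at (norm x))"
    unfolding B1_def[abs_def] B2_def r_def using al(1)[OF S(2)] al(2)
    by (auto intro!: derivative_eq_intros simp: power2_eq_square)
  define \<phi> :: "real^'n \<Rightarrow> (real^'n) \<times> real" where "\<phi> = equivariant A B"
  have phi: "\<phi> x = (A r *\<^sub>R sgn x, B r)" by (simp add: \<phi>_def equivariant_def r_def)
  \<comment> \<open>the projection to the tangent space of the sphere is linear, so it commutes with the trace\<close>
  define h where "h v = v - (v \<bullet> \<phi> x) *\<^sub>R \<phi> x" for v
  have h: "linear h"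
    by (intro linearI) (simp_all add: h_def inner_add_left scaleR_add_left scaleR_diff_right)
  have grad: "(\<Sum>k\<in>UNIV. (sgn x $ k) *\<^sub>R pd k \<phi> x) = (A1 r *\<^sub>R sgn x, B1 r)"
  proof -
    have eq: "(sgn x $ k) *\<^sub>R pd k \<phi> x = ((A1 r * (sgn x $ k * sgn x $ k)) *\<^sub>R sgn x
        + (A r / r) *\<^sub>R (sgn x $ k) *\<^sub>R tang k x, B1 r * (sgn x $ k * sgn x $ k))" for k
      using pd_equivariant[OF S(3) dA dB, of k] S(2) by (simp add: \<phi>_def r_def scaleR_add_right mult_ac)
    have pair: "(\<Sum>k\<in>UNIV. (a k, b k)) = (\<Sum>k\<in>UNIV. a k, \<Sum>k\<in>UNIV. b k)"
      for a :: "'n \<Rightarrow> real^'n" and b :: "'n \<Rightarrow> real"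
      by (simp add: prod_eq_iff fst_sum snd_sum)
    show ?thesis
      unfolding eq pair sum.distrib sum_distrib_left[symmetric] scaleR_sum_left[symmetric]
        scaleR_sum_right[symmetric] sum_sgn_sq[OF S(3)] sum_sgn_tang[OF S(3)]
      by simp
  qed
  have "tension (warped_metric f) \<phi> x
    = h (trace_g (warped_metric f x) (\<lambda>i j. pd i (pd j \<phi>) x))
      - (m * (r / (f r)\<^sup>2 - f1 / f r)) *\<^sub>R (A1 r *\<^sub>R sgn x, B1 r)"
    unfolding tension_def second_fundamental_form_def pullback_conn_def trace_g_diff
      trace_christoffel_warped_metric[where f = f and x = x, OF S(3) f] grad h_def[symmetric] trace_g_linear[OF h]
    by (simp add: m_def r_def)
  also have "\<dots> = h ((A2 + m * r / (f r)\<^sup>2 * A1 r - m / (f r)\<^sup>2 * A r) *\<^sub>R sgn x, B2 + m * r / (f r)\<^sup>2 * B1 r)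
      - (m * (r / (f r)\<^sup>2 - f1 / f r)) *\<^sub>R (A1 r *\<^sub>R sgn x, B1 r)"
    unfolding \<phi>_def m_def r_def
    by (subst trace_pd_pd_equivariant[where f = f and A = A and B = B, OF S dA dA1 dB dB1 f(1)]) auto
  also have "\<dots> = ((T * cos (\<alpha> r)) *\<^sub>R sgn x, - T * sin (\<alpha> r))"
  proof -
    let ?s = "sin (\<alpha> r)" and ?c = "cos (\<alpha> r)"
    define Y where "Y = A2 + m * r / (f r)\<^sup>2 * A1 r - m / (f r)\<^sup>2 * A r"
    define Z where "Z = B2 + m * r / (f r)\<^sup>2 * B1 r"
    define \<gamma> where "\<gamma> = m * (r / (f r)\<^sup>2 - f1 / f r)"
    define k where "k = m * r / (f r)\<^sup>2"
    define l where "l = m / (f r)\<^sup>2"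
    have sc: "?s * ?s + ?c * ?c = 1" by (simp flip: power2_eq_square)
    \<comment> \<open>\<open>Y\<close> and \<open>Z\<close> are the components of the traced Hessian; its inner product with \<open>\<eta>\<close>
        differs from \<open>T\<close> by the traced Christoffel term\<close>
    have YZ: "?c * Y - ?s * Z = \<alpha>2 + k * \<alpha>1 r - l * ?s * ?c"
      using sc unfolding Y_def Z_def A_def B_def A1_def B1_def A2_def B2_def k_def[symmetric] l_def[symmetric]
      by algebra
    have T: "T = (?c * Y - ?s * Z) - \<gamma> * \<alpha>1 r"
      unfolding YZ T_def \<gamma>_def k_def l_def by (simp add: field_simps)
    have "Y - (Y * A r + Z * B r) * A r - \<gamma> * A1 r = T * ?c"
      using sc unfolding T A_def B_def A1_def by algebra
    moreover have "Z - (Y * A r + Z * B r) * B r - \<gamma> * B1 r = - T * ?s"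
      using sc unfolding T A_def B_def B1_def by algebra
    moreover have "h (Y *\<^sub>R sgn x, Z) = ((Y - (Y * A r + Z * B r) * A r) *\<^sub>R sgn x,
        Z - (Y * A r + Z * B r) * B r)"
      using S(3) by (simp add: h_def phi inner_sgn_self algebra_simps)
    ultimately show ?thesis
      unfolding Y_def[symmetric] Z_def[symmetric] \<gamma>_def[symmetric]
      by (simp flip: scaleR_diff_left)
  qed
  finally show ?thesis by (simp add: \<phi>_def A_def[abs_def] B_def[abs_def])
qed


text \<open>Along radii \<open>\<eta>\<close> is parallel, so that only \<open>T\<close> is differentiated; along the sphere of radius
  \<open>\<rho>\<close> the covariant derivative of \<open>\<eta>\<close> in a \<open>g\<close>-unit direction has length \<open>cos \<alpha> / f\<close>.  The
  density is the sum of the squares.\<close>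

lemma triharmonic_density_equivariant:
  fixes x :: "real^'n::finite"
  assumes S: "open S" "norm x \<in> S" "S \<subseteq> {0<..}"
    and al: "\<And>r. r \<in> S \<Longrightarrow> (\<alpha> has_real_derivative \<alpha>1 r) (at r)"
      "\<And>r. r \<in> S \<Longrightarrow> (\<alpha>1 has_real_derivative \<alpha>2 r) (at r)"
    and f: "\<And>r. r \<in> S \<Longrightarrow> f r \<noteq> 0" "\<And>r. r \<in> S \<Longrightarrow> (f has_real_derivative f1 r) (at r)"
  defines "m \<equiv> real CARD('n) - 1"
  defines "T \<equiv> \<lambda>r. \<alpha>2 r + m * f1 r / f r * \<alpha>1 r - m * sin (\<alpha> r) * cos (\<alpha> r) / (f r)\<^sup>2"
  defines "\<phi> \<equiv> equivariant (\<lambda>r. sin (\<alpha> r)) (\<lambda>r. cos (\<alpha> r)) :: real^'n \<Rightarrow> (real^'n) \<times> real"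
  assumes T1: "(T has_real_derivative T1) (at (norm x))"
  shows "trace_g (warped_metric f x) (\<lambda>i j. pullback_conn \<phi> i (tension (warped_metric f) \<phi>) x
              \<bullet> pullback_conn \<phi> j (tension (warped_metric f) \<phi>) x)
    = T1\<^sup>2 + m * (cos (\<alpha> (norm x)))\<^sup>2 * (T (norm x))\<^sup>2 / (f (norm x))\<^sup>2"
proof -
  define r where "r = norm x"
  have x: "x \<noteq> 0" using S by (auto simp: greaterThan_def)
  have r: "r \<noteq> 0" "f r \<noteq> 0" using x f S by (simp_all add: r_def)
  define U :: "(real^'n) set" where "U = norm -` S"
  have U: "open U" "x \<in> U"
    unfolding U_def using S by (auto intro!: open_vimage continuous_intros)
  let ?s = "sin (\<alpha> r)" and ?c = "cos (\<alpha> r)"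
  have sc: "?s * ?s + ?c * ?c = 1" by (simp flip: power2_eq_square)
  define E :: "real^'n \<Rightarrow> (real^'n) \<times> real"
    where "E = equivariant (\<lambda>r. T r * cos (\<alpha> r)) (\<lambda>r. - T r * sin (\<alpha> r))"
  have "tension (warped_metric f) \<phi> y = E y" if "y \<in> U" for y
  proof -
    have "norm y \<in> S" "y \<noteq> 0" using that S(3) by (auto simp: U_def greaterThan_def)
    then show ?thesis
      unfolding \<phi>_def E_def T_def m_def
      by (subst tension_equivariant[OF S(1) _ _ al(1) al(2) f]) (auto simp: equivariant_def)
  qed
  then have pdE: "pd i (tension (warped_metric f) \<phi>) x = pd i E x" for i
    by (rule pd_cong_open[OF U])
  have d: "((\<lambda>r. T r * cos (\<alpha> r)) has_real_derivative T1 * ?c - T r * ?s * \<alpha>1 r) (at (norm x))"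
    "((\<lambda>r. - T r * sin (\<alpha> r)) has_real_derivative - T1 * ?s - T r * ?c * \<alpha>1 r) (at (norm x))"
    using T1 al(1)[OF S(2)] by (auto intro!: derivative_eq_intros simp: r_def)
  have pb: "pullback_conn \<phi> i (tension (warped_metric f) \<phi>) x
      = ((T1 * sgn x $ i * ?c) *\<^sub>R sgn x + (T r * ?c / r) *\<^sub>R tang i x, - T1 * sgn x $ i * ?s)" for i
  proof -
    let ?a = "T1 * ?c - T r * ?s * \<alpha>1 r" and ?b = "- T1 * ?s - T r * ?c * \<alpha>1 r"
    have pd: "pd i E x = ((?a * sgn x $ i) *\<^sub>R sgn x + (T r * ?c / r) *\<^sub>R tang i x, ?b * sgn x $ i)"
      unfolding E_def by (subst pd_equivariant[OF x d]) (simp add: r_def)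
    have phi: "\<phi> x = (?s *\<^sub>R sgn x, ?c)"
      by (simp add: \<phi>_def equivariant_def r_def)
    have "pd i E x \<bullet> \<phi> x = (?a * ?s + ?b * ?c) * sgn x $ i"
      using x by (simp add: pd phi inner_sgn_self tang_inner_sgn inner_add_left algebra_simps)
    also have "?a * ?s + ?b * ?c = - T r * \<alpha>1 r"
      using sc by algebra
    finally have inn: "pd i E x \<bullet> \<phi> x = - T r * \<alpha>1 r * sgn x $ i" .
    have "pullback_conn \<phi> i (tension (warped_metric f) \<phi>) x
      = ((?a * sgn x $ i + T r * \<alpha>1 r * sgn x $ i * ?s) *\<^sub>R sgn x + (T r * ?c / r) *\<^sub>R tang i x,
          ?b * sgn x $ i + T r * \<alpha>1 r * sgn x $ i * ?c)"
      unfolding pullback_conn_def pdE inn by (simp add: pd phi scaleR_add_left)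
    then show ?thesis by (simp add: algebra_simps)
  qed
  have dens: "pullback_conn \<phi> i (tension (warped_metric f) \<phi>) x \<bullet> pullback_conn \<phi> j (tension (warped_metric f) \<phi>) x
     = (sgn x $ i * sgn x $ j) *\<^sub>R T1\<^sup>2 + (tang i x $ j) *\<^sub>R (T r * ?c / r)\<^sup>2" for i j
  proof -
    have "pullback_conn \<phi> i (tension (warped_metric f) \<phi>) x \<bullet> pullback_conn \<phi> j (tension (warped_metric f) \<phi>) x
     = (T1 * sgn x $ i * ?c) * (T1 * sgn x $ j * ?c) + (T r * ?c / r)\<^sup>2 * tang i x $ j
       + (T1 * sgn x $ i * ?s) * (T1 * sgn x $ j * ?s)"
      unfolding pb using x tang_inner_sgn[OF x] tang_inner_sgn[OF x, unfolded inner_commute[of _ "sgn x"]]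
      by (simp add: inner_add_left inner_add_right inner_sgn_self tang_inner_tang power2_eq_square)
    also have "\<dots> = (sgn x $ i * sgn x $ j) * T1\<^sup>2 + (tang i x $ j) * (T r * ?c / r)\<^sup>2"
      using sc by algebra
    finally show ?thesis by simp
  qed
  have "trace_g (warped_metric f x) (\<lambda>i j. pullback_conn \<phi> i (tension (warped_metric f) \<phi>) x
              \<bullet> pullback_conn \<phi> j (tension (warped_metric f) \<phi>) x)
    = T1\<^sup>2 + m * (r / f r)\<^sup>2 * (T r * ?c / r)\<^sup>2"
    unfolding dens trace_g_add trace_g_sgn_sgn[where f = f and x = x, OF x f(1)[OF S(2)]]
      trace_g_tang[where f = f and x = x, OF x f(1)[OF S(2)]]
    by (simp add: m_def r_def)
  also have "\<dots> = T1\<^sup>2 + m * ?c\<^sup>2 * (T r)\<^sup>2 / (f r)\<^sup>2"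
    using r by (simp add: power_mult_distrib power_divide)
  finally show ?thesis by (simp add: r_def)
qed

section \<open>Integration of radial functions\<close>

text \<open>Both measures have the same mass on every half line, by the volume of balls on one side and the
  fundamental theorem of calculus on the other.  The cut-off at \<open>R\<close> keeps these masses finite.\<close>

lemma distr_norm_lborel:
  fixes R :: real
  assumes R: "0 \<le> R"
  defines "n \<equiv> DIM('a::euclidean_space)"
  shows "distr (density lborel (\<lambda>x. ennreal (indicator (cball 0 R) x))) borel (norm :: 'a \<Rightarrow> real)
    = density lborel (\<lambda>r. ennreal (real n * unit_ball_vol (real n) * r ^ (n - 1) * indicator {0..R} r))"
    (is "?M = ?N")
proof -
  define V where "V = unit_ball_vol (real n)"
  have [measurable]: "(cball 0 R :: 'a set) \<in> sets borel" by (simp add: borel_closed)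
  have n: "0 < n" by (simp add: n_def)
  have V: "0 \<le> V" by (simp add: V_def)
  have M: "emeasure ?M {x<..} = ennreal (V * (R ^ n - (max 0 (min x R)) ^ n))" for x
  proof -
    have [measurable]: "(norm -` {x<..} :: 'a set) \<in> sets borel"
      by (auto intro!: borel_open open_vimage continuous_intros)
    have "emeasure ?M {x<..}
        = (\<integral>\<^sup>+y. ennreal (indicator (cball 0 R) y) * indicator (norm -` {x<..}) (y :: 'a) \<partial>lborel)"
      by (subst emeasure_distr, measurable, subst emeasure_density) (auto simp: measurable_sets_borel)
    also have "\<dots> = (\<integral>\<^sup>+y. indicator (cball 0 R \<inter> norm -` {x<..}) (y :: 'a) \<partial>lborel)"
      by (intro nn_integral_cong) (auto simp: indicator_def)
    also have "\<dots> = emeasure lborel (cball 0 R \<inter> norm -` {x<..} :: 'a set)"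
      by (intro nn_integral_indicator) (simp add: measurable_sets_borel)
    also have "\<dots> = ennreal (V * (R ^ n - (max 0 (min x R)) ^ n))"
    proof (cases "x < 0")
      case True
      then have "cball 0 R \<inter> norm -` {x<..} = (cball 0 R :: 'a set)"
        by (auto intro: less_le_trans[OF _ norm_ge_zero])
      then show ?thesis
        using True R n by (simp add: emeasure_cball n_def[symmetric] V_def max_def min_def)
    next
      case False
      define y where "y = min x R"
      have y: "0 \<le> y" "y \<le> R" using False R by (auto simp: y_def)
      have "cball 0 R \<inter> norm -` {x<..} = (cball 0 R - cball 0 y :: 'a set)"
        by (auto simp: y_def)
      moreover have "emeasure lborel (cball 0 R - cball 0 y :: 'a set)
          = emeasure lborel (cball 0 R :: 'a set) - emeasure lborel (cball 0 y :: 'a set)"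
        using y emeasure_cball[of y "0::'a"] by (intro emeasure_Diff) auto
      ultimately show ?thesis
        using y V unfolding y_def[symmetric]
        by (simp add: emeasure_cball n_def[symmetric] V_def[symmetric] max_def
            ennreal_minus[symmetric] right_diff_distrib)
    qed
    finally show ?thesis .
  qed
  have N: "emeasure ?N {x<..} = ennreal (V * (R ^ n - (max 0 (min x R)) ^ n))" for x
  proof -
    define y where "y = max 0 (min x R)"
    have y: "0 \<le> y" "y \<le> R" using R by (auto simp: y_def)
    have "emeasure ?N {x<..} = (\<integral>\<^sup>+r. ennreal (real n * V * r ^ (n - 1) * indicator {0..R} r)
              * indicator {x<..} r \<partial>lborel)"
      by (subst emeasure_density) (auto simp: V_def)
    also have "\<dots> = (\<integral>\<^sup>+r. ennreal (real n * V * r ^ (n - 1)) * indicator {y..R} r \<partial>lborel)"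
      by (rule nn_integral_cong_AE, rule AE_mp[OF AE_lborel_singleton[of x]])
        (use AE_lborel_singleton[of 0] AE_lborel_singleton[of R] in eventually_elim,
          use R in \<open>auto simp: indicator_def y_def max_def min_def not_less split: if_splits\<close>)
    also have "\<dots> = ennreal (V * R ^ n - V * y ^ n)"
      using y V n
      by (intro nn_integral_FTC_Icc) (auto intro!: derivative_eq_intros simp: mult_ac)
    finally show ?thesis by (simp add: y_def right_diff_distrib)
  qed
  show ?thesis
  proof (rule measure_eqI_lessThan)
    show "emeasure ?M {x<..} < \<infinity>" for x unfolding M by simp
    show "emeasure ?M {x<..} = emeasure ?N {x<..}" for x unfolding M N ..
  qed simp_all
qed

lemma polar_integral_shell:
  fixes H :: "real \<Rightarrow> real"
  assumes p: "0 < p" "p \<le> q" and H: "continuous_on {p..q} H"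
  defines "n \<equiv> DIM('a::euclidean_space)"
  shows "(LINT x:{x::'a. p \<le> norm x \<and> norm x \<le> q}|lborel. H (norm x))
    = real n * unit_ball_vol (real n) * integral {p..q} (\<lambda>r. r ^ (n - 1) * H r)"
proof -
  define G where "G r = indicator {p..q} r *\<^sub>R H r" for r
  have G: "G \<in> borel_measurable borel"
    unfolding G_def[abs_def] by (intro borel_measurable_continuous_on_indicator H) simp
  have [measurable]: "(cball 0 q :: 'a set) \<in> sets borel" by (simp add: borel_closed)
  define c where "c = real n * unit_ball_vol (real n)"
  have c: "0 \<le> c" by (simp add: c_def)
  have "(LINT x:{x::'a. p \<le> norm x \<and> norm x \<le> q}|lborel. H (norm x))
      = (LINT x|lborel. indicator (cball 0 q) (x :: 'a) *\<^sub>R G (norm x))"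
    unfolding set_lebesgue_integral_def G_def
    by (intro Bochner_Integration.integral_cong) (auto simp: indicator_def)
  also have "\<dots> = integral\<^sup>L (density lborel (\<lambda>x. ennreal (indicator (cball 0 q) (x :: 'a)))) (\<lambda>x. G (norm x))"
    using G by (subst integral_density) auto
  also have "\<dots> = integral\<^sup>L (distr (density lborel (\<lambda>x. ennreal (indicator (cball 0 q) (x :: 'a)))) borel norm) G"
    using G by (subst integral_distr) auto
  also have "\<dots> = (LINT r|lborel. (c * r ^ (n - 1) * indicator {0..q} r) *\<^sub>R G r)"
    using p G c unfolding c_def n_def
    by (subst distr_norm_lborel, simp, subst integral_density) (auto simp: indicator_def)
  also have "\<dots> = (LINT r:{p..q}|lborel. c * (r ^ (n - 1) * H r))"
    unfolding set_lebesgue_integral_def G_def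
    using p by (intro Bochner_Integration.integral_cong) (auto simp: indicator_def)
  also have "\<dots> = integral {p..q} (\<lambda>r. c * (r ^ (n - 1) * H r))"
    by (intro set_borel_integral_eq_integral borel_integrable_atLeastAtMost' continuous_intros H)
  finally show ?thesis by (simp add: c_def)
qed

section \<open>The reduced energy and its first variation\<close>

text \<open>\<open>F\<close> lists a smooth function on \<open>S\<close> together with all its derivatives: \<open>F k\<close> is the \<open>k\<close>-th one.\<close>

definition derivs_on :: "real set \<Rightarrow> (nat \<Rightarrow> real \<Rightarrow> real) \<Rightarrow> bool" where
  "derivs_on S F \<longleftrightarrow> (\<forall>k. \<forall>r\<in>S. (F k has_real_derivative F (Suc k) r) (at r))"

lemma derivs_onD: "derivs_on S F \<Longrightarrow> r \<in> S \<Longrightarrow> (F k has_real_derivative F (Suc k) r) (at r)"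
  by (simp add: derivs_on_def)

lemma derivs_on_continuous: "derivs_on S F \<Longrightarrow> continuous_on S (F k)"
  by (meson DERIV_continuous_on derivs_onD has_field_derivative_at_within)

text \<open>The volume density \<open>(f / r)\<^bsup>n-1\<^esup>\<close> of the chart and the Jacobian \<open>r\<^bsup>n-1\<^esup>\<close> of polar coordinates
  multiply to \<open>f\<^bsup>n-1\<^esup>\<close>.\<close>

lemma E3_equivariant:
  fixes f \<alpha> :: "real \<Rightarrow> real"
  assumes pq: "0 < p" "p \<le> q" "q < 1"
    and al: "\<And>r. r \<in> {0<..<1} \<Longrightarrow> (\<alpha> has_real_derivative \<alpha>1 r) (at r)"
      "\<And>r. r \<in> {0<..<1} \<Longrightarrow> (\<alpha>1 has_real_derivative \<alpha>2 r) (at r)"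
    and f: "\<And>r. r \<in> {0<..<1} \<Longrightarrow> 0 < f r" "\<And>r. r \<in> {0<..<1} \<Longrightarrow> (f has_real_derivative f1 r) (at r)"
    and T: "\<And>r. r \<in> {0<..<1} \<Longrightarrow> T r = \<alpha>2 r + m * f1 r / f r * \<alpha>1 r - m * sin (\<alpha> r) * cos (\<alpha> r) / (f r)\<^sup>2"
    and T1: "\<And>r. r \<in> {0<..<1} \<Longrightarrow> (T has_real_derivative T1 r) (at r)" "continuous_on {p..q} T1"
    and m: "m = real CARD('n::finite) - 1"
  shows "E3 (warped_metric f) (equivariant (\<lambda>r. sin (\<alpha> r)) (\<lambda>r. cos (\<alpha> r)))
           {x :: real^'n. p \<le> norm x \<and> norm x \<le> q}
    = real CARD('n) * unit_ball_vol (real CARD('n)) / 2 * integral {p..q}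
        (\<lambda>r. ((T1 r)\<^sup>2 + m * (cos (\<alpha> r))\<^sup>2 * (T r)\<^sup>2 / (f r)\<^sup>2) * f r ^ (CARD('n) - 1))"
proof -
  define H where "H r = ((T1 r)\<^sup>2 + m * (cos (\<alpha> r))\<^sup>2 * (T r)\<^sup>2 / (f r)\<^sup>2) * (f r / r) ^ (CARD('n) - 1)" for r
  let ?K = "{x :: real^'n. p \<le> norm x \<and> norm x \<le> q}"
  let ?\<phi> = "equivariant (\<lambda>r. sin (\<alpha> r)) (\<lambda>r. cos (\<alpha> r)) :: real^'n \<Rightarrow> _"
  have sub: "{p..q} \<subseteq> {0<..<1}" using pq by auto
  have DERIV_cont: "continuous_on {p..q} g"
    if "\<And>r. r \<in> {0<..<1} \<Longrightarrow> (g has_real_derivative g' r) (at r)" for g g' :: "real \<Rightarrow> real"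
    using that sub by (intro continuous_at_imp_continuous_on ballI) (blast intro: DERIV_isCont)
  have cont: "continuous_on {p..q} T" "continuous_on {p..q} \<alpha>" "continuous_on {p..q} f"
    by (rule DERIV_cont[OF T1(1)] DERIV_cont[OF al(1)] DERIV_cont[OF f(2)]; assumption)+
  have fnz: "f r \<noteq> 0" if "r \<in> {0<..<1}" for r using f(1)[OF that] by simp
  have "continuous_on {p..q} H"
    unfolding H_def[abs_def] using cont T1(2) pq f(1) sub
    by (intro continuous_intros ballI) (use fnz pq in auto)
  have "trace_g (warped_metric f x) (\<lambda>i j. pullback_conn ?\<phi> i (tension (warped_metric f) ?\<phi>) x
            \<bullet> pullback_conn ?\<phi> j (tension (warped_metric f) ?\<phi>) x) * vol_density (warped_metric f) x
        = H (norm x)" if "x \<in> ?K" for x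
  proof -
    let ?T = "\<lambda>r. \<alpha>2 r + m * f1 r / f r * \<alpha>1 r - m * sin (\<alpha> r) * cos (\<alpha> r) / (f r)\<^sup>2"
    have x: "norm x \<in> {0<..<1}" "x \<noteq> 0" using that pq by auto
    have "(?T has_real_derivative T1 (norm x)) (at (norm x))"
      by (rule has_field_derivative_transform_within_open[OF T1(1)[OF x(1)] _ x(1) T]) auto
    then have "trace_g (warped_metric f x) (\<lambda>i j. pullback_conn ?\<phi> i (tension (warped_metric f) ?\<phi>) x
            \<bullet> pullback_conn ?\<phi> j (tension (warped_metric f) ?\<phi>) x)
        = (T1 (norm x))\<^sup>2 + m * (cos (\<alpha> (norm x)))\<^sup>2 * (T (norm x))\<^sup>2 / (f (norm x))\<^sup>2"
      unfolding m T[OF x(1)]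
      by (intro triharmonic_density_equivariant[OF _ x(1) _ al fnz f(2)]) auto
    moreover have "vol_density (warped_metric f) x = (f (norm x) / norm x) ^ (CARD('n) - 1)"
      using x f(1)[OF x(1)] by (intro vol_density_warped_metric) auto
    ultimately show ?thesis by (simp add: H_def)
  qed
  then have "E3 (warped_metric f) ?\<phi> ?K = (LINT x:?K|lborel. H (norm x)) / 2"
    unfolding E3_def set_lebesgue_integral_def
    by (intro arg_cong[of _ _ "\<lambda>z. z / 2"] Bochner_Integration.integral_cong)
      (auto simp: indicator_def)
  also have "\<dots> = real CARD('n) * unit_ball_vol (real CARD('n))
      * integral {p..q} (\<lambda>r. r ^ (CARD('n) - 1) * H r) / 2"
    using polar_integral_shell[where ?'a = "real^'n", OF pq(1,2) \<open>continuous_on {p..q} H\<close>] by simp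
  also have "integral {p..q} (\<lambda>r. r ^ (CARD('n) - 1) * H r) = integral {p..q}
        (\<lambda>r. ((T1 r)\<^sup>2 + m * (cos (\<alpha> r))\<^sup>2 * (T r)\<^sup>2 / (f r)\<^sup>2) * f r ^ (CARD('n) - 1))"
    by (intro Henstock_Kurzweil_Integration.integral_cong)
      (use pq in \<open>auto simp: H_def power_divide\<close>)
  finally show ?thesis by simp
qed

lemma derivs_on_numerals:
  assumes "derivs_on S F" "r \<in> S"
  shows "(F 0 has_real_derivative F 1 r) (at r)" "(F 1 has_real_derivative F 2 r) (at r)"
    "(F 2 has_real_derivative F 3 r) (at r)" "(F 3 has_real_derivative F 4 r) (at r)"
  using derivs_onD[OF assms, of 0] derivs_onD[OF assms, of 1] derivs_onD[OF assms, of 2]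
    derivs_onD[OF assms, of 3] by (simp_all add: eval_nat_numeral)

text \<open>The coefficient of the tension field for the profile \<open>a + t B\<close>, where \<open>F\<close> lists the derivatives
  of the warping function and \<open>B\<close> those of the variation.\<close>

definition radial_tension ::
  "real \<Rightarrow> real \<Rightarrow> (nat \<Rightarrow> real \<Rightarrow> real) \<Rightarrow> (nat \<Rightarrow> real \<Rightarrow> real) \<Rightarrow> real \<Rightarrow> real \<Rightarrow> real" where
  "radial_tension m a F B t r =
     t * B 2 r + m * F 1 r / F 0 r * (t * B 1 r)
     - m * sin (a + t * B 0 r) * cos (a + t * B 0 r) / (F 0 r)\<^sup>2"

definition radial_tension_deriv ::
  "real \<Rightarrow> real \<Rightarrow> (nat \<Rightarrow> real \<Rightarrow> real) \<Rightarrow> (nat \<Rightarrow> real \<Rightarrow> real) \<Rightarrow> real \<Rightarrow> real \<Rightarrow> real" where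
  "radial_tension_deriv m a F B t r =
     t * B 3 r + m * (F 2 r / F 0 r - (F 1 r / F 0 r)\<^sup>2) * (t * B 1 r)
     + m * F 1 r / F 0 r * (t * B 2 r)
     - m * ((cos (a + t * B 0 r))\<^sup>2 - (sin (a + t * B 0 r))\<^sup>2) * (t * B 1 r) / (F 0 r)\<^sup>2
     + 2 * m * sin (a + t * B 0 r) * cos (a + t * B 0 r) * F 1 r / F 0 r ^ 3"

lemma radial_tension_has_derivative:
  assumes "derivs_on S F" "derivs_on UNIV B" "r \<in> S" "F 0 r \<noteq> 0"
  shows "(radial_tension m a F B t has_real_derivative radial_tension_deriv m a F B t r) (at r)"
proof -
  note F = derivs_on_numerals[OF assms(1,3)]
  note B = derivs_on_numerals[OF assms(2) UNIV_I, of r]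
  define u where "u r = inverse (F 0 r)" for r
  have du: "(u has_real_derivative - F 1 r * (u r)\<^sup>2) (at r)"
    unfolding u_def[abs_def] using assms(4) F(1)
    by (auto intro!: derivative_eq_intros simp: power2_eq_square)
  have "radial_tension m a F B t = (\<lambda>r. t * B 2 r + m * F 1 r * u r * (t * B 1 r)
     - m * sin (a + t * B 0 r) * cos (a + t * B 0 r) * (u r)\<^sup>2)"
    by (simp add: fun_eq_iff radial_tension_def u_def divide_inverse power_inverse)
  moreover have "radial_tension_deriv m a F B t r
   = t * B 3 r + m * (F 2 r * u r - (F 1 r * u r)\<^sup>2) * (t * B 1 r)
     + m * F 1 r * u r * (t * B 2 r)
     - m * ((cos (a + t * B 0 r))\<^sup>2 - (sin (a + t * B 0 r))\<^sup>2) * (t * B 1 r) * (u r)\<^sup>2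
     + 2 * m * sin (a + t * B 0 r) * cos (a + t * B 0 r) * F 1 r * u r ^ 3"
    by (simp add: radial_tension_deriv_def u_def divide_inverse power_inverse)
  ultimately show ?thesis
    by (auto intro!: derivative_eq_intros F[simplified] B[simplified] du[simplified])
      (simp add: algebra_simps power2_eq_square power3_eq_cube)
qed

text \<open>For \<open>z k = f\<^sup>(\<^sup>k\<^sup>)\<close> this is the Euler-Lagrange expression of the reduced energy at the constant
  profile \<open>a\<close>, multiplied by \<open>- f\<^sup>6 / (m sin a cos a)\<close> to make it polynomial.  Concretely, let
  \<open>\<Delta> h = h'' + m f'/f h'\<close> and \<open>Q = - \<Delta> (f\<^sup>-\<^sup>2) + m cos\<^sup>2 a f\<^sup>-\<^sup>4\<close>.  Then it equals
  \<open>f\<^sup>6 (\<Delta> Q - m cos (2 a) f\<^sup>-\<^sup>2 Q + m\<^sup>2 sin\<^sup>2 a cos\<^sup>2 a f\<^sup>-\<^sup>6)\<close>.\<close>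

definition triharmonic_poly :: "real \<Rightarrow> real \<Rightarrow> (nat \<Rightarrow> real) \<Rightarrow> real" where
  "triharmonic_poly m a z =
     (let c = (cos a)\<^sup>2; C = cos (2 * a) in
     2 * z 0 ^ 3 * z 4 + (6 * m - 24) * (z 0)\<^sup>2 * z 1 * z 3 + (4 * m - 18) * (z 0)\<^sup>2 * (z 2)\<^sup>2
     + (4 * m\<^sup>2 - 58 * m + 144) * z 0 * (z 1)\<^sup>2 * z 2 - (8 * m\<^sup>2 - 64 * m + 120) * z 1 ^ 4
     - (4 * m * c + 2 * m * C) * z 0 * z 2
     + (20 * m * c - 4 * m\<^sup>2 * c - 2 * m\<^sup>2 * C + 6 * m * C) * (z 1)\<^sup>2
     + m\<^sup>2 * (c * (1 - c) - c * C))"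

text \<open>Differentiate under the integral sign and integrate by parts three times.  The integrations by
  parts are carried out at once: half of the differentiated integrand and the weighted
  Euler-Lagrange expression times the variation differ by the derivative of an explicit function \<open>\<Psi>\<close>, which vanishes at the end points
  together with the variation and its first two derivatives.\<close>

lemma first_variation:
  fixes F B :: "nat \<Rightarrow> real \<Rightarrow> real" and k :: nat and a p q :: real
  assumes F: "derivs_on {0<..<1} F" and pos: "\<And>r. r \<in> {0<..<1} \<Longrightarrow> 0 < F 0 r"
    and B: "derivs_on UNIV B" and supp: "\<And>r. r \<notin> {p<..<q} \<Longrightarrow> B 0 r = 0 \<and> B 1 r = 0 \<and> B 2 r = 0"
    and pq: "0 < p" "p < q" "q < 1"
  defines "m \<equiv> real k"
  shows "((\<lambda>t. integral {p..q} (\<lambda>r. ((radial_tension_deriv m a F B t r)\<^sup>2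
            + m * (cos (a + t * B 0 r))\<^sup>2 * (radial_tension m a F B t r)\<^sup>2 / (F 0 r)\<^sup>2) * F 0 r ^ k))
      has_real_derivative - (2 * m * sin a * cos a) *
          integral {p..q} (\<lambda>r. B 0 r * triharmonic_poly m a (\<lambda>k. F k r) * F 0 r ^ k / F 0 r ^ 6)) (at 0)"
proof -
  define u where "u r = inverse (F 0 r)" for r
  have sub: "{p..q} \<subseteq> {0<..<1}" using pq by auto
  have nz: "F 0 r \<noteq> 0" if "r \<in> {0<..<1}" for r using pos[OF that] by simp
  define T where "T t r = t * B 2 r + m * F 1 r * u r * (t * B 1 r)
     - m * sin (a + t * B 0 r) * cos (a + t * B 0 r) * (u r)\<^sup>2" for t r
  define T1 where "T1 t r = t * B 3 r + m * (F 2 r * u r - (F 1 r * u r)\<^sup>2) * (t * B 1 r)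
     + m * F 1 r * u r * (t * B 2 r)
     - m * ((cos (a + t * B 0 r))\<^sup>2 - (sin (a + t * B 0 r))\<^sup>2) * (t * B 1 r) * (u r)\<^sup>2
     + 2 * m * sin (a + t * B 0 r) * cos (a + t * B 0 r) * F 1 r * u r ^ 3" for t r
  define dT where "dT t r = B 2 r + m * F 1 r * u r * B 1 r
     - m * ((cos (a + t * B 0 r))\<^sup>2 - (sin (a + t * B 0 r))\<^sup>2) * B 0 r * (u r)\<^sup>2" for t r
  define dT1 where "dT1 t r = B 3 r + m * (F 2 r * u r - (F 1 r * u r)\<^sup>2) * B 1 r
     + m * F 1 r * u r * B 2 r
     - m * ((cos (a + t * B 0 r))\<^sup>2 - (sin (a + t * B 0 r))\<^sup>2) * B 1 r * (u r)\<^sup>2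
     + 4 * m * (cos (a + t * B 0 r) * sin (a + t * B 0 r) * B 0 r) * (t * B 1 r) * (u r)\<^sup>2
     + 2 * m * ((cos (a + t * B 0 r))\<^sup>2 - (sin (a + t * B 0 r))\<^sup>2) * B 0 r * F 1 r * u r ^ 3" for t r
  define h where "h t r = ((T1 t r)\<^sup>2 + m * (cos (a + t * B 0 r))\<^sup>2 * (T t r)\<^sup>2 * (u r)\<^sup>2) * F 0 r ^ k" for t r
  \<comment> \<open>\<open>h\<close> is the integrand and \<open>hx\<close> its derivative in \<open>t\<close>; \<open>dT\<close>, \<open>dT1\<close> are those of \<open>T\<close>, \<open>T1\<close>\<close>
  define hx where "hx t r = (2 * T1 t r * dT1 t r + m * (cos (a + t * B 0 r))\<^sup>2 * (2 * T t r * dT t r) * (u r)\<^sup>2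
     - m * (2 * cos (a + t * B 0 r) * sin (a + t * B 0 r) * B 0 r) * (T t r)\<^sup>2 * (u r)\<^sup>2) * F 0 r ^ k" for t r
  have h_eq: "((radial_tension_deriv m a F B t r)\<^sup>2
            + m * (cos (a + t * B 0 r))\<^sup>2 * (radial_tension m a F B t r)\<^sup>2 / (F 0 r)\<^sup>2) * F 0 r ^ k = h t r" for t r
    unfolding h_def radial_tension_deriv_def radial_tension_def T_def T1_def u_def
    by (simp add: divide_inverse power_inverse power_mult_distrib)
  have dT: "((\<lambda>t. T t r) has_real_derivative dT t r) (at t)" for t r
    unfolding T_def dT_def by (auto intro!: derivative_eq_intros) (simp add: algebra_simps power2_eq_square)
  have dT1: "((\<lambda>t. T1 t r) has_real_derivative dT1 t r) (at t)" for t r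
    unfolding T1_def dT1_def by (auto intro!: derivative_eq_intros) (simp add: algebra_simps power2_eq_square)
  have dh: "((\<lambda>t. h t r) has_real_derivative hx t r) (at t)" for t r
    unfolding h_def hx_def
    by (rule DERIV_cmult_right)
      (auto intro!: derivative_eq_intros dT dT1 simp: algebra_simps power2_eq_square)
  have cF: "continuous_on {p..q} (F j)" for j
    using continuous_on_subset[OF derivs_on_continuous[OF F] sub] .
  have cB: "continuous_on {p..q} (B j)" for j
    using continuous_on_subset[OF derivs_on_continuous[OF B]] by blast
  have cu: "continuous_on {p..q} u"
    unfolding u_def[abs_def] using nz sub by (intro continuous_intros cF) auto
  have snd_cont: "continuous_on (UNIV \<times> {p..q}) (\<lambda>z. g (snd z))"
    if "continuous_on {p..q} g" for g :: "real \<Rightarrow> real"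
    by (rule continuous_on_compose2[OF that continuous_on_snd[OF continuous_on_id]]) auto
  have "((\<lambda>t. integral (cbox p q) (h t)) has_real_derivative integral (cbox p q) (hx 0)) (at 0 within UNIV)"
  proof (rule leibniz_rule_field_derivative)
    show "((\<lambda>t. h t r) has_real_derivative hx t r) (at t within UNIV)" for t r using dh .
    show "h t integrable_on cbox p q" for t
      unfolding h_def[abs_def] T_def T1_def
      by (intro integrable_continuous continuous_intros) (auto intro: cF cB cu)
    show "continuous_on (UNIV \<times> cbox p q) (\<lambda>(t, r). hx t r)"
      unfolding hx_def[abs_def] T_def T1_def dT_def dT1_def split_beta cbox_interval
      by (intro continuous_intros snd_cont cF cB cu)
  qed auto
  then have D: "((\<lambda>t. integral {p..q} (h t)) has_real_derivative integral {p..q} (hx 0)) (at 0)"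
    by simp
  let ?s = "sin a" and ?c = "cos a"
  define C where "C = cos (2 * a)"
  have C: "C = ?c\<^sup>2 - ?s\<^sup>2" by (simp add: C_def cos_double)
  have sc: "?s\<^sup>2 = 1 - ?c\<^sup>2" by (simp add: sin_squared_eq)
  define \<kappa> where "\<kappa> = m * ?s * ?c"
  \<comment> \<open>At \<open>t = 0\<close> the tension coefficient is \<open>T\<^sub>0 = - \<kappa> / f\<^sup>2\<close>; with \<open>\<Delta>\<close> the radial Laplacian,
      \<open>P = - \<Delta> T\<^sub>0 + m cos\<^sup>2 a T\<^sub>0 / f\<^sup>2\<close>, and \<open>P1\<close>, \<open>P2\<close> are its derivatives.\<close>
  define P where "P r = - \<kappa> * (2 * F 2 r * u r ^ 3 + ((2 * m - 6) * (F 1 r)\<^sup>2 + m * ?c\<^sup>2) * u r ^ 4)" for r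
  define P1 where "P1 r = - \<kappa> * (2 * F 3 r * u r ^ 3 + (4 * m - 18) * F 1 r * F 2 r * u r ^ 4
      - (8 * m - 24) * F 1 r ^ 3 * u r ^ 5 - 4 * m * ?c\<^sup>2 * F 1 r * u r ^ 5)" for r
  define P2 where "P2 r = - \<kappa> * (2 * F 4 r * u r ^ 3 + (4 * m - 24) * F 1 r * F 3 r * u r ^ 4
      + (4 * m - 18) * (F 2 r)\<^sup>2 * u r ^ 4 - (40 * m - 144) * (F 1 r)\<^sup>2 * F 2 r * u r ^ 5
      + (40 * m - 120) * F 1 r ^ 4 * u r ^ 6 - 4 * m * ?c\<^sup>2 * F 2 r * u r ^ 5
      + 20 * m * ?c\<^sup>2 * (F 1 r)\<^sup>2 * u r ^ 6)" for r
  define dT' where "dT' r = B 2 r + m * F 1 r * u r * B 1 r - m * C * B 0 r * (u r)\<^sup>2" for r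
  define dT1' where "dT1' r = B 3 r + m * (F 2 r * u r - (F 1 r * u r)\<^sup>2) * B 1 r
     + m * F 1 r * u r * B 2 r - m * C * B 1 r * (u r)\<^sup>2 + 2 * m * C * B 0 r * F 1 r * u r ^ 3" for r
  define \<Psi> where "\<Psi> r = F 0 r ^ k * (2 * \<kappa> * F 1 r * u r ^ 3 * dT' r + P r * B 1 r - P1 r * B 0 r)" for r
  \<comment> \<open>the Euler-Lagrange expression \<open>\<Delta> P - m cos (2 a) P / f\<^sup>2 - \<kappa> T\<^sub>0\<^sup>2 / f\<^sup>2\<close>\<close>
  define R where "R r = P2 r + m * F 1 r * u r * P1 r - m * C * P r * (u r)\<^sup>2 - \<kappa> ^ 3 * u r ^ 6" for r
  have R: "R r = - \<kappa> * triharmonic_poly m a (\<lambda>k. F k r) / F 0 r ^ 6" if "r \<in> {0<..<1}" for r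
  proof -
    have "u r * F 0 r = 1" using nz[OF that] by (simp add: u_def)
    have "\<kappa>\<^sup>2 = m\<^sup>2 * (?c\<^sup>2 * (1 - ?c\<^sup>2))"
      by (simp add: \<kappa>_def power_mult_distrib sc mult_ac)
    then have k3: "\<kappa> ^ 3 = \<kappa> * (m\<^sup>2 * (?c\<^sup>2 * (1 - ?c\<^sup>2)))"
      by (simp add: power3_eq_cube power2_eq_square)
    have "R r = - \<kappa> * triharmonic_poly m a (\<lambda>k. F k r) * u r ^ 6"
      using \<open>u r * F 0 r = 1\<close>
      unfolding R_def P_def P1_def P2_def triharmonic_poly_def Let_def C_def[symmetric] k3
      by algebra
    then show ?thesis by (simp add: u_def power_inverse divide_inverse)
  qed
  have d\<Psi>: "(\<Psi> has_real_derivative hx 0 r / 2 - B 0 r * R r * F 0 r ^ k) (at r)" if r: "r \<in> {0<..<1}" for r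
  proof -
    note dF = derivs_on_numerals[OF F r]
    note dB = derivs_on_numerals[OF B UNIV_I, of r]
    have uF: "u r * F 0 r = 1" using nz[OF r] by (simp add: u_def)
    have du: "(u has_real_derivative - F 1 r * (u r)\<^sup>2) (at r)"
      unfolding u_def[abs_def] using nz[OF r] dF(1)
      by (auto intro!: derivative_eq_intros simp: power2_eq_square)
    have dP: "(P has_real_derivative P1 r) (at r)"
      unfolding P_def[abs_def] P1_def
      by (rule derivative_eq_intros dF du refl)+ (simp add: algebra_simps eval_nat_numeral)
    have dP1: "(P1 has_real_derivative P2 r) (at r)"
      unfolding P1_def[abs_def] P2_def
      by (rule derivative_eq_intros dF du refl)+ (simp add: algebra_simps eval_nat_numeral)
    have ddT: "(dT' has_real_derivative dT1' r) (at r)"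
      unfolding dT'_def[abs_def] dT1'_def
      by (rule derivative_eq_intros dF dB du refl)+ (simp add: algebra_simps eval_nat_numeral)
    have dFk: "((\<lambda>r. F 0 r ^ k) has_real_derivative m * F 1 r * u r * F 0 r ^ k) (at r)"
    proof (cases k)
      case 0
      then show ?thesis by (simp add: m_def)
    next
      case (Suc j)
      have "real k * (F 0 r ^ (k - 1)) * F 1 r = m * F 1 r * u r * F 0 r ^ k"
        using uF Suc by (simp add: m_def mult_ac)
      then show ?thesis
        by (auto intro!: derivative_eq_intros dF simp: mult_ac)
    qed
    have dTu: "((\<lambda>r. 2 * \<kappa> * F 1 r * u r ^ 3) has_real_derivative
        2 * \<kappa> * (F 2 r * u r ^ 3 - 3 * (F 1 r)\<^sup>2 * u r ^ 4)) (at r)"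
      by (rule derivative_eq_intros dF du refl)+ (simp add: algebra_simps eval_nat_numeral)
    define G where "G = F 0 r ^ k"
    have "(\<Psi> has_real_derivative
        m * F 1 r * u r * G * (2 * \<kappa> * F 1 r * u r ^ 3 * dT' r + P r * B 1 r - P1 r * B 0 r)
        + G * ((2 * \<kappa> * (F 2 r * u r ^ 3 - 3 * (F 1 r)\<^sup>2 * u r ^ 4)) * dT' r + 2 * \<kappa> * F 1 r * u r ^ 3 * dT1' r
           + (P1 r * B 1 r + P r * B 2 r) - (P2 r * B 0 r + P1 r * B 1 r))) (at r)"
      unfolding \<Psi>_def[abs_def] G_def
      by (rule derivative_eq_intros dFk dTu ddT dP dP1 dB refl)+ (simp add: algebra_simps)
    moreover have "hx 0 r = (2 * (2 * \<kappa> * F 1 r * u r ^ 3) * dT1' r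
        + m * ?c\<^sup>2 * (2 * (- \<kappa> * (u r)\<^sup>2) * dT' r) * (u r)\<^sup>2
        - 2 * \<kappa> * B 0 r * (- \<kappa> * (u r)\<^sup>2)\<^sup>2 * (u r)\<^sup>2) * G"
      unfolding hx_def G_def T_def T1_def dT_def dT1_def dT'_def dT1'_def C \<kappa>_def
      by (simp add: mult_ac)
    moreover have "m * F 1 r * u r * G * (2 * \<kappa> * F 1 r * u r ^ 3 * dT' r + P r * B 1 r - P1 r * B 0 r)
        + G * ((2 * \<kappa> * (F 2 r * u r ^ 3 - 3 * (F 1 r)\<^sup>2 * u r ^ 4)) * dT' r + 2 * \<kappa> * F 1 r * u r ^ 3 * dT1' r
           + (P1 r * B 1 r + P r * B 2 r) - (P2 r * B 0 r + P1 r * B 1 r))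
      = (2 * (2 * \<kappa> * F 1 r * u r ^ 3) * dT1' r
        + m * ?c\<^sup>2 * (2 * (- \<kappa> * (u r)\<^sup>2) * dT' r) * (u r)\<^sup>2
        - 2 * \<kappa> * B 0 r * (- \<kappa> * (u r)\<^sup>2)\<^sup>2 * (u r)\<^sup>2) * G / 2 - B 0 r * R r * G"
    proof -
      have dTP: "dT' r * (2 * \<kappa> * (F 2 r * u r ^ 3 - 3 * (F 1 r)\<^sup>2 * u r ^ 4)
           + m * F 1 r * u r * (2 * \<kappa> * F 1 r * u r ^ 3)) = dT' r * (- P r - m * ?c\<^sup>2 * \<kappa> * u r ^ 4)"
        unfolding P_def by algebra
      have "P r * B 2 r = P r * (dT' r - m * F 1 r * u r * B 1 r + m * C * B 0 r * (u r)\<^sup>2)"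
        by (simp add: dT'_def)
      with dTP show ?thesis
        unfolding R_def by algebra
    qed
    ultimately show ?thesis by (simp add: G_def)
  qed
  have ends: "\<Psi> p = 0" "\<Psi> q = 0"
    using supp[of p] supp[of q] by (simp_all add: \<Psi>_def dT'_def)
  have "((\<lambda>r. hx 0 r / 2 - B 0 r * R r * F 0 r ^ k) has_integral (\<Psi> q - \<Psi> p)) {p..q}"
    using pq sub d\<Psi> by (intro fundamental_theorem_of_calculus)
      (auto simp: has_real_derivative_iff_has_vector_derivative[symmetric]
        intro: has_field_derivative_at_within)
  then have 1: "((\<lambda>r. hx 0 r / 2 - B 0 r * R r * F 0 r ^ k) has_integral 0) {p..q}"
    by (simp add: ends)
  have "(\<lambda>r. B 0 r * R r * F 0 r ^ k) integrable_on {p..q}"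
    unfolding R_def P_def P1_def P2_def
    by (intro integrable_continuous_interval continuous_intros cF cB cu)
  from has_integral_mult_right[OF has_integral_add[OF 1 integrable_integral[OF this]], of 2]
  have "integral {p..q} (hx 0) = 2 * integral {p..q} (\<lambda>r. B 0 r * R r * F 0 r ^ k)"
    by (simp add: integral_unique)
  also have "integral {p..q} (\<lambda>r. B 0 r * R r * F 0 r ^ k)
     = integral {p..q} (\<lambda>r. - \<kappa> * (B 0 r * triharmonic_poly m a (\<lambda>k. F k r) * F 0 r ^ k / F 0 r ^ 6))"
    by (intro Henstock_Kurzweil_Integration.integral_cong) (use sub R in \<open>auto simp: subset_iff\<close>)
  also have "\<dots> = - \<kappa> * integral {p..q} (\<lambda>r. B 0 r * triharmonic_poly m a (\<lambda>k. F k r) * F 0 r ^ k / F 0 r ^ 6)"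
    by (rule integral_mult_right)
  finally have "integral {p..q} (hx 0) = - (2 * m * ?s * ?c)
     * integral {p..q} (\<lambda>r. B 0 r * triharmonic_poly m a (\<lambda>k. F k r) * F 0 r ^ k / F 0 r ^ 6)"
    by (simp add: \<kappa>_def)
  with D show ?thesis by (simp add: h_eq)
qed

section \<open>Smooth compactly supported variations\<close>

lemma has_real_derivative_zero_quadratic:
  fixes g :: "real \<Rightarrow> real"
  assumes "\<And>x. \<bar>g x\<bar> \<le> M * (x - c)\<^sup>2"
  shows "(g has_real_derivative 0) (at c)"
proof -
  have g0: "g c = 0" using assms[of c] by simp
  have "((\<lambda>h. (g (c + h) - g c) / h) \<longlongrightarrow> 0) (at 0)"
  proof (rule Lim_null_comparison)
    show "\<forall>\<^sub>F h in at 0. norm ((g (c + h) - g c) / h) \<le> M * \<bar>h\<bar>"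
    proof (rule eventually_at_filter[THEN iffD2, OF always_eventually], safe)
      fix h :: real assume "h \<noteq> 0"
      then show "norm ((g (c + h) - g c) / h) \<le> M * \<bar>h\<bar>"
        using assms[of "c + h"] by (simp add: g0 abs_divide divide_le_eq power2_eq_square abs_mult mult_ac)
    qed
    show "((\<lambda>h. M * \<bar>h\<bar>) \<longlongrightarrow> 0) (at 0)"
      by (auto intro!: tendsto_eq_intros)
  qed
  then show ?thesis by (simp add: DERIV_def)
qed

text \<open>The exponential beats every power: apply \<open>1 + x \<le> exp x\<close> at \<open>x = 1 / (j w)\<close> and raise to the
  power \<open>j\<close>.\<close>

lemma exp_neg_inverse_le:
  fixes w :: real
  assumes "0 < w" "0 < j"
  shows "exp (- (1 / w)) \<le> (real j * w) ^ j"
proof -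
  have "1 / (real j * w) \<le> exp (1 / (real j * w))"
    using exp_ge_add_one_self[of "1 / (real j * w)"] by linarith
  then have "(1 / (real j * w)) ^ j \<le> exp (1 / (real j * w)) ^ j"
    using assms by (intro power_mono) auto
  also have "exp (1 / (real j * w)) ^ j = exp (1 / w)"
    using assms by (simp flip: exp_of_nat_mult)
  finally show ?thesis
    using assms by (simp add: exp_minus power_divide field_simps)
qed

text \<open>The function is \<open>exp (- 1 / w)\<close> with \<open>w = (r - p) (q - r)\<close>.  Its \<open>k\<close>-th derivative is
  \<open>N\<^sub>k w\<^sup>-\<^sup>2\<^sup>k exp (- 1 / w)\<close> for polynomials \<open>N\<^sub>k\<close> given by a recursion, and it is bounded by a
  multiple of \<open>(r - c)\<^sup>2\<close> at either end point \<open>c\<close>, hence differentiable there with derivative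
  zero.\<close>

lemma smooth_bump_exists:
  fixes p q :: real
  assumes "p < q"
  obtains B where "derivs_on UNIV B" "\<And>k r. r \<notin> {p<..<q} \<Longrightarrow> B k r = 0"
    "\<And>r. r \<in> {p<..<q} \<Longrightarrow> 0 < B 0 r"
proof -
  define W where "W = [:- (p * q), p + q, -1:]"
  define w where "w r = (r - p) * (q - r)" for r
  define w' where "w' r = p + q - 2 * r" for r
  have W: "poly W r = w r" "poly (pderiv W) r = w' r" for r
    by (simp_all add: W_def w_def w'_def pderiv_pCons algebra_simps)
  define N where "N = rec_nat (1 :: real poly)
    (\<lambda>k P. pderiv P * W\<^sup>2 - smult (2 * real k) (P * pderiv W * W) + P * pderiv W)"
  have N: "N 0 = 1"
    "N (Suc k) = pderiv (N k) * W\<^sup>2 - smult (2 * real k) (N k * pderiv W * W) + N k * pderiv W" for k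
    by (simp_all add: N_def)
  define B where "B k r = (if r \<in> {p<..<q} then poly (N k) r / w r ^ (2 * k) * exp (- (1 / w r)) else 0)" for k r
  have wpos: "0 < w r" if "r \<in> {p<..<q}" for r using that by (simp add: w_def)
  have quad: "\<exists>M. \<forall>x. \<bar>B k x\<bar> \<le> M * (x - c)\<^sup>2" if c: "c = p \<or> c = q" for k c
  proof -
    have "compact (poly (N k) ` {p..q})"
      by (intro compact_continuous_image continuous_intros) auto
    then have "bounded (poly (N k) ` {p..q})" by (rule compact_imp_bounded)
    then obtain M where "\<forall>y\<in>poly (N k) ` {p..q}. norm y \<le> M"
      unfolding bounded_iff by blast
    then have M: "\<bar>poly (N k) x\<bar> \<le> M" if "x \<in> {p..q}" for x
      using that by auto
    have M0: "0 \<le> M" using M[of p] assms by auto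
    \<comment> \<open>this power of \<open>w\<close> cancels the denominator and leaves the factor \<open>w\<^sup>2\<close>\<close>
    define j where "j = 2 * k + 2"
    define L where "L = M * real j ^ j * (q - p)\<^sup>2"
    have "\<bar>B k x\<bar> \<le> L * (x - c)\<^sup>2" for x
    proof (cases "x \<in> {p<..<q}")
      case True
      have w: "0 < w x" using wpos[OF True] .
      have "\<bar>w x\<bar> \<le> (q - p) * \<bar>x - c\<bar>"
        using c
      proof
        assume "c = p"
        then show ?thesis
          using mult_left_mono[of "q - x" "q - p" "x - p"] True by (simp add: w_def abs_mult mult.commute)
      next
        assume "c = q"
        then show ?thesis
          using mult_right_mono[of "x - p" "q - p" "q - x"] True by (simp add: w_def abs_mult)
      qed
      then have w2: "(w x)\<^sup>2 \<le> (q - p)\<^sup>2 * (x - c)\<^sup>2"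
        using power_mono[of "\<bar>w x\<bar>" "(q - p) * \<bar>x - c\<bar>" 2] by (simp add: power_mult_distrib)
      have "\<bar>B k x\<bar> = \<bar>poly (N k) x\<bar> / w x ^ (2 * k) * exp (- (1 / w x))"
        using True w by (simp add: B_def abs_mult)
      also have "\<dots> \<le> M / w x ^ (2 * k) * (real j * w x) ^ j"
        using w True M M0 by (intro mult_mono divide_right_mono exp_neg_inverse_le) (auto simp: j_def)
      also have "\<dots> = M * real j ^ j * (w x)\<^sup>2"
        using w by (simp add: j_def power_mult_distrib power_add power2_eq_square)
      also have "\<dots> \<le> L * (x - c)\<^sup>2"
        unfolding L_def using mult_left_mono[OF w2, of "M * real j ^ j"] M0 by (simp add: mult_ac)
      finally show ?thesis .
    next
      case False
      then have "B k x = 0" by (auto simp: B_def)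
      then show ?thesis using M0 by (simp add: L_def)
    qed
    then show ?thesis by blast
  qed
  have "(B k has_real_derivative B (Suc k) r) (at r)" for k r
  proof -
    consider "r \<in> {p<..<q}" | "r = p \<or> r = q" | "r < p" | "r > q" by fastforce
    then show ?thesis
    proof cases
      case 1
      have w: "w r \<noteq> 0" using wpos[OF 1] by simp
      have dw: "(w has_real_derivative w' r) (at r)"
        unfolding w_def[abs_def] w'_def by (auto intro!: derivative_eq_intros)
      have dv: "((\<lambda>r. inverse (w r)) has_real_derivative - w' r * (inverse (w r))\<^sup>2) (at r)"
        using w dw by (auto intro!: derivative_eq_intros simp: power2_eq_square)
      have dpow: "((\<lambda>r. inverse (w r) ^ (2 * k)) has_real_derivative
          - (2 * real k) * w' r * inverse (w r) ^ (2 * k) * inverse (w r)) (at r)"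
        by (rule DERIV_cong[OF DERIV_power[OF dv]]) (cases k; simp add: power2_eq_square algebra_simps)
      have "((\<lambda>r. poly (N k) r * inverse (w r) ^ (2 * k) * exp (- inverse (w r))) has_real_derivative
         (poly (pderiv (N k)) r * inverse (w r) ^ (2 * k)
           + (- (2 * real k) * w' r * inverse (w r) ^ (2 * k) * inverse (w r)) * poly (N k) r)
            * exp (- inverse (w r))
         + (exp (- inverse (w r)) * - (- w' r * (inverse (w r))\<^sup>2))
           * (poly (N k) r * inverse (w r) ^ (2 * k))) (at r)"
        by (intro DERIV_mult poly_DERIV dpow DERIV_fun_exp DERIV_minus dv)
      also have "(poly (pderiv (N k)) r * inverse (w r) ^ (2 * k)
           + (- (2 * real k) * w' r * inverse (w r) ^ (2 * k) * inverse (w r)) * poly (N k) r)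
            * exp (- inverse (w r))
         + (exp (- inverse (w r)) * - (- w' r * (inverse (w r))\<^sup>2))
           * (poly (N k) r * inverse (w r) ^ (2 * k)) = B (Suc k) r"
        using w 1 by (simp add: B_def N W field_simps power2_eq_square)
      finally show ?thesis
        by (rule has_field_derivative_transform_within_open[of _ _ _ "{p<..<q}"])
          (use 1 in \<open>auto simp: B_def divide_inverse power_inverse\<close>)
    next
      case 2
      then obtain M where "\<And>x. \<bar>B k x\<bar> \<le> M * (x - r)\<^sup>2" using quad[of r k] by blast
      then have "(B k has_real_derivative 0) (at r)" by (rule has_real_derivative_zero_quadratic)
      moreover have "B (Suc k) r = 0" using 2 by (auto simp: B_def)
      ultimately show ?thesis by simp
    next
      case 3
      then have "((\<lambda>_. 0) has_real_derivative B (Suc k) r) (at r)" by (simp add: B_def)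
      then show ?thesis
        by (rule has_field_derivative_transform_within_open[OF _ open_lessThan[of p]])
          (use 3 in \<open>simp_all add: B_def\<close>)
    next
      case 4
      then have "((\<lambda>_. 0) has_real_derivative B (Suc k) r) (at r)" by (simp add: B_def)
      then show ?thesis
        by (rule has_field_derivative_transform_within_open[OF _ open_greaterThan[of q]])
          (use 4 in \<open>simp_all add: B_def\<close>)
    qed
  qed
  then have dB: "derivs_on UNIV B" by (simp add: derivs_on_def)
  show thesis
  proof (rule that[OF dB])
    show "B k r = 0" if "r \<notin> {p<..<q}" for k r using that by (auto simp: B_def)
    show "0 < B 0 r" if "r \<in> {p<..<q}" for r using that by (simp add: B_def N)
  qed
qed

text \<open>Generators for the coordinates of the variation of \<open>phi a\<close>, chosen such that the algebra is closed
  under directional derivatives away from the pole.  Closure gives smoothness of all its members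
  without any rule for higher derivatives of products and compositions.\<close>

inductive variation_algebra ::
  "real \<Rightarrow> (nat \<Rightarrow> real \<Rightarrow> real) \<Rightarrow> (real \<times> 'a::real_inner \<Rightarrow> real) \<Rightarrow> bool" for a B where
  const: "variation_algebra a B (\<lambda>z. c)"
| time: "variation_algebra a B fst"
| coord: "variation_algebra a B (\<lambda>z. snd z \<bullet> v)"
| inverse_norm: "variation_algebra a B (\<lambda>z. inverse (norm (snd z)))"
| radial: "variation_algebra a B (\<lambda>z. B k (norm (snd z)))"
| sin: "variation_algebra a B (\<lambda>z. sin (a + fst z * B 0 (norm (snd z))))"
| cos: "variation_algebra a B (\<lambda>z. cos (a + fst z * B 0 (norm (snd z))))"
| add: "variation_algebra a B g \<Longrightarrow> variation_algebra a B h \<Longrightarrow> variation_algebra a B (\<lambda>z. g z + h z)"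
| mult: "variation_algebra a B g \<Longrightarrow> variation_algebra a B h \<Longrightarrow> variation_algebra a B (\<lambda>z. g z * h z)"

lemma variation_algebra_derivative:
  fixes h :: "real \<times> 'a::real_inner \<Rightarrow> real"
  assumes B: "derivs_on UNIV B" and h: "variation_algebra a B h"
  shows "\<exists>h'. (\<forall>v. variation_algebra a B (h' v)) \<and>
               (\<forall>z. snd z \<noteq> 0 \<longrightarrow> (h has_derivative (\<lambda>v. h' v z)) (at z))"
proof -
  define N where "N v z = inverse (norm (snd z)) * (snd z \<bullet> snd v)" for v z :: "real \<times> 'a"
  have N: "variation_algebra a B (N v)" for v
    unfolding N_def[abs_def] by (intro variation_algebra.intros)
  have sndd: "(snd has_derivative snd) (at z)" for z :: "real \<times> 'a"
    by (rule has_derivative_snd[OF has_derivative_ident])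
  have fstd: "(fst has_derivative fst) (at z)" for z :: "real \<times> 'a"
    by (rule has_derivative_fst[OF has_derivative_ident])
  have comp: "((\<lambda>z. g (norm (snd z))) has_derivative (\<lambda>v. d * N v z)) (at z)"
    if "(g has_real_derivative d) (at (norm (snd z)))" "snd z \<noteq> 0" for g d and z :: "real \<times> 'a"
    using has_derivative_compose[OF sndd has_derivative_radial[OF that]]
    by (simp add: N_def sgn_div_norm mult_ac)
  show ?thesis
    using h
  proof induction
    case (const c)
    show ?case
      by (rule exI[of _ "\<lambda>v z. 0"]) (auto intro: variation_algebra.intros)
  next
    case time
    show ?case
      by (rule exI[of _ "\<lambda>v z. fst v"]) (auto intro: variation_algebra.intros fstd)
  next
    case (coord u)
    show ?case
      by (rule exI[of _ "\<lambda>v z. snd v \<bullet> u"])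
        (auto intro!: variation_algebra.intros derivative_eq_intros sndd)
  next
    case inverse_norm
    have D: "((\<lambda>z. inverse (norm (snd z))) has_derivative
        (\<lambda>v. - 1 * (inverse (norm (snd z)) * inverse (norm (snd z))) * N v z)) (at z)"
      if "snd z \<noteq> 0" for z :: "real \<times> 'a"
      using that by (intro comp) (auto intro!: derivative_eq_intros)
    show ?case
      by (intro exI[of _ "\<lambda>v z. - 1 * (inverse (norm (snd z)) * inverse (norm (snd z))) * N v z"]
          conjI allI impI variation_algebra.intros N D)
  next
    case (radial k)
    show ?case
      by (intro exI[of _ "\<lambda>v z. B (Suc k) (norm (snd z)) * N v z"])
        (auto intro!: variation_algebra.intros N comp derivs_onD[OF B])
  next
    case sin
    let ?g = "\<lambda>v z. fst z * (B 1 (norm (snd z)) * N v z) + fst v * B 0 (norm (snd z))"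
    have inner: "((\<lambda>z. fst z * B 0 (norm (snd z))) has_derivative (\<lambda>v. ?g v z)) (at z)"
      if "snd z \<noteq> 0" for z :: "real \<times> 'a"
      by (intro has_derivative_mult fstd comp that derivs_on_numerals[OF B]) simp
    have outer: "((\<lambda>s. sin (a + s)) has_derivative (\<lambda>h. cos (a + s) * h)) (at s)" for s
      by (auto intro!: derivative_eq_intros)
    have "((\<lambda>z. sin (a + fst z * B 0 (norm (snd z)))) has_derivative
        (\<lambda>v. cos (a + fst z * B 0 (norm (snd z))) * ?g v z)) (at z)"
      if "snd z \<noteq> 0" for z :: "real \<times> 'a"
      using has_derivative_compose[OF inner[OF that] outer] .
    note D = this
    show ?case
      by (intro exI[of _ "\<lambda>v z. cos (a + fst z * B 0 (norm (snd z))) * ?g v z"]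
          conjI allI impI variation_algebra.intros N D)
  next
    case cos
    let ?g = "\<lambda>v z. fst z * (B 1 (norm (snd z)) * N v z) + fst v * B 0 (norm (snd z))"
    have inner: "((\<lambda>z. fst z * B 0 (norm (snd z))) has_derivative (\<lambda>v. ?g v z)) (at z)"
      if "snd z \<noteq> 0" for z :: "real \<times> 'a"
      by (intro has_derivative_mult fstd comp that derivs_on_numerals[OF B]) simp
    have outer: "((\<lambda>s. cos (a + s)) has_derivative (\<lambda>h. - 1 * (sin (a + s) * h))) (at s)" for s
      by (auto intro!: derivative_eq_intros)
    have "((\<lambda>z. cos (a + fst z * B 0 (norm (snd z)))) has_derivative
        (\<lambda>v. - 1 * (sin (a + fst z * B 0 (norm (snd z))) * ?g v z))) (at z)"
      if "snd z \<noteq> 0" for z :: "real \<times> 'a"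
      using has_derivative_compose[OF inner[OF that] outer] .
    note D = this
    show ?case
      by (intro exI[of _ "\<lambda>v z. - 1 * (sin (a + fst z * B 0 (norm (snd z))) * ?g v z)"]
          conjI allI impI variation_algebra.intros N D)
  next
    case (add g h)
    then obtain g' h' where
      "\<forall>v. variation_algebra a B (g' v)" "\<forall>v. variation_algebra a B (h' v)"
      "\<forall>z. snd z \<noteq> 0 \<longrightarrow> (g has_derivative (\<lambda>v. g' v z)) (at z)"
      "\<forall>z. snd z \<noteq> 0 \<longrightarrow> (h has_derivative (\<lambda>v. h' v z)) (at z)"
      by blast
    then show ?case
      by (intro exI[of _ "\<lambda>v z. g' v z + h' v z"])
        (auto intro!: variation_algebra.intros has_derivative_add)
  next
    case (mult g h)
    then obtain g' h' where
      "\<forall>v. variation_algebra a B (g' v)" "\<forall>v. variation_algebra a B (h' v)"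
      "\<forall>z. snd z \<noteq> 0 \<longrightarrow> (g has_derivative (\<lambda>v. g' v z)) (at z)"
      "\<forall>z. snd z \<noteq> 0 \<longrightarrow> (h has_derivative (\<lambda>v. h' v z)) (at z)"
      by blast
    with mult.hyps show ?case
      by (intro exI[of _ "\<lambda>v z. g z * h' v z + g' v z * h z"])
        (auto intro!: variation_algebra.intros has_derivative_mult)
  qed
qed

text \<open>Induction on the order: the coordinates of a directional derivative lie in the algebra again.\<close>

lemma variation_algebra_smooth:
  fixes G :: "real \<times> 'a::euclidean_space \<Rightarrow> 'b::euclidean_space"
  assumes B: "derivs_on UNIV B" and U: "open U" "\<And>z. z \<in> U \<Longrightarrow> snd z \<noteq> 0"
    and G: "\<And>b. b \<in> Basis \<Longrightarrow> \<exists>h. variation_algebra a B h \<and> (\<forall>z\<in>U. G z \<bullet> b = h z)"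
  shows "smooth_on U G"
proof -
  have deriv: "\<exists>G'. (\<forall>z\<in>U. (G has_derivative (\<lambda>v. G' v z)) (at z)) \<and>
      (\<forall>v. \<forall>b\<in>Basis. variation_algebra a B (\<lambda>z. G' v z \<bullet> b))"
    if G: "\<And>b. b \<in> Basis \<Longrightarrow> \<exists>h. variation_algebra a B h \<and> (\<forall>z\<in>U. G z \<bullet> b = h z)"
    for G :: "real \<times> 'a \<Rightarrow> 'b"
  proof -
    have "\<exists>h'. (\<forall>v. variation_algebra a B (h' v)) \<and>
        (\<forall>z\<in>U. ((\<lambda>z. G z \<bullet> b) has_derivative (\<lambda>v. h' v z)) (at z))" if b: "b \<in> Basis" for b
    proof -
      obtain h where h: "variation_algebra a B h" "\<forall>z\<in>U. G z \<bullet> b = h z" using G[OF b] by blast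
      obtain h' where h': "\<forall>v. variation_algebra a B (h' v)"
        "\<forall>z. snd z \<noteq> 0 \<longrightarrow> (h has_derivative (\<lambda>v. h' v z)) (at z)"
        using variation_algebra_derivative[OF B h(1)] by blast
      have "((\<lambda>z. G z \<bullet> b) has_derivative (\<lambda>v. h' v z)) (at z)" if "z \<in> U" for z
        by (rule has_derivative_transform_within_open
            [OF h'(2)[rule_format, OF U(2)[OF that]] U(1) that]) (use h(2) in simp)
      with h' show ?thesis by blast
    qed
    then obtain h' where hh: "\<forall>b\<in>Basis. (\<forall>v. variation_algebra a B (h' b v)) \<and>
        (\<forall>z\<in>U. ((\<lambda>z. G z \<bullet> b) has_derivative (\<lambda>v. h' b v z)) (at z))"
      using bchoice[of Basis "\<lambda>b h'. (\<forall>v. variation_algebra a B (h' v)) \<and>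
        (\<forall>z\<in>U. ((\<lambda>z. G z \<bullet> b) has_derivative (\<lambda>v. h' v z)) (at z))"] by auto
    have h'1: "variation_algebra a B (h' b v)" if "b \<in> Basis" for b v
      using bspec[OF hh that] by (elim conjE) (erule spec)
    have h'2: "((\<lambda>z. G z \<bullet> b) has_derivative (\<lambda>v. h' b v z)) (at z)"
      if "b \<in> Basis" "z \<in> U" for b z
      using bspec[OF hh that(1)] that(2) by (elim conjE) (erule bspec)
    define G' where "G' v z = (\<Sum>b\<in>Basis. h' b v z *\<^sub>R b)" for v z
    have G'b: "G' v z \<bullet> b = h' b v z" if "b \<in> Basis" for v z b
      using that by (simp add: G'_def)
    have "(G has_derivative (\<lambda>v. G' v z)) (at z)" if "z \<in> U" for z
      by (rule has_derivative_componentwise_within[THEN iffD2]) (use h'2 that in \<open>simp add: G'b\<close>)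
    moreover have "variation_algebra a B (\<lambda>z. G' v z \<bullet> b)" if "b \<in> Basis" for v b
      using h'1[OF that] by (simp add: G'b[OF that])
    ultimately show ?thesis by (intro exI[of _ G'] conjI ballI allI)
  qed
  have "Ck_on k U G"
    if "\<And>b. b \<in> Basis \<Longrightarrow> \<exists>h. variation_algebra a B h \<and> (\<forall>z\<in>U. G z \<bullet> b = h z)"
    for k and G :: "real \<times> 'a \<Rightarrow> 'b"
    using that
  proof (induction k arbitrary: G)
    case 0
    obtain G' where "\<forall>z\<in>U. (G has_derivative (\<lambda>v. G' v z)) (at z)"
      using deriv[OF 0] by blast
    then show ?case
      by (auto intro!: continuous_at_imp_continuous_on has_derivative_continuous)
  next
    case (Suc k)
    obtain G' where G': "\<And>z. z \<in> U \<Longrightarrow> (G has_derivative (\<lambda>v. G' v z)) (at z)"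
      "\<And>v b. b \<in> Basis \<Longrightarrow> variation_algebra a B (\<lambda>z. G' v z \<bullet> b)"
      using deriv[OF Suc.prems] by blast
    have "frechet_derivative G (at z) v = G' v z" if "z \<in> U" for z v
      using frechet_derivative_at[OF G'(1)[OF that]] by metis
    then have "Ck_on k U (\<lambda>z. frechet_derivative G (at z) v)" for v
    proof (intro Suc.IH)
      fix b :: 'b assume b: "b \<in> Basis"
      show "\<exists>h. variation_algebra a B h \<and> (\<forall>z\<in>U. frechet_derivative G (at z) v \<bullet> b = h z)"
        by (intro exI[of _ "\<lambda>z. G' v z \<bullet> b"] conjI G'(2) b ballI)
          (simp add: \<open>\<And>z v. z \<in> U \<Longrightarrow> frechet_derivative G (at z) v = G' v z\<close>)
    qed
    moreover have "\<forall>z\<in>U. G differentiable (at z)"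
      using G'(1) by (auto simp: differentiable_def)
    ultimately show ?case by simp
  qed
  with G show ?thesis by (simp add: smooth_on_def)
qed

section \<open>The Euler-Lagrange equation\<close>

lemma compact_shell: "0 < p \<Longrightarrow> compact {x :: 'a::euclidean_space. p \<le> norm x \<and> norm x \<le> q}"
proof -
  have "{x :: 'a. p \<le> norm x \<and> norm x \<le> q} = cball 0 q - ball 0 p"
    by (auto simp: not_less)
  then show ?thesis by (simp add: compact_diff)
qed

lemma smooth_equivariant_variation:
  assumes "derivs_on UNIV B" "open U" "\<And>z. z \<in> U \<Longrightarrow> snd z \<noteq> 0"
  shows "smooth_on U (\<lambda>z :: real \<times> (real^'n::finite).
    equivariant (\<lambda>r. sin (a + fst z * B 0 r)) (\<lambda>r. cos (a + fst z * B 0 r)) (snd z))"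
proof (rule variation_algebra_smooth[OF assms])
  fix b :: "(real^'n) \<times> real"
  let ?h = "\<lambda>z :: real \<times> (real^'n). sin (a + fst z * B 0 (norm (snd z)))
      * (inverse (norm (snd z)) * (snd z \<bullet> fst b)) + cos (a + fst z * B 0 (norm (snd z))) * snd b"
  have "variation_algebra a B ?h"
    by (intro variation_algebra.intros)
  moreover have "equivariant (\<lambda>r. sin (a + fst z * B 0 r)) (\<lambda>r. cos (a + fst z * B 0 r)) (snd z) \<bullet> b = ?h z" for z
    by (simp add: equivariant_def inner_prod_def sgn_div_norm)
  ultimately show "\<exists>h. variation_algebra a B h \<and> (\<forall>z\<in>U.
      equivariant (\<lambda>r. sin (a + fst z * B 0 r)) (\<lambda>r. cos (a + fst z * B 0 r)) (snd z) \<bullet> b = h z)"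
    by blast
qed

text \<open>The variation moves the latitude \<open>a\<close> to \<open>a + t B 0 r\<close> on the sphere of radius \<open>r\<close>.  It is
  constant off the shell that supports \<open>B\<close>, so that it is admissible; the derivative of the energy
  along it is the first variation of the reduced energy.\<close>

lemma triharmonic_integral_eq_zero:
  fixes F B :: "nat \<Rightarrow> real \<Rightarrow> real" and a p q :: real
  assumes F: "derivs_on {0<..<1} F" and pos: "\<And>r. r \<in> {0<..<1} \<Longrightarrow> 0 < F 0 r"
    and B: "derivs_on UNIV B" and supp: "\<And>k r. r \<notin> {p<..<q} \<Longrightarrow> B k r = 0"
    and pq: "0 < p" "p < q" "q < 1" and a: "0 < a" "a < pi / 2" and n: "2 \<le> CARD('n::finite)"
    and tri: "triharmonic_on (ball 0 1 - {0}) (warped_metric (F 0)) (phi a :: real^'n \<Rightarrow> (real^'n) \<times> real)"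
  defines "m \<equiv> real CARD('n) - 1"
  shows "integral {p..q} (\<lambda>r. B 0 r * triharmonic_poly m a (\<lambda>k. F k r)
           * F 0 r ^ (CARD('n) - 1) / F 0 r ^ 6) = 0"
proof -
  define U where "U = ball 0 1 - {0 :: real^'n}"
  define K where "K = {x :: real^'n. p \<le> norm x \<and> norm x \<le> q}"
  define \<Phi> where "\<Phi> z = equivariant (\<lambda>r. sin (a + fst z * B 0 r)) (\<lambda>r. cos (a + fst z * B 0 r)) (snd z)"
    for z :: "real \<times> (real^'n)"
  have m: "m = real (CARD('n) - 1)" using n by (simp add: m_def of_nat_diff)
  have K: "compact K" "K \<subseteq> U"
    using compact_shell[OF pq(1)] pq by (auto simp: K_def U_def)
  have smooth: "smooth_on ({-1<..<1} \<times> U) \<Phi>"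
    unfolding \<Phi>_def[abs_def] by (rule smooth_equivariant_variation[OF B])
      (auto simp: U_def intro!: open_Times)
  have sphere: "\<Phi> (t, x) \<in> sphere 0 1" if "x \<in> U" for t x
  proof -
    have "\<Phi> (t, x) \<bullet> \<Phi> (t, x) = 1"
      using that by (simp add: \<Phi>_def U_def equivariant_inner flip: power2_eq_square)
    then show ?thesis by (simp add: norm_eq_1)
  qed
  have phi: "\<Phi> (0, x) = phi a x" for x
    by (simp add: \<Phi>_def equivariant_def phi_def)
  have off: "\<Phi> (t, x) = phi a x" if "x \<notin> K" for t x
    using that supp[of "norm x" 0] by (auto simp: \<Phi>_def equivariant_def phi_def K_def)
  have "((\<lambda>t. E3 (warped_metric (F 0)) (\<lambda>x. \<Phi> (t, x)) K) has_real_derivative 0) (at 0)"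
    using tri K smooth sphere phi off unfolding triharmonic_on_def U_def[symmetric]
    by (elim conjE allE[where x = "1::real"] allE[where x = K] allE[where x = \<Phi>] impE) auto
  define c where "c = real CARD('n) * unit_ball_vol (real CARD('n)) / 2"
  have c: "0 < c" using n by (simp add: c_def)
  define J where "J t = integral {p..q} (\<lambda>r. ((radial_tension_deriv m a F B t r)\<^sup>2
            + m * (cos (a + t * B 0 r))\<^sup>2 * (radial_tension m a F B t r)\<^sup>2 / (F 0 r)\<^sup>2)
              * F 0 r ^ (CARD('n) - 1))" for t
  have nz: "F 0 r \<noteq> 0" if "r \<in> {0<..<1}" for r using pos[OF that] by simp
  have "E3 (warped_metric (F 0)) (\<lambda>x. \<Phi> (t, x)) K = c * J t" for t
    unfolding \<Phi>_def fst_conv snd_conv K_def c_def J_def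
  proof (rule E3_equivariant[where ?\<alpha>1.0 = "\<lambda>r. t * B 1 r" and ?\<alpha>2.0 = "\<lambda>r. t * B 2 r"
        and ?f1.0 = "F 1"])
    show "((\<lambda>r. a + t * B 0 r) has_real_derivative t * B 1 r) (at r)"
      "((\<lambda>r. t * B 1 r) has_real_derivative t * B 2 r) (at r)" for r
      using derivs_on_numerals[OF B UNIV_I, of r]
      by (auto intro!: derivative_eq_intros)
    show "(F 0 has_real_derivative F 1 r) (at r)" if "r \<in> {0<..<1}" for r
      using derivs_on_numerals[OF F that] by simp
    show "radial_tension m a F B t r = t * B 2 r + m * F 1 r / F 0 r * (t * B 1 r)
        - m * sin (a + t * B 0 r) * cos (a + t * B 0 r) / (F 0 r)\<^sup>2" for r
      by (simp add: radial_tension_def)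
    show "(radial_tension m a F B t has_real_derivative radial_tension_deriv m a F B t r) (at r)"
      if "r \<in> {0<..<1}" for r
      by (rule radial_tension_has_derivative[OF F B that nz[OF that]])
    have "continuous_on {p..q} (F j)" "continuous_on {p..q} (B j)" for j
      using derivs_on_continuous[OF F, of j] derivs_on_continuous[OF B, of j] pq
      by (auto elim!: continuous_on_subset)
    then show "continuous_on {p..q} (radial_tension_deriv m a F B t)"
      unfolding radial_tension_deriv_def[abs_def] using nz pq
      by (intro continuous_intros) (auto dest!: nz)
  qed (use pq pos in \<open>auto simp: m_def\<close>)
  then have "((\<lambda>t. c * J t) has_real_derivative 0) (at 0)"
    using \<open>((\<lambda>t. E3 (warped_metric (F 0)) (\<lambda>x. \<Phi> (t, x)) K) has_real_derivative 0) (at 0)\<close> by simp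
  moreover have "((\<lambda>t. c * J t) has_real_derivative c * (- (2 * m * sin a * cos a) *
          integral {p..q} (\<lambda>r. B 0 r * triharmonic_poly m a (\<lambda>k. F k r) * F 0 r ^ (CARD('n) - 1) / F 0 r ^ 6))) (at 0)"
    unfolding J_def m
    by (intro DERIV_cmult first_variation F pos B pq) (use supp in auto)
  ultimately have "c * (- (2 * m * sin a * cos a) *
          integral {p..q} (\<lambda>r. B 0 r * triharmonic_poly m a (\<lambda>k. F k r) * F 0 r ^ (CARD('n) - 1) / F 0 r ^ 6)) = 0"
    by (rule DERIV_unique[symmetric])
  moreover have "0 < sin a" "0 < cos a" "0 < m"
    using a n by (auto intro!: sin_gt_zero cos_gt_zero simp: m_def)
  ultimately show ?thesis using c by simp
qed

text \<open>The fundamental lemma of the calculus of variations: near a point where the expression does not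
  vanish it has a sign, and a bump function supported there gives a non-zero integral.\<close>

lemma triharmonic_ode:
  fixes F :: "nat \<Rightarrow> real \<Rightarrow> real" and a :: real
  assumes F: "derivs_on {0<..<1} F" and pos: "\<And>r. r \<in> {0<..<1} \<Longrightarrow> 0 < F 0 r"
    and a: "0 < a" "a < pi / 2" and n: "2 \<le> CARD('n::finite)"
    and tri: "triharmonic_on (ball 0 1 - {0}) (warped_metric (F 0)) (phi a :: real^'n \<Rightarrow> (real^'n) \<times> real)"
    and r: "r \<in> {0<..<1}"
  shows "triharmonic_poly (real CARD('n) - 1) a (\<lambda>k. F k r) = 0"
proof (rule ccontr)
  assume neq: "triharmonic_poly (real CARD('n) - 1) a (\<lambda>k. F k r) \<noteq> 0"
  define g where "g r = triharmonic_poly (real CARD('n) - 1) a (\<lambda>k. F k r)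
      * F 0 r ^ (CARD('n) - 1) / F 0 r ^ 6" for r
  have gr: "g r \<noteq> 0" using neq pos[OF r] by (auto simp: g_def)
  have "continuous_on {0<..<1} g"
    unfolding g_def[abs_def] triharmonic_poly_def Let_def
    by (intro continuous_intros derivs_on_continuous[OF F]) (auto dest!: pos)
  then have cgr: "continuous_on {0<..<1} (\<lambda>s. g s * g r)"
    by (intro continuous_intros)
  have "open {s \<in> {0<..<1}. 0 < g s * g r}"
    using continuous_open_preimage[OF cgr open_greaterThanLessThan open_greaterThan[of 0]]
    by (simp add: Int_def vimage_def greaterThan_def)
  moreover have "r \<in> {s \<in> {0<..<1}. 0 < g s * g r}"
    using r gr by (auto simp: zero_less_mult_iff linorder_neq_iff)
  ultimately obtain e where e: "0 < e" "cball r e \<subseteq> {s \<in> {0<..<1}. 0 < g s * g r}"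
    using open_contains_cball by blast
  define p q where "p = r - e" and "q = r + e"
  have sub: "{p..q} \<subseteq> {s \<in> {0<..<1}. 0 < g s * g r}"
    using e(2) by (auto simp: p_def q_def cball_def dist_real_def subset_iff)
  have pq: "0 < p" "p < q" "q < 1" "r \<in> {p<..<q}"
    using sub e(1) by (auto simp: p_def q_def subset_iff)
  obtain B where B: "derivs_on UNIV B" "\<And>k r. r \<notin> {p<..<q} \<Longrightarrow> B k r = 0"
    "\<And>r. r \<in> {p<..<q} \<Longrightarrow> 0 < B 0 r"
    using smooth_bump_exists[OF pq(2)] by blast
  have "integral {p..q} (\<lambda>s. B 0 s * g s) = 0"
    using triharmonic_integral_eq_zero[OF F pos B(1,2) pq(1-3) a n tri] by (simp add: g_def mult.assoc)
  then have "integral {p..q} (\<lambda>s. B 0 s * (g s * g r)) = 0"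
    using integral_mult_left[of "{p..q}" "\<lambda>s. B 0 s * g s" "g r"] by (simp add: mult.assoc)
  moreover have "continuous_on {p..q} (\<lambda>s. B 0 s * (g s * g r))"
    by (intro continuous_on_mult continuous_on_subset[OF derivs_on_continuous[OF B(1)]]
        continuous_on_subset[OF cgr]) (use sub in auto)
  moreover have "0 \<le> B 0 s * (g s * g r)" if "s \<in> {p..q}" for s
    using that sub B(2)[of s 0] B(3)[of s] by (cases "s \<in> {p<..<q}") (auto simp: less_imp_le subset_iff)
  ultimately have "\<forall>s\<in>{p..q}. B 0 s * (g s * g r) = 0"
    using integral_eq_0_iff[of p q "\<lambda>s. B 0 s * (g s * g r)"] pq by blast
  then have "B 0 r * (g r * g r) = 0" using pq(4) by auto
  with B(3)[OF pq(4)] gr show False by simp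
qed

section \<open>The Euler-Lagrange equation at the pole\<close>

text \<open>The equation is invariant under dilations, since \<open>f \<mapsto> f (\<lambda> \<cdot>) / \<lambda>\<close> only rescales the metric:
  every monomial has weight zero when \<open>f\<^sup>(\<^sup>j\<^sup>)\<close> is given the weight \<open>j - 1\<close>.\<close>

lemma triharmonic_poly_homogeneous:
  assumes "t \<noteq> 0"
  shows "triharmonic_poly m a (\<lambda>j. t ^ j * z j / t) = triharmonic_poly m a z"
proof -
  have "z 0 ^ 3 * (t ^ 4 * z 4 / t) / t ^ 3 = z 0 ^ 3 * z 4"
    using assms by (simp add: field_simps eval_nat_numeral)
  then show ?thesis
    unfolding triharmonic_poly_def Let_def using assms
    by (simp add: field_simps power2_eq_square power3_eq_cube eval_nat_numeral)
qed

lemma triharmonic_poly_tendsto: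
  assumes "\<And>j. ((\<lambda>t. z t j) \<longlongrightarrow> l j) G"
  shows "((\<lambda>t. triharmonic_poly m a (z t)) \<longlongrightarrow> triharmonic_poly m a l) G"
  unfolding triharmonic_poly_def Let_def by (intro tendsto_intros assms)

lemma power_series_tendsto_at_right_0:
  fixes b :: "nat \<Rightarrow> real"
  assumes "0 < d" "\<And>t. t \<in> {0<..<d} \<Longrightarrow> (\<lambda>i. b i * t ^ i) sums g t"
  shows "(g \<longlongrightarrow> b 0) (at_right 0)"
proof -
  have "summable (\<lambda>i. b i * (d / 2) ^ i)"
    using assms(2)[of "d / 2"] assms(1) by (auto simp: sums_iff)
  then have "isCont (\<lambda>t. \<Sum>i. b i * t ^ i) 0"
    by (rule isCont_powser) (use assms(1) in auto)
  then have "((\<lambda>t. \<Sum>i. b i * t ^ i) \<longlongrightarrow> b 0) (at 0)"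
    by (simp add: isCont_def powser_zero)
  then have "((\<lambda>t. \<Sum>i. b i * t ^ i) \<longlongrightarrow> b 0) (at_right 0)"
    by (rule tendsto_within_subset) simp
  moreover have "\<forall>\<^sub>F t in at_right 0. (\<Sum>i. b i * t ^ i) = g t"
    unfolding eventually_at_right_field using assms by (intro exI[of _ d]) (auto simp: sums_iff)
  ultimately show ?thesis by (rule Lim_transform_eventually)
qed

section \<open>Power series solutions and unique continuation\<close>

text \<open>Applying \<open>t d/dt\<close> to a power series multiplies the coefficient of \<open>t\<^sup>i\<close> by \<open>i\<close>, and
  \<open>t\<^bsup>j+1\<^esup> U\<^sup>(\<^sup>j\<^sup>+\<^sup>1\<^sup>) = (t d/dt - j) (t\<^sup>j U\<^sup>(\<^sup>j\<^sup>))\<close>.\<close>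

lemma power_series_derivs:
  fixes c :: "nat \<Rightarrow> real"
  assumes U: "derivs_on {0<..<d} U"
    and c: "\<And>t. t \<in> {0<..<d} \<Longrightarrow> (\<lambda>i. c i * t ^ i) sums U 0 t"
    and t: "t \<in> {0<..<d}"
  shows "(\<lambda>i. c i * (\<Prod>l<j. real i - real l) * t ^ i) sums (t ^ j * U j t)"
  using t
proof (induction j arbitrary: t)
  case 0
  then show ?case using c by simp
next
  case (Suc j)
  define b where "b i = c i * (\<Prod>l<j. real i - real l)" for i
  have b: "(\<lambda>i. b i * s ^ i) sums (s ^ j * U j s)" if "s \<in> {0<..<d}" for s
    using Suc.IH[OF that] by (simp add: b_def)
  obtain K where K: "t < K" "K < d" using dense[of t d] Suc.prems by auto
  have sK: "summable (\<lambda>i. b i * K ^ i)"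
    using b[of K] K Suc.prems by (auto simp: sums_iff)
  have "((\<lambda>s. \<Sum>i. b i * s ^ i) has_real_derivative (\<Sum>i. diffs b i * t ^ i)) (at t)"
    by (rule termdiffs_strong[OF sK]) (use K Suc.prems in auto)
  then have "((\<lambda>s. s ^ j * U j s) has_real_derivative (\<Sum>i. diffs b i * t ^ i)) (at t)"
    by (rule has_field_derivative_transform_within_open[of _ _ _ "{0<..<d}"])
      (use Suc.prems b in \<open>auto simp: sums_iff\<close>)
  moreover have "((\<lambda>s. s ^ j * U j s) has_real_derivative
      (real j * t ^ (j - 1)) * U j t + U (Suc j) t * t ^ j) (at t)"
    by (rule DERIV_mult) (auto intro!: derivative_eq_intros derivs_onD[OF U Suc.prems])
  ultimately have eq: "(\<Sum>i. diffs b i * t ^ i) = (real j * t ^ (j - 1)) * U j t + U (Suc j) t * t ^ j"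
    by (rule DERIV_unique)
  have "summable (\<lambda>i. diffs b i * t ^ i)"
    by (rule termdiff_converges[of _ K]) (use K Suc.prems powser_inside[OF sK] in auto)
  from diffs_equiv[OF this]
  have "(\<lambda>i. t * (of_nat i * b i * t ^ (i - Suc 0))) sums (t * (\<Sum>i. diffs b i * t ^ i))"
    by (rule sums_mult)
  also have "(\<lambda>i. t * (of_nat i * b i * t ^ (i - Suc 0))) = (\<lambda>i. real i * b i * t ^ i)"
    by (rule ext, rename_tac i, case_tac i) auto
  also have "t * (\<Sum>i. diffs b i * t ^ i) = real j * (t ^ j * U j t) + t ^ Suc j * U (Suc j) t"
    unfolding eq by (cases j) (auto simp: algebra_simps)
  finally have "(\<lambda>i. real i * b i * t ^ i - real j * (b i * t ^ i)) sums
      (real j * (t ^ j * U j t) + t ^ Suc j * U (Suc j) t - real j * (t ^ j * U j t))"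
    by (intro sums_diff sums_mult b Suc.prems)
  then show ?case
    by (simp add: b_def algebra_simps)
qed

lemma power_series_leading_term:
  fixes c :: "nat \<Rightarrow> real"
  assumes d: "0 < d" and U: "derivs_on {0<..<d} U"
    and c: "\<And>t. t \<in> {0<..<d} \<Longrightarrow> (\<lambda>i. c i * t ^ i) sums U 0 t"
    and K: "\<And>i. i < K \<Longrightarrow> c i = 0"
  shows "((\<lambda>t. t ^ j * U j t / t ^ K) \<longlongrightarrow> c K * (\<Prod>l<j. real K - real l)) (at_right 0)"
proof -
  define b where "b i = c i * (\<Prod>l<j. real i - real l)" for i
  have "(\<lambda>i. b (i + K) * t ^ i) sums (t ^ j * U j t / t ^ K)" if t: "t \<in> {0<..<d}" for t
  proof -
    have "(\<lambda>i. b i * t ^ i) sums (t ^ j * U j t)"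
      using power_series_derivs[OF U c t] by (simp add: b_def)
    then have "(\<lambda>i. b (i + K) * t ^ (i + K)) sums (t ^ j * U j t - (\<Sum>i<K. b i * t ^ i))"
      by (rule sums_split_initial_segment)
    also have "(\<Sum>i<K. b i * t ^ i) = 0" by (rule sum.neutral) (simp add: b_def K)
    finally have "(\<lambda>i. b (i + K) * t ^ (i + K)) sums (t ^ j * U j t)" by simp
    from sums_divide[OF this, of "t ^ K"] show ?thesis
      using t by (simp add: power_add)
  qed
  from power_series_tendsto_at_right_0[OF d this] show ?thesis by (simp add: b_def)
qed

lemma cos_double_bounds:
  assumes "0 < a" "a < pi / 2"
  shows "- 1 < cos (2 * a)" "cos (2 * a) < 1"
  using assms cos_monotone_0_pi[of 0 "2 * a"] cos_monotone_0_pi[of "2 * a" pi] by auto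

text \<open>In terms of \<open>e = 1 + cos (2 a) > 0\<close> the value is a difference of products in which the negative
  one dominates once \<open>3 m - 20\<close> is positive, as it is for \<open>m \<ge> 7\<close>.\<close>

lemma pole_condition_fails_above_dim_7:
  fixes m :: real
  assumes a: "0 < a" "a < pi / 2" and m: "7 \<le> m"
  shows "triharmonic_poly m a (\<lambda>j. if j \<le> 1 then 1 else 0) \<noteq> 0"
proof -
  \<comment> \<open>vanishes at the excluded end point \<open>a = \<pi> / 2\<close>\<close>
  define e where "e = 1 + cos (2 * a)"
  have e: "0 < e" "e < 2" using cos_double_bounds[OF a] by (auto simp: e_def)
  have c: "(cos a)\<^sup>2 = e / 2" by (simp add: e_def cos_double_cos)
  have C: "cos (2 * a) = e - 1" by (simp add: e_def)
  have "triharmonic_poly m a (\<lambda>j. if j \<le> 1 then 1 else 0)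
      = m\<^sup>2 * e * (2 - e) / 4 - (2 * (m - 3) + m * e / 2) * (3 * m - 20 + m * e)"
    unfolding triharmonic_poly_def Let_def c C by (simp add: field_simps power2_eq_square)
  also have "\<dots> < 0"
  proof -
    define P where "P = (2 * (m - 3) + m * e / 2) * (3 * m - 20 + m * e)"
    have "2 * (m - 3) * (m * e) < P"
      unfolding P_def using e m by (intro mult_strict_mono) (auto intro!: add_pos_nonneg)
    moreover have "m\<^sup>2 * e * (2 - e) / 4 \<le> m\<^sup>2 * e * 2 / 4"
      using e by (intro divide_right_mono mult_left_mono) auto
    moreover have "m\<^sup>2 * e * 2 / 4 = m * e * (m / 2)" by (simp add: power2_eq_square)
    moreover have "m * e * (m / 2) \<le> m * e * (2 * (m - 3))"
      using e m by (intro mult_left_mono) auto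
    moreover have "m * e * (2 * (m - 3)) = 2 * (m - 3) * (m * e)" by simp
    ultimately show ?thesis unfolding P_def[symmetric] by linarith
  qed
  finally show ?thesis by simp
qed

text \<open>For \<open>m = 6\<close> the condition is a quadratic equation for \<open>cos (2 a)\<close>.  Only the larger root lies in
  the range of the cosine.  The bounds on the root are those that the indicial polynomial below
  needs.\<close>

lemma pole_condition_dim_7:
  assumes a: "0 < a" "a < pi / 2"
    and p: "triharmonic_poly 6 a (\<lambda>j. if j \<le> 1 then 1 else 0) = 0"
  shows "9 * (cos (2 * a))\<^sup>2 + 22 * cos (2 * a) + 9 = 0"
    and "- 5 / 9 < cos (2 * a)" and "cos (2 * a) < - 1 / 2"
    and "a = 1 / 2 * arccos (1 / 9 * (2 * sqrt 10 - 11))"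
proof -
  define C where "C = cos (2 * a)"
  have C1: "- 1 < C" using cos_double_bounds[OF a] by (simp add: C_def)
  have c: "(cos a)\<^sup>2 = (1 + C) / 2" by (simp add: C_def cos_double_cos)
  have eq: "9 * C\<^sup>2 + 22 * C + 9 = 0"
    using p by (simp add: triharmonic_poly_def Let_def c flip: C_def)
      (simp add: field_simps power2_eq_square)
  then show "9 * (cos (2 * a))\<^sup>2 + 22 * cos (2 * a) + 9 = 0" by (simp add: C_def)
  \<comment> \<open>completing the square\<close>
  have sq: "(9 * C + 11)\<^sup>2 = 40" using eq by (simp add: power2_eq_square algebra_simps)
  have pos: "0 < 9 * C + 11" using C1 by simp
  have "9 * C + 11 = sqrt 40" using sq pos by (metis real_sqrt_unique less_imp_le)
  also have "sqrt 40 = 2 * sqrt 10" using real_sqrt_mult[of 4 10] by simp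
  finally have C_eq: "C = 1 / 9 * (2 * sqrt 10 - 11)" by simp
  have "2 * a = arccos C" using a by (simp add: C_def arccos_cos)
  then show "a = 1 / 2 * arccos (1 / 9 * (2 * sqrt 10 - 11))"
    unfolding C_eq by linarith
  \<comment> \<open>\<open>6\<^sup>2 < 40 < (13/2)\<^sup>2\<close>\<close>
  have "6 < 9 * C + 11" by (rule power_less_imp_less_base[of _ 2]) (use sq pos in auto)
  then show "- 5 / 9 < cos (2 * a)" by (simp add: C_def)
  have "9 * C + 11 < 13 / 2"
    by (rule power_less_imp_less_base[of _ 2]) (use sq in \<open>auto simp: power2_eq_square\<close>)
  then show "cos (2 * a) < - 1 / 2" by (simp add: C_def)
qed

text \<open>For the root found above the constant terms cancel.  The equation becomes linear and homogeneous
  in \<open>(f' - 1, f'', f''', f\<^sup>(\<^sup>4\<^sup>))\<close>, with coefficients that depend on the solution.  Both the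
  comparison of leading terms and the uniqueness argument start from this form.\<close>

lemma triharmonic_poly_6_linear_form:
  assumes "9 * (cos (2 * a))\<^sup>2 + 22 * cos (2 * a) + 9 = 0"
  defines "C \<equiv> cos (2 * a)"
  shows "triharmonic_poly 6 a z = 2 * z 0 ^ 3 * z 4 + 12 * (z 0)\<^sup>2 * z 1 * z 3
     + (6 * (z 0)\<^sup>2 * z 2 - 60 * z 0 * (z 1)\<^sup>2 - (12 + 24 * C) * z 0) * z 2
     - (24 * (z 1 + 1) * ((z 1)\<^sup>2 + 1) + (12 + 48 * C) * (z 1 + 1)) * (z 1 - 1)"
proof -
  have c: "(cos a)\<^sup>2 = (1 + C) / 2" by (simp add: C_def cos_double_cos)
  have "9 * C\<^sup>2 + 22 * C + 9 = 0" using assms(1) by (simp add: C_def)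
  moreover have "triharmonic_poly 6 a z = 2 * z 0 ^ 3 * z 4 + 12 * (z 0)\<^sup>2 * z 1 * z 3
     + (6 * (z 0)\<^sup>2 * z 2 - 60 * z 0 * (z 1)\<^sup>2 - (12 + 24 * C) * z 0) * z 2
     - 24 * z 1 ^ 4 - (12 + 48 * C) * (z 1)\<^sup>2 + (9 - 18 * C - 27 * C\<^sup>2)"
    by (simp add: triharmonic_poly_def Let_def c flip: C_def)
      (simp add: field_simps power2_eq_square eval_nat_numeral)
  ultimately show ?thesis by algebra
qed

text \<open>This is the factor that the linearised equation at \<open>f \<rho> = \<rho>\<close> attaches to the perturbation
  \<open>\<rho>\<^sup>K\<close>, divided by \<open>K\<close>.  It is negative for \<open>K \<le> 6\<close>, where \<open>K = 6\<close> is the case that needs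
  \<open>-5/9 < C\<close>, and positive for \<open>K \<ge> 7\<close>.\<close>

lemma indicial_polynomial_nonzero:
  fixes C :: real
  assumes "- 5 / 9 < C" "C < - 1 / 2" "2 \<le> K"
  defines "k \<equiv> real K"
  shows "2 * (k - 1) * (k - 2) * (k - 3) + 12 * (k - 1) * (k - 2)
           - (72 + 24 * C) * (k - 1) - (120 + 96 * C) \<noteq> 0"
proof -
  have eq: "2 * (k - 1) * (k - 2) * (k - 3) + 12 * (k - 1) * (k - 2)
           - (72 + 24 * C) * (k - 1) - (120 + 96 * C)
     = (k + 3) * (2 * ((k - 1) * (k - 2)) - 72 - 24 * C) + 168"
    by (simp add: algebra_simps)
  consider "K = 2" | "K = 3" | "K = 4" | "K = 5" | "K = 6" | "7 \<le> K" using assms(3) by linarith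
  then show ?thesis
  proof cases
    case 6
    then have "6 * 5 \<le> (k - 1) * (k - 2)" by (intro mult_mono) (auto simp: k_def)
    then have "0 \<le> (k + 3) * (2 * ((k - 1) * (k - 2)) - 72 - 24 * C)"
      using assms(2) by (intro mult_nonneg_nonneg) (auto simp: k_def)
    then show ?thesis unfolding eq by simp
  qed (use assms(1) in \<open>auto simp: k_def\<close>)
qed

text \<open>The square sum \<open>E\<close> of the deviations from the identity solution satisfies \<open>E' \<le> M E\<close> on compact
  intervals, so that \<open>E exp (- M s)\<close> decreases from zero.\<close>

lemma linear_ode_unique_continuation:
  fixes F :: "nat \<Rightarrow> real \<Rightarrow> real"
  assumes F: "derivs_on {0<..<1} F"
    and ode: "\<And>t. t \<in> {0<..<1} \<Longrightarrow> F 4 t = \<alpha> t * (F 1 t - 1) + \<beta> t * F 2 t + \<gamma> t * F 3 t"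
    and cont: "continuous_on {0<..<1} \<alpha>" "continuous_on {0<..<1} \<beta>" "continuous_on {0<..<1} \<gamma>"
    and t0: "t0 \<in> {0<..<1}" "F 0 t0 = t0" "F 1 t0 = 1" "F 2 t0 = 0" "F 3 t0 = 0"
    and t: "t0 \<le> t" "t < 1"
  shows "F 0 t = t"
proof -
  define E where "E s = (F 0 s - s)\<^sup>2 + (F 1 s - 1)\<^sup>2 + (F 2 s)\<^sup>2 + (F 3 s)\<^sup>2" for s
  have sub: "{t0..t} \<subseteq> {0<..<1}" using t0 t by auto
  have "\<exists>L. \<forall>s\<in>{t0..t}. \<bar>g s\<bar> \<le> L" if "continuous_on {0<..<1} g" for g :: "real \<Rightarrow> real"
  proof -
    have "compact (g ` {t0..t})"
      using continuous_on_subset[OF that sub] by (intro compact_continuous_image) auto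
    then have "bounded (g ` {t0..t})" by (rule compact_imp_bounded)
    then show ?thesis unfolding bounded_iff by auto
  qed
  from this[OF cont(1)] this[OF cont(2)] this[OF cont(3)] obtain L1 L2 L3 where
    "\<forall>s\<in>{t0..t}. \<bar>\<alpha> s\<bar> \<le> L1" "\<forall>s\<in>{t0..t}. \<bar>\<beta> s\<bar> \<le> L2" "\<forall>s\<in>{t0..t}. \<bar>\<gamma> s\<bar> \<le> L3" by blast
  then have L: "\<bar>\<alpha> s\<bar> \<le> L1" "\<bar>\<beta> s\<bar> \<le> L2" "\<bar>\<gamma> s\<bar> \<le> L3" if "s \<in> {t0..t}" for s
    using that by auto
  define M where "M = 2 + L1 + L2 + 2 * L3"
  define E' where "E' s = 2 * (F 0 s - s) * (F 1 s - 1) + 2 * (F 1 s - 1) * F 2 s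
      + 2 * F 2 s * F 3 s + 2 * F 3 s * F 4 s" for s
  have dE: "(E has_real_derivative E' s) (at s)" if "s \<in> {0<..<1}" for s
    unfolding E_def[abs_def] E'_def
    by (rule derivative_eq_intros derivs_on_numerals[OF F that] refl)+ (simp add: algebra_simps)
  have amgm: "2 * x * y \<le> x\<^sup>2 + y\<^sup>2" for x y :: real
    using sum_squares_bound[of x y] by simp
  have coeff: "2 * x * (k * y) \<le> l * (x\<^sup>2 + y\<^sup>2)" if "\<bar>k\<bar> \<le> l" for x y k l :: real
  proof -
    have "2 * x * (k * y) \<le> \<bar>k\<bar> * (2 * \<bar>x\<bar> * \<bar>y\<bar>)"
      using abs_ge_self[of "2 * x * (k * y)"] by (simp add: abs_mult mult_ac)
    also have "\<dots> \<le> l * (\<bar>x\<bar>\<^sup>2 + \<bar>y\<bar>\<^sup>2)"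
      using that amgm[of "\<bar>x\<bar>" "\<bar>y\<bar>"] by (intro mult_mono) auto
    finally show ?thesis by simp
  qed
  have E'_le: "E' s \<le> M * E s" if s: "s \<in> {t0..t}" for s
  proof -
    let ?u = "F 0 s - s" and ?v = "F 1 s - 1" and ?w = "F 2 s" and ?z = "F 3 s"
    have Lpos: "0 \<le> L1" "0 \<le> L2" "0 \<le> L3"
      using L[OF s] by (auto intro: order_trans[OF abs_ge_zero])
    have s01: "s \<in> {0<..<1}" using s sub by blast
    have "E' s = 2 * ?u * ?v + 2 * ?v * ?w + 2 * ?w * ?z
        + (2 * ?z * (\<alpha> s * ?v) + 2 * ?z * (\<beta> s * ?w) + 2 * ?z * (\<gamma> s * ?z))"
      unfolding E'_def ode[OF s01] by (simp add: algebra_simps)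
    also have "\<dots> \<le> (?u\<^sup>2 + ?v\<^sup>2) + (?v\<^sup>2 + ?w\<^sup>2) + (?w\<^sup>2 + ?z\<^sup>2)
        + (L1 * (?z\<^sup>2 + ?v\<^sup>2) + L2 * (?z\<^sup>2 + ?w\<^sup>2) + L3 * (?z\<^sup>2 + ?z\<^sup>2))"
      by (intro add_mono amgm coeff L s)
    also have "\<dots> \<le> 2 * E s + (L1 * E s + L2 * E s + L3 * (2 * E s))"
      using Lpos by (intro add_mono mult_left_mono) (auto simp: E_def)
    finally show ?thesis by (simp add: M_def algebra_simps)
  qed
  have "E t * exp (- M * t) \<le> E t0 * exp (- M * t0)"
  proof (rule DERIV_nonpos_imp_nonincreasing[OF t(1)])
    fix s assume "t0 \<le> s" "s \<le> t"
    then have s: "s \<in> {t0..t}" "s \<in> {0<..<1}" using sub by auto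
    have "((\<lambda>s. E s * exp (- M * s)) has_real_derivative (E' s - M * E s) * exp (- M * s)) (at s)"
      by (rule derivative_eq_intros dE s refl)+ (simp add: algebra_simps)
    moreover have "(E' s - M * E s) * exp (- M * s) \<le> 0"
      using E'_le[OF s(1)] by (simp add: mult_nonpos_nonneg)
    ultimately show "\<exists>y. ((\<lambda>s. E s * exp (- M * s)) has_real_derivative y) (at s) \<and> y \<le> 0"
      by blast
  qed
  also have "E t0 = 0" unfolding E_def t0(2-5) by simp
  finally have "E t \<le> 0" by (simp add: mult_le_0_iff)
  moreover have "(F 0 t - t)\<^sup>2 \<le> E t" by (simp add: E_def)
  ultimately have "(F 0 t - t)\<^sup>2 \<le> 0" by linarith
  then show ?thesis by simp
qed

section \<open>Warping functions that solve the equation\<close>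

text \<open>The one-sided derivatives of the definition are ordinary ones inside the interval; at the pole they
  provide continuity up to the boundary.\<close>

lemma warping_function_derivs:
  assumes "warping_function I f"
  defines "S \<equiv> insert 0 I"
  defines "F \<equiv> \<lambda>k. nderiv_within S k f"
  shows "{0<..<1} \<subseteq> I" "I \<subseteq> {0..1}"
    and "derivs_on {0<..<1} F"
    and "F 0 = f" "F 1 0 = 1"
    and "continuous_on S (F k)"
    and "(f has_real_derivative 1) (at 0 within S)"
proof -
  have I: "is_interval I" "closure I = {0..1}"
    and diff: "\<And>k t. t \<in> S \<Longrightarrow> F k differentiable (at t within S)"
    and F1: "F 1 0 = 1"
    using assms(1) by (auto simp: warping_function_def S_def F_def)
  have "interior (closure I) = interior I"
    by (rule convex_interior_closure[OF is_interval_convex[OF I(1)]])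
  then have int: "interior I = {0<..<1}" by (simp add: I(2) interior_atLeastAtMost_real)
  then show I01: "{0<..<1} \<subseteq> I" using interior_subset[of I] by simp
  show "I \<subseteq> {0..1}" using closure_subset[of I] by (simp add: I(2))
  show F0: "F 0 = f" by (simp add: F_def nderiv_within_def)
  show "F 1 0 = 1" by (rule F1)
  show "continuous_on S (F k)"
    using diff differentiable_imp_continuous_on[of "F k" S] by (simp add: differentiable_on_def)
  have deriv: "(F k has_real_derivative F (Suc k) t) (at t within S)" if "t \<in> S" for k t
    using diff[OF that, of k] unfolding has_real_derivative_iff_has_vector_derivative
    by (simp add: vector_derivative_works F_def nderiv_within_def)
  have at_eq: "at t within S = at t" if "t \<in> {0<..<1}" for t
    by (rule at_within_open_subset[OF that open_greaterThanLessThan]) (use I01 in \<open>auto simp: S_def\<close>)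
  show "derivs_on {0<..<1} F"
    unfolding derivs_on_def
  proof (intro allI ballI)
    fix k r assume r: "r \<in> {0<..<1::real}"
    then have "r \<in> S" using I01 by (auto simp: S_def)
    from deriv[OF this, of k] show "(F k has_real_derivative F (Suc k) r) (at r)"
      by (simp add: at_eq[OF r])
  qed
  show "(f has_real_derivative 1) (at 0 within S)"
    using deriv[of 0 0] F1 F0 by (simp add: S_def)
qed

text \<open>The blow-up of the warping function at the pole is the Euclidean one, \<open>\<rho> \<mapsto> \<rho>\<close>.\<close>

lemma warping_function_limits_at_pole:
  assumes "warping_function I f"
  defines "F \<equiv> \<lambda>k. nderiv_within (insert 0 I) k f"
  shows "((\<lambda>t. t ^ j * F j t / t) \<longlongrightarrow> (if j \<le> 1 then 1 else 0)) (at_right 0)"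
proof -
  have Fk: "nderiv_within (insert 0 I) k f = F k" for k by (simp add: F_def)
  note W = warping_function_derivs[OF assms(1), unfolded Fk]
  let ?S = "insert 0 I"
  have right: "at_right 0 = at 0 within {0<..<1::real}"
    by (rule at_within_nhd[of _ "{-1<..<1}"]) auto
  have sub: "{0<..<1} \<subseteq> ?S" using W(1) by auto
  have F0: "((\<lambda>t. F 0 t / t) \<longlongrightarrow> 1) (at_right 0)"
  proof -
    have "((\<lambda>t. (f t - f 0) / (t - 0)) \<longlongrightarrow> 1) (at 0 within ?S)"
      using W(7) by (simp add: has_field_derivative_iff)
    moreover have "f 0 = 0" using assms(1) by (simp add: warping_function_def)
    ultimately show ?thesis
      unfolding right W(4) by (intro tendsto_within_subset[OF _ sub]) simp
  qed
  have Fk: "(F k \<longlongrightarrow> F k 0) (at_right 0)" for k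
    unfolding right using W(6)[of k]
    by (intro tendsto_within_subset[OF _ sub]) (auto simp: continuous_on_def)
  have id: "((\<lambda>t. t) \<longlongrightarrow> 0) (at_right (0::real))" by (rule tendsto_ident_at)
  consider "j = 0" | "j = 1" | i where "j = Suc (Suc i)"
    by (metis One_nat_def not0_implies_Suc)
  then show ?thesis
  proof cases
    case 1
    then show ?thesis using F0 by simp
  next
    case 2
    have "((\<lambda>t. t ^ j * F j t / t) \<longlongrightarrow> F 1 0) (at_right 0)"
      by (rule Lim_transform_eventually[OF Fk])
        (auto simp: 2 eventually_at_filter intro!: always_eventually)
    then show ?thesis using 2 W(5) by simp
  next
    case 3
    have "((\<lambda>t. t ^ Suc i * F j t) \<longlongrightarrow> 0 ^ Suc i * F j 0) (at_right 0)"
      by (intro tendsto_mult tendsto_power id Fk)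
    then have "((\<lambda>t. t ^ j * F j t / t) \<longlongrightarrow> 0 ^ Suc i * F j 0) (at_right 0)"
      by (rule Lim_transform_eventually)
        (auto simp: 3 eventually_at_filter intro!: always_eventually)
    then show ?thesis using 3 by simp
  qed
qed

text \<open>By homogeneity the equation passes to the blow-up: a solution with a smooth pole exists only if
  the Euclidean warping function satisfies the equation as well.\<close>

lemma triharmonic_pole_condition:
  assumes W: "warping_function I f"
  defines "F \<equiv> \<lambda>k. nderiv_within (insert 0 I) k f"
  assumes ode: "\<And>t. t \<in> {0<..<1} \<Longrightarrow> triharmonic_poly m a (\<lambda>k. F k t) = 0"
  shows "triharmonic_poly m a (\<lambda>j. if j \<le> 1 then 1 else 0) = 0"
proof (rule tendsto_unique)
  show "((\<lambda>t. triharmonic_poly m a (\<lambda>j. t ^ j * F j t / t))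
      \<longlongrightarrow> triharmonic_poly m a (\<lambda>j. if j \<le> 1 then 1 else 0)) (at_right 0)"
    using warping_function_limits_at_pole[OF W] unfolding F_def by (rule triharmonic_poly_tendsto)
  show "((\<lambda>t. triharmonic_poly m a (\<lambda>j. t ^ j * F j t / t)) \<longlongrightarrow> 0) (at_right 0)"
    by (rule Lim_transform_eventually[OF tendsto_const], unfold eventually_at_right_field)
      (auto simp: triharmonic_poly_homogeneous ode intro!: exI[of _ 1])
qed simp

text \<open>If \<open>f \<rho> - \<rho>\<close> had a first non-zero coefficient \<open>b\<^sub>K\<close>, then the leading term of the equation would
  be \<open>b\<^sub>K\<close> times a non-zero value of the indicial polynomial.\<close>

lemma analytic_solution_euclidean_near_pole:
  assumes W: "warping_function I f" and an: "analytic_near_0 f"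
    and C: "9 * (cos (2 * a))\<^sup>2 + 22 * cos (2 * a) + 9 = 0" "- 5 / 9 < cos (2 * a)" "cos (2 * a) < - 1 / 2"
  defines "F \<equiv> \<lambda>k. nderiv_within (insert 0 I) k f"
  assumes ode: "\<And>t. t \<in> {0<..<1} \<Longrightarrow> triharmonic_poly 6 a (\<lambda>k. F k t) = 0"
  obtains d where "0 < d" "d \<le> 1"
    "\<And>t. t \<in> {0<..<d} \<Longrightarrow> F 0 t = t \<and> F 1 t = 1 \<and> F 2 t = 0 \<and> F 3 t = 0"
proof -
  have Fk: "nderiv_within (insert 0 I) k f = F k" for k by (simp add: F_def)
  note W' = warping_function_derivs[OF W, unfolded Fk]
  note lim = warping_function_limits_at_pole[OF W, unfolded Fk]
  from an obtain d0 c where d0: "0 < d0" "\<And>t. t \<in> {0..<d0} \<Longrightarrow> (\<lambda>k. c k * t ^ k) sums f t"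
    unfolding analytic_near_0_def by blast
  define d where "d = min d0 1"
  have d: "0 < d" "d \<le> 1" "d \<le> d0" using d0(1) by (auto simp: d_def)
  have c0: "c 0 = 0"
    using d0(2)[of 0] d0(1) W by (simp add: warping_function_def)
  have c1: "c 1 = 1"
  proof (rule tendsto_unique)
    have "(\<lambda>i. c (Suc i) * t ^ i) sums (F 0 t / t)" if "t \<in> {0<..<d}" for t
    proof -
      have "(\<lambda>i. c (Suc i) * t ^ Suc i) sums F 0 t"
        using d0(2)[of t] that d sums_Suc_iff[of "\<lambda>k. c k * t ^ k" "f t"] by (simp add: c0 W'(4))
      from sums_divide[OF this, of t] show ?thesis using that by simp
    qed
    from power_series_tendsto_at_right_0[OF d(1) this]
    show "((\<lambda>t. F 0 t / t) \<longlongrightarrow> c 1) (at_right 0)" by simp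
    show "((\<lambda>t. F 0 t / t) \<longlongrightarrow> 1) (at_right 0)" using lim[of 0] by simp
  qed simp
  \<comment> \<open>the derivatives of the deviation \<open>f \<rho> - \<rho>\<close>\<close>
  define U where "U j t = F j t - (if j = 0 then t else if j = 1 then 1 else 0)" for j t
  define b where "b i = (if i \<le> 1 then 0 else c i)" for i
  have U: "derivs_on {0<..<d} U"
    unfolding derivs_on_def
  proof (intro allI ballI)
    fix k r assume "r \<in> {0<..<d}"
    then have "(F k has_real_derivative F (Suc k) r) (at r)"
      using derivs_onD[OF W'(3), of r k] d by auto
    then show "(U k has_real_derivative U (Suc k) r) (at r)"
      unfolding U_def[abs_def] by (auto intro!: derivative_eq_intros)
  qed
  have b: "(\<lambda>i. b i * t ^ i) sums U 0 t" if "t \<in> {0<..<d}" for t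
  proof -
    have "(\<lambda>k. c k * t ^ k - (if k = 1 then t else 0)) sums (f t - t)"
      using d0(2)[of t] that d sums_single[of 1 "\<lambda>_. t"] by (intro sums_diff) auto
    also have "(\<lambda>k. c k * t ^ k - (if k = 1 then t else 0)) = (\<lambda>i. b i * t ^ i)"
      by (auto simp: fun_eq_iff b_def le_Suc_eq c0 c1[simplified])
    finally show ?thesis by (simp add: U_def W'(4))
  qed
  have "b i = 0" for i
  proof (rule ccontr)
    assume "b i \<noteq> 0"
    define K where "K = (LEAST i. b i \<noteq> 0)"
    have K: "b K \<noteq> 0" "\<And>i. i < K \<Longrightarrow> b i = 0"
      unfolding K_def by (rule LeastI[of "\<lambda>i. b i \<noteq> 0"], rule \<open>b i \<noteq> 0\<close>) (drule not_less_Least, simp)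
    have K2: "2 \<le> K" using K(1) by (auto simp: b_def split: if_splits)
    define C where "C = cos (2 * a)"
    \<comment> \<open>\<open>z\<close> are the weight-zero variables of the homogeneous equation, and \<open>y\<close> the deviations of the
        \<open>z\<close> from their limits, up to the common factor \<open>t\<^bsup>K-1\<^esup>\<close>\<close>
    define z where "z j t = t ^ j * F j t / t" for j t
    define y where "y j t = t ^ j * U j t / t ^ K" for j t
    define k where "k = real K"
    define Y where "Y j = b K * (\<Prod>l<j. k - real l)" for j
    have zlim: "(z j \<longlongrightarrow> (if j \<le> 1 then 1 else 0)) (at_right 0)" for j
      using lim[of j] by (simp add: z_def[abs_def])
    have ylim: "(y j \<longlongrightarrow> Y j) (at_right 0)" for j
      using power_series_leading_term[OF d(1) U b K(2)] by (simp add: y_def[abs_def] Y_def k_def)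
    \<comment> \<open>the linear form of the equation, divided by this common factor\<close>
    define P where "P t = 2 * z 0 t ^ 3 * y 4 t + 12 * (z 0 t)\<^sup>2 * z 1 t * y 3 t
       + (6 * (z 0 t)\<^sup>2 * z 2 t - 60 * z 0 t * (z 1 t)\<^sup>2 - (12 + 24 * C) * z 0 t) * y 2 t
       - (24 * (z 1 t + 1) * ((z 1 t)\<^sup>2 + 1) + (12 + 48 * C) * (z 1 t + 1)) * y 1 t" for t
    have "P t = 0" if t: "t \<in> {0<..<d}" for t
    proof -
      have t': "t \<in> {0<..<1}" "t \<noteq> 0" using t d by auto
      define T where "T = t ^ K / t"
      have T: "T \<noteq> 0" using t' by (simp add: T_def)
      have z: "z j t = T * y j t" if "2 \<le> j" for j
        using that t' by (simp add: z_def y_def T_def U_def)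
      have z1: "z 1 t - 1 = T * y 1 t"
        using t' by (simp add: z_def y_def T_def U_def field_simps)
      have "triharmonic_poly 6 a (\<lambda>j. z j t) = 0"
        unfolding z_def triharmonic_poly_homogeneous[OF t'(2)] by (rule ode[OF t'(1)])
      then have "2 * z 0 t ^ 3 * (T * y 4 t) + 12 * (z 0 t)\<^sup>2 * z 1 t * (T * y 3 t)
       + (6 * (z 0 t)\<^sup>2 * z 2 t - 60 * z 0 t * (z 1 t)\<^sup>2 - (12 + 24 * C) * z 0 t) * (T * y 2 t)
       - (24 * (z 1 t + 1) * ((z 1 t)\<^sup>2 + 1) + (12 + 48 * C) * (z 1 t + 1)) * (T * y 1 t) = 0"
        unfolding triharmonic_poly_6_linear_form[OF C(1)] C_def[symmetric] z1 using z by simp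
      then have "T * P t = 0" unfolding P_def by algebra
      with T show ?thesis by simp
    qed
    then have "\<forall>\<^sub>F t in at_right 0. 0 = P t"
      unfolding eventually_at_right_field using d(1) by (intro exI[of _ d]) auto
    then have "(P \<longlongrightarrow> 0) (at_right 0)"
      by (rule Lim_transform_eventually[OF tendsto_const])
    moreover have "(P \<longlongrightarrow> 2 * 1 ^ 3 * Y 4 + 12 * 1\<^sup>2 * 1 * Y 3
       + (6 * 1\<^sup>2 * 0 - 60 * 1 * 1\<^sup>2 - (12 + 24 * C) * 1) * Y 2
       - (24 * (1 + 1) * (1\<^sup>2 + 1) + (12 + 48 * C) * (1 + 1)) * Y 1) (at_right 0)"
      unfolding P_def[abs_def]
      by (intro tendsto_intros ylim)
        (use zlim[of 0] zlim[of 1] zlim[of 2] in simp_all)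
    ultimately have "2 * 1 ^ 3 * Y 4 + 12 * 1\<^sup>2 * 1 * Y 3
       + (6 * 1\<^sup>2 * 0 - 60 * 1 * 1\<^sup>2 - (12 + 24 * C) * 1) * Y 2
       - (24 * (1 + 1) * (1\<^sup>2 + 1) + (12 + 48 * C) * (1 + 1)) * Y 1 = 0"
      by (intro tendsto_unique[OF trivial_limit_at_right_real, symmetric])
    then have "b K * k * (2 * (k - 1) * (k - 2) * (k - 3) + 12 * (k - 1) * (k - 2)
           - (72 + 24 * C) * (k - 1) - (120 + 96 * C)) = 0"
      by (simp add: Y_def eval_nat_numeral algebra_simps)
    then show False
      using K(1) K2 indicial_polynomial_nonzero[OF C(2,3) K2] by (simp add: k_def C_def)
  qed
  then have b0: "b i = 0" for i .
  have U0: "U j t = 0" if t: "t \<in> {0<..<d}" for j t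
  proof -
    have "(\<lambda>i. 0) sums (t ^ j * U j t)"
      using power_series_derivs[OF U b t, of j] by (simp add: b0)
    then have "t ^ j * U j t = 0" by (rule sums_unique2[OF _ sums_zero])
    then show ?thesis using t by simp
  qed
  show thesis
  proof (rule that[OF d(1,2)])
    fix t assume "t \<in> {0<..<d}"
    from U0[OF this, of 0] U0[OF this, of 1] U0[OF this, of 2] U0[OF this, of 3]
    show "F 0 t = t \<and> F 1 t = 1 \<and> F 2 t = 0 \<and> F 3 t = 0"
      by (simp add: U_def)
  qed
qed

text \<open>Analyticity is available only near the pole; from there the equation itself, which determines the
  fourth derivative wherever \<open>f > 0\<close>, carries the identity \<open>f \<rho> = \<rho>\<close> through the whole
  interval.\<close>

lemma analytic_solution_euclidean:
  assumes W: "warping_function I f" and an: "analytic_near_0 f"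
    and C: "9 * (cos (2 * a))\<^sup>2 + 22 * cos (2 * a) + 9 = 0" "- 5 / 9 < cos (2 * a)" "cos (2 * a) < - 1 / 2"
  defines "F \<equiv> \<lambda>k. nderiv_within (insert 0 I) k f"
  assumes ode: "\<And>t. t \<in> {0<..<1} \<Longrightarrow> triharmonic_poly 6 a (\<lambda>k. F k t) = 0"
  shows "\<forall>\<rho>\<in>insert 0 I. f \<rho> = \<rho>"
proof -
  have Fk: "nderiv_within (insert 0 I) k f = F k" for k by (simp add: F_def)
  note W' = warping_function_derivs[OF W, unfolded Fk]
  obtain d where d: "0 < d" "d \<le> 1"
    "\<And>t. t \<in> {0<..<d} \<Longrightarrow> F 0 t = t \<and> F 1 t = 1 \<and> F 2 t = 0 \<and> F 3 t = 0"
    using analytic_solution_euclidean_near_pole[OF W an C ode[unfolded F_def], unfolded Fk] by blast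
  define C where "C = cos (2 * a)"
  define v where "v t = inverse (2 * F 0 t ^ 3)" for t
  have F0: "F 0 t \<noteq> 0" if "t \<in> {0<..<1}" for t
    using W W'(1) that unfolding warping_function_def W'(4) by force
  have cF: "continuous_on {0<..<1} (F j)" for j by (rule derivs_on_continuous[OF W'(3)])
  have cv: "continuous_on {0<..<1} v"
    unfolding v_def[abs_def] by (intro continuous_intros cF) (use F0 in auto)
  have inner: "F 0 t = t" if t: "t \<in> {0<..<1}" for t
  proof (cases "t < d")
    case True
    then show ?thesis using d(3) t by auto
  next
    case False
    show ?thesis
    proof (rule linear_ode_unique_continuation[OF W'(3), where ?t0.0 = "d / 2"])
      fix s :: real assume s: "s \<in> {0<..<1}"
      have "v s * (2 * F 0 s ^ 3) = 1" using F0[OF s] by (simp add: v_def)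
      with ode[OF s] show "F 4 s
          = v s * (24 * (F 1 s + 1) * ((F 1 s)\<^sup>2 + 1) + (12 + 48 * C) * (F 1 s + 1)) * (F 1 s - 1)
            + v s * (60 * F 0 s * (F 1 s)\<^sup>2 + (12 + 24 * C) * F 0 s - 6 * (F 0 s)\<^sup>2 * F 2 s) * F 2 s
            + v s * (- 12 * (F 0 s)\<^sup>2 * F 1 s) * F 3 s"
        unfolding triharmonic_poly_6_linear_form[OF assms(3)] C_def[symmetric] by algebra
    next
      show "continuous_on {0<..<1} (\<lambda>s. v s * (24 * (F 1 s + 1) * ((F 1 s)\<^sup>2 + 1) + (12 + 48 * C) * (F 1 s + 1)))"
        "continuous_on {0<..<1} (\<lambda>s. v s * (60 * F 0 s * (F 1 s)\<^sup>2 + (12 + 24 * C) * F 0 s - 6 * (F 0 s)\<^sup>2 * F 2 s))"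
        "continuous_on {0<..<1} (\<lambda>s. v s * (- 12 * (F 0 s)\<^sup>2 * F 1 s))"
        by (intro continuous_intros cv cF)+
      have "d / 2 \<in> {0<..<d}" using d(1) by simp
      then show "F 0 (d / 2) = d / 2" "F 1 (d / 2) = 1" "F 2 (d / 2) = 0" "F 3 (d / 2) = 0"
        using d(3)[of "d / 2"] by blast+
      show "d / 2 \<in> {0<..<1}" "d / 2 \<le> t" "t < 1" using d(1,2) False t by auto
    qed
  qed
  show ?thesis
  proof
    fix \<rho> assume \<rho>: "\<rho> \<in> insert 0 I"
    then consider "\<rho> = 0" | "\<rho> \<in> {0<..<1}" | "\<rho> = 1" "1 \<in> I" using W'(2) by fastforce
    then show "f \<rho> = \<rho>"
    proof cases
      case 1
      then show ?thesis using W by (simp add: warping_function_def)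
    next
      case 2
      then show ?thesis using inner W'(4) by simp
    next
      case 3
      have left: "at_left 1 = at 1 within {0<..<1::real}"
        by (rule at_within_nhd[of _ "{0<..<2}"]) auto
      have "(f \<longlongrightarrow> f 1) (at 1 within insert 0 I)"
        using W'(6)[of 0] 3 by (auto simp: continuous_on_def W'(4))
      then have "(f \<longlongrightarrow> f 1) (at_left 1)"
        unfolding left by (rule tendsto_within_subset) (use W'(1) in auto)
      moreover have "\<forall>\<^sub>F t in at_left 1. t = f t"
        unfolding eventually_at_left_field using inner W'(4) by (intro exI[of _ 0]) auto
      then have "(f \<longlongrightarrow> 1) (at_left 1)"
        by (rule Lim_transform_eventually[OF tendsto_ident_at])
      ultimately show ?thesis
        using 3 tendsto_unique[OF trivial_limit_at_left_real] by blast
    qed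
  qed
qed

section \<open>Weakly triharmonic maps of geodesic balls\<close>

theorem theorem6p2:
  fixes I :: "real set" and f :: "real \<Rightarrow> real" and a :: real
  assumes "7 \<le> CARD('n::finite)"
    and "warping_function I f"
    and "0 < a" and "a < pi / 2"
  shows "(weakly_triharmonic_ball f (phi a :: real^'n \<Rightarrow> (real^'n) \<times> real) \<longrightarrow> CARD('n) = 7) \<and>
         (CARD('n) = 7 \<and> analytic_near_0 f \<and>
          weakly_triharmonic_ball f (phi a :: real^'n \<Rightarrow> (real^'n) \<times> real) \<longrightarrow>
            (\<forall>\<rho>\<in>insert 0 I. f \<rho> = \<rho>) \<and> a = 1 / 2 * arccos (1 / 9 * (2 * sqrt 10 - 11)))"
proof -
  note n = assms(1) and W = assms(2) and a = assms(3,4)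
  define F where "F k = nderiv_within (insert 0 I) k f" for k
  note W' = warping_function_derivs[OF W, folded F_def]
  have pos: "0 < F 0 r" if "r \<in> {0<..<1}" for r
    using W W'(1) that unfolding warping_function_def W'(4) by blast
  have ode: "triharmonic_poly (real CARD('n) - 1) a (\<lambda>k. F k r) = 0"
    if "weakly_triharmonic_ball f (phi a :: real^'n \<Rightarrow> (real^'n) \<times> real)" "r \<in> {0<..<1}" for r
    using that n by (intro triharmonic_ode[OF W'(3) pos a])
      (auto simp: weakly_triharmonic_ball_def W'(4))
  have "CARD('n) = 7" if wt: "weakly_triharmonic_ball f (phi a :: real^'n \<Rightarrow> (real^'n) \<times> real)"
  proof (rule ccontr)
    assume "CARD('n) \<noteq> 7"
    then have "7 \<le> real CARD('n) - 1" using n by simp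
    from pole_condition_fails_above_dim_7[OF a this]
    show False using triharmonic_pole_condition[OF W ode[OF wt, unfolded F_def]] by contradiction
  qed
  moreover have "(\<forall>\<rho>\<in>insert 0 I. f \<rho> = \<rho>) \<and> a = 1 / 2 * arccos (1 / 9 * (2 * sqrt 10 - 11))"
    if n7: "CARD('n) = 7" and an: "analytic_near_0 f"
      and wt: "weakly_triharmonic_ball f (phi a :: real^'n \<Rightarrow> (real^'n) \<times> real)"
  proof -
    have ode6: "triharmonic_poly 6 a (\<lambda>k. nderiv_within (insert 0 I) k f r) = 0" if "r \<in> {0<..<1}" for r
      using ode[OF wt that] by (simp add: n7 F_def)
    note angle = pole_condition_dim_7[OF a triharmonic_pole_condition[OF W ode6]]
    show ?thesis
      using analytic_solution_euclidean[OF W an angle(1-3) ode6] angle(4) by blast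
  qed
  ultimately show ?thesis by blast
qed

end
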